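(* The following problem is NP-complete: given an $m\times n$ binary matrix $M$ and an integer $k\ge 0$, decide whether there exists a set $R'$ of rows of $M$ with $|R'|\le k$ such that the matrix obtained from $M$ by deleting the rows in $R'$ has the simultaneous consecutive ones property.
   Context: A binary matrix has the consecutive ones property (C1P) for rows if its columns can be permuted so that in every row the $1$-entries occur consecutively; it has the C1P for columns if its rows can be permuted so that in every column the $1$-entries occur consecutively. It has the simultaneous consecutive ones property (SC1P) if it has both the C1P for rows and the C1P for columns. *)

theory Defs
  imports
    "HOL-Combinatorics.Permutations"
    "HOL-Computational_Algebra.Polynomial"
    "Jordan_Normal_Form.DL_Submatrix"
begin

section \<open>Deterministic multi-tape Turing machines\<close>

text \<open>
  Control states are \<open>0, \<dots>, nstates T\<close>, where \<open>0\<close> is the initial state and \<open>nstates T\<close> is the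
  unique halting state. Tape symbols are \<open>0, \<dots>, nsymbols T - 1\<close>, where \<open>0\<close> is the blank and
  \<open>1\<close>, \<open>2\<close> stand for the bits 0 and 1. The transition function maps a non-halting state and the
  list of scanned symbols (one per tape) to the successor state and, for each tape, the symbol to
  write and the head movement. Its values elsewhere are irrelevant.
\<close>

datatype move = Move_Left | Stay | Move_Right

record tm =
  ntapes :: nat
  nstates :: nat
  nsymbols :: nat
  delta :: "nat \<Rightarrow> nat list \<Rightarrow> nat \<times> (nat \<times> move) list"

definition wf_tm :: "tm \<Rightarrow> bool" where
  "wf_tm T \<longleftrightarrow> ntapes T \<ge> 1 \<and> nsymbols T \<ge> 3 \<and>
     (\<forall>q ss. q < nstates T \<and> length ss = ntapes T \<and> set ss \<subseteq> {..<nsymbols T} \<longrightarrow>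
        (case delta T q ss of (q', as) \<Rightarrow>
           q' \<le> nstates T \<and> length as = ntapes T \<and> fst ` set as \<subseteq> {..<nsymbols T}))"

text \<open>A tape is infinite in both directions; it is given by its contents and its head position.\<close>

type_synonym tape = "(int \<Rightarrow> nat) \<times> int"
type_synonym config = "nat \<times> tape list"

fun scanned :: "tape \<Rightarrow> nat" where
  "scanned (c, h) = c h"

fun offset :: "move \<Rightarrow> int" where
  "offset Move_Left = - 1"
| "offset Stay = 0"
| "offset Move_Right = 1"

fun act :: "nat \<times> move \<Rightarrow> tape \<Rightarrow> tape" where
  "act (s, d) (c, h) = (c(h := s), h + offset d)"

text \<open>A configuration in the halting state is left unchanged.\<close>

fun step :: "tm \<Rightarrow> config \<Rightarrow> config" where
  "step T (q, ts) =
     (if q < nstates T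
      then case delta T q (map scanned ts) of (q', as) \<Rightarrow> (q', map2 act as ts)
      else (q, ts))"

definition bit_symbol :: "bool \<Rightarrow> nat" where
  "bit_symbol b = (if b then 2 else 1)"

definition tape_of :: "bool list \<Rightarrow> tape" where
  "tape_of w = (\<lambda>i. if 0 \<le> i \<and> i < int (length w) then bit_symbol (w ! nat i) else 0, 0)"

text \<open>The \<open>i\<close>-th input word is on the \<open>i\<close>-th tape; all remaining tapes are blank.\<close>

definition init_config :: "tm \<Rightarrow> bool list list \<Rightarrow> config" where
  "init_config T ws =
     (0, map (\<lambda>i. tape_of (if i < length ws then ws ! i else [])) [0..<ntapes T])"

text \<open>The output is the word on tape \<open>0\<close> from cell \<open>0\<close> up to the first blank.\<close>

definition output_word :: "config \<Rightarrow> bool list \<Rightarrow> bool" where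
  "output_word cf w \<longleftrightarrow>
     (\<forall>i<length w. fst (snd cf ! 0) (int i) = bit_symbol (w ! i)) \<and>
     fst (snd cf ! 0) (int (length w)) = 0"

definition computes_within :: "tm \<Rightarrow> bool list list \<Rightarrow> nat \<Rightarrow> bool list \<Rightarrow> bool" where
  "computes_within T ws t w \<longleftrightarrow>
     (let cf = (step T ^^ t) (init_config T ws) in fst cf = nstates T \<and> output_word cf w)"

text \<open>Functions of \<open>r\<close> words take a list of length \<open>r\<close> as argument.\<close>

definition poly_time_computable :: "nat \<Rightarrow> (bool list list \<Rightarrow> bool list) \<Rightarrow> bool" where
  "poly_time_computable r f \<longleftrightarrow>
     (\<exists>(T :: tm) (p :: nat poly). wf_tm T \<and> r \<le> ntapes T \<and>
        (\<forall>ws. length ws = r \<longrightarrow>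
           computes_within T ws (poly p (sum_list (map length ws))) (f ws)))"


section \<open>NP-completeness\<close>

type_synonym language = "bool list set"

definition NP :: "language set" where
  "NP = {L. \<exists>(V :: bool list \<Rightarrow> bool list \<Rightarrow> bool) (p :: nat poly).
     poly_time_computable 2 (\<lambda>ws. [V (ws ! 0) (ws ! 1)]) \<and>
     (\<forall>x. x \<in> L \<longleftrightarrow> (\<exists>u. length u \<le> poly p (length x) \<and> V x u))}"

definition poly_time_reducible :: "language \<Rightarrow> language \<Rightarrow> bool" where
  "poly_time_reducible L L' \<longleftrightarrow>
     (\<exists>f :: bool list \<Rightarrow> bool list.
        poly_time_computable 1 (\<lambda>ws. f (ws ! 0)) \<and> (\<forall>x. x \<in> L \<longleftrightarrow> f x \<in> L'))"

definition NP_hard :: "language \<Rightarrow> bool" where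
  "NP_hard L \<longleftrightarrow> (\<forall>L'\<in>NP. poly_time_reducible L' L)"

definition NP_complete :: "language \<Rightarrow> bool" where
  "NP_complete L \<longleftrightarrow> L \<in> NP \<and> NP_hard L"


section \<open>The simultaneous consecutive ones property\<close>

text \<open>Binary matrices have entries of type \<^typ>\<open>bool\<close>; the entry \<^term>\<open>True\<close> is a 1-entry.\<close>

definition consecutive :: "nat set \<Rightarrow> bool" where
  "consecutive S \<longleftrightarrow> (\<forall>a\<in>S. \<forall>c\<in>S. \<forall>b. a \<le> b \<and> b \<le> c \<longrightarrow> b \<in> S)"

definition C1P_rows :: "bool mat \<Rightarrow> bool" where
  "C1P_rows M \<longleftrightarrow>
     (\<exists>\<pi>. \<pi> permutes {..<dim_col M} \<and>
        (\<forall>i<dim_row M. consecutive {j. j < dim_col M \<and> M $$ (i, \<pi> j)}))"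

definition C1P_cols :: "bool mat \<Rightarrow> bool" where
  "C1P_cols M \<longleftrightarrow>
     (\<exists>\<pi>. \<pi> permutes {..<dim_row M} \<and>
        (\<forall>j<dim_col M. consecutive {i. i < dim_row M \<and> M $$ (\<pi> i, j)}))"

definition SC1P :: "bool mat \<Rightarrow> bool" where
  "SC1P M \<longleftrightarrow> C1P_rows M \<and> C1P_cols M"

definition delete_rows :: "bool mat \<Rightarrow> nat set \<Rightarrow> bool mat" where
  "delete_rows M R = submatrix M ({..<dim_row M} - R) UNIV"

definition SC1P_row_deletion :: "(bool mat \<times> nat) set" where
  "SC1P_row_deletion =
     {(M, k). \<exists>R. R \<subseteq> {..<dim_row M} \<and> card R \<le> k \<and> SC1P (delete_rows M R)}"


section \<open>Encoding of instances\<close>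

text \<open>Binary representation, least significant bit first and without leading zeros.\<close>

fun binary :: "nat \<Rightarrow> bool list" where
  "binary n = (if n = 0 then [] else odd n # binary (n div 2))"

declare binary.simps [simp del]

text \<open>Self-delimiting code: a bit \<open>b\<close> becomes \<open>1b\<close>, and \<open>0\<close> marks the end of the word.\<close>

fun delimit :: "bool list \<Rightarrow> bool list" where
  "delimit [] = [False]"
| "delimit (b # w) = True # b # delimit w"

text \<open>
  The instance \<open>(M, k)\<close> is written as \<open>k\<close> in binary, the number of columns in unary (to record it
  even if there are no rows), and the rows of \<open>M\<close>. The length is polynomially related to
  \<open>m * n + m + n + log k\<close>.
\<close>

definition encode :: "bool mat \<times> nat \<Rightarrow> bool list" where
  "encode = (\<lambda>(M, k).
     delimit (binary k) @ delimit (replicate (dim_col M) True) @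
     concat (map delimit (mat_to_list M)))"

lemma binary_0: "binary 0 = []"
  by (subst binary.simps) simp

lemma binary_pos: "n \<noteq> 0 \<Longrightarrow> binary n = odd n # binary (n div 2)"
  by (subst binary.simps) simp

lemma binary_inject: "binary m = binary n \<Longrightarrow> m = n"
proof (induction m arbitrary: n rule: less_induct)
  case (less m)
  show ?case
  proof (cases "m = 0 \<or> n = 0")
    case True
    then show ?thesis
      using less.prems by (metis binary_0 binary_pos list.distinct(1))
  next
    case False
    then have *: "odd m = odd n" "binary (m div 2) = binary (n div 2)"
      using less.prems by (simp_all add: binary_pos)
    have "m div 2 < m"
      using False by simp
    then have "m div 2 = n div 2"
      using less.IH *(2) by blast
    with *(1) show ?thesis
      by presburger
  qed
qed

lemma delimit_append_inject:
  "delimit v @ xs = delimit w @ ys \<longleftrightarrow> v = w \<and> xs = ys"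
proof (induction v arbitrary: w)
  case Nil
  then show ?case by (cases w) auto
next
  case (Cons b v)
  then show ?case by (cases w) auto
qed

lemma concat_delimit_inject:
  "concat (map delimit vs) = concat (map delimit ws) \<Longrightarrow> vs = ws"
proof (induction vs arbitrary: ws)
  case Nil
  have "delimit w \<noteq> []" for w by (cases w) auto
  with Nil show ?case by (cases ws) auto
next
  case (Cons v vs)
  have "delimit v \<noteq> []" by (cases v) auto
  with Cons show ?case by (cases ws) (auto simp: delimit_append_inject)
qed

text \<open>Distinct instances have distinct encodings.\<close>

lemma inj_encode: "inj encode"
proof (rule injI, clarify)
  fix M N :: "bool mat" and k l :: nat
  assume "encode (M, k) = encode (N, l)"
  then have *: "binary k = binary l"
      "replicate (dim_col M) True = replicate (dim_col N) True"
      "concat (map delimit (mat_to_list M)) = concat (map delimit (mat_to_list N))"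
    by (simp_all add: encode_def delimit_append_inject)
  from *(1) have k: "k = l"
    by (rule binary_inject)
  from *(2) have c: "dim_col M = dim_col N"
    by simp
  from *(3) have l: "mat_to_list M = mat_to_list N"
    by (rule concat_delimit_inject)
  then have "length (mat_to_list M) = length (mat_to_list N)"
    by simp
  then have r: "dim_row M = dim_row N"
    by (simp add: mat_to_list_def)
  have "M $$ (i, j) = N $$ (i, j)" if "i < dim_row N" "j < dim_col N" for i j
  proof -
    have "mat_to_list M ! i ! j = mat_to_list N ! i ! j"
      using l by simp
    then show ?thesis
      using that r c by (simp add: mat_to_list_def)
  qed
  then have "M = N"
    using r c by (intro eq_matI) auto
  with k show "M = N \<and> k = l"
    by simp
qed

end

theory Submission
  imports Defs
begin

text \<open>
  Polynomial-time computability is established for while programs operating on stacks, and then for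
  arithmetic with bounded quantifiers. Both the certificate check and the reduction below are
  formulas of this kind, so no Turing machine has to be written down by hand.

  The \<open>1\<close>-entries of all rows can be made consecutive iff the columns can be given keys such that
  each row is convex with respect to the keys; keys for the rows and the columns are the certificate.

  For hardness, an accepting computation is a solution of a binary constraint satisfaction problem on
  a tableau. Every possible assignment of a value to a variable becomes a large class of
  twin rows, and rows of incompatible assignments share a private column. If four twins of each of two
  incompatible assignments survive, then some row has private columns with three other rows, two of
  which lie on the same side of it in the row order; the column shared with the farther one then has a
  gap. Hence the surviving classes form a solution, and conversely the rows of a solution have
  pairwise disjoint supports.
\<close>

section \<open>While programs on tapes\<close>

text \<open>A column with two 1-entries relates only two rows, so all constraints of the tableau
  must be binary. A transition, however, depends on the symbols under all heads, which lie in
  different cells; this forces the cells to carry redundant copies of the state and of the scanned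
  symbols. Twins make it unprofitable to keep a few rows of many vertices. A vertex with fewer than
  four survivors contributes at most three, and \<open>3 * (N * D)\<close> rows in all are fewer
  than one class. So \<open>N * csp_twins N D\<close> survivors need \<open>N\<close> vertices with
  at least four survivors each. Numbers in formulas are in unary, so that all intermediate values
  are polynomially bounded. The bound \<open>k\<close> of an instance is in binary and may be
  exponentially large; the check therefore never computes it, but compares it digit by digit with a
  certified lower bound. The number \<open>D\<close> of possible cells depends on the machine only,
  so predicates on cells are constant tables and need no program of their own.\<close>

datatype cmd =
    Skip
  | Write nat nat
  | Move nat move
  | Seq cmd cmd
  | Cond nat nat cmd cmd
  | While nat nat cmd

type_synonym store = "nat \<Rightarrow> tape"

text \<open>The program state is a stack of commands still to be run. Control flow and the effect on
  the tapes are separated because both depend only on the scanned symbols, like a transition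
  function; administrative commands rewrite what they scan.\<close>

fun next_cont :: "cmd list \<Rightarrow> (nat \<Rightarrow> nat) \<Rightarrow> cmd list" where
  "next_cont [] \<rho> = []"
| "next_cont (Seq c1 c2 # K) \<rho> = c1 # c2 # K"
| "next_cont (Cond r s c1 c2 # K) \<rho> = (if \<rho> r = s then c1 else c2) # K"
| "next_cont (While r s c # K) \<rho> = (if \<rho> r = s then K else c # While r s c # K)"
| "next_cont (_ # K) \<rho> = K"

fun action :: "cmd list \<Rightarrow> (nat \<Rightarrow> nat) \<Rightarrow> nat \<Rightarrow> nat \<times> move" where
  "action (Write r s # K) \<rho> = (\<lambda>i. (\<rho> i, Stay))(r := (s, Stay))"
| "action (Move r d # K) \<rho> = (\<lambda>i. (\<rho> i, Stay))(r := (\<rho> r, d))"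
| "action _ \<rho> = (\<lambda>i. (\<rho> i, Stay))"

definition small_step :: "cmd list \<times> store \<Rightarrow> cmd list \<times> store" where
  "small_step = (\<lambda>(K, \<sigma>). (next_cont K (scanned \<circ> \<sigma>), \<lambda>r. act (action K (scanned \<circ> \<sigma>) r) (\<sigma> r)))"

text \<open>The step count is exact and the rest \<open>K\<close> of the program arbitrary, so
  executions are chained by adding their lengths.\<close>

definition exec :: "cmd \<Rightarrow> store \<Rightarrow> nat \<Rightarrow> store \<Rightarrow> bool" where
  "exec c \<sigma> t \<sigma>' \<longleftrightarrow> (\<forall>K. (small_step ^^ t) (c # K, \<sigma>) = (K, \<sigma>'))"

lemma act_stay [simp]: "act (scanned \<tau>, Stay) \<tau> = \<tau>"
  by (cases \<tau>) simp

lemma funpow_append: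
  assumes "(f ^^ m) x = y" "(f ^^ n) y = z"
  shows "(f ^^ (m + n)) x = z"
  using assms by (metis add.commute comp_apply funpow_add)

lemma exec_one:
  assumes "\<And>K. small_step (c # K, \<sigma>) = (K, \<sigma>')"
  shows "exec c \<sigma> 1 \<sigma>'"
  using assms by (simp add: exec_def)

lemma exec_step:
  assumes "\<And>K. small_step (c # K, \<sigma>) = (c' # K, \<sigma>)" "exec c' \<sigma> t \<sigma>'"
  shows "exec c \<sigma> (Suc t) \<sigma>'"
  using assms by (simp add: exec_def funpow_Suc_right del: funpow.simps)

lemma exec_Skip: "exec Skip \<sigma> 1 \<sigma>"
  by (rule exec_one) (simp add: small_step_def)

lemma exec_Write: "exec (Write r s) \<sigma> 1 (\<sigma>(r := act (s, Stay) (\<sigma> r)))"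
  by (rule exec_one) (auto simp: small_step_def fun_eq_iff)

lemma exec_Move: "exec (Move r d) \<sigma> 1 (\<sigma>(r := act (scanned (\<sigma> r), d) (\<sigma> r)))"
  by (rule exec_one) (auto simp: small_step_def fun_eq_iff)

lemma exec_Seq:
  assumes "exec c1 \<sigma> t1 \<sigma>1" "exec c2 \<sigma>1 t2 \<sigma>2"
  shows "exec (Seq c1 c2) \<sigma> (Suc (t1 + t2)) \<sigma>2"
proof -
  have "(small_step ^^ (t1 + t2)) (c1 # c2 # K, \<sigma>) = (K, \<sigma>2)" for K
    using assms by (intro funpow_append) (auto simp: exec_def)
  then show ?thesis
    by (simp add: exec_def funpow_Suc_right small_step_def comp_def del: funpow.simps)
qed

lemma exec_Cond:
  assumes "exec (if scanned (\<sigma> r) = s then c1 else c2) \<sigma> t \<sigma>'"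
  shows "exec (Cond r s c1 c2) \<sigma> (Suc t) \<sigma>'"
  by (rule exec_step[OF _ assms]) (auto simp: small_step_def comp_def)

lemma exec_While_end: "scanned (\<sigma> r) = s \<Longrightarrow> exec (While r s c) \<sigma> 1 \<sigma>"
  by (rule exec_one) (auto simp: small_step_def comp_def)

lemma exec_While_step:
  assumes "scanned (\<sigma> r) \<noteq> s" "exec c \<sigma> t1 \<sigma>1" "exec (While r s c) \<sigma>1 t2 \<sigma>2"
  shows "exec (While r s c) \<sigma> (Suc (t1 + t2)) \<sigma>2"
proof -
  have "(small_step ^^ (t1 + t2)) (c # While r s c # K, \<sigma>) = (K, \<sigma>2)" for K
    using assms by (intro funpow_append) (auto simp: exec_def)
  then show ?thesis
    using assms(1)
    by (simp add: exec_def funpow_Suc_right small_step_def comp_def del: funpow.simps)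
qed


section \<open>Compilation to Turing machines\<close>

fun conts :: "cmd \<Rightarrow> cmd list \<Rightarrow> cmd list set" where
  "conts (Seq c1 c2) K = insert (Seq c1 c2 # K) (conts c1 (c2 # K) \<union> conts c2 K)"
| "conts (Cond r s c1 c2) K = insert (Cond r s c1 c2 # K) (conts c1 K \<union> conts c2 K)"
| "conts (While r s c) K = insert (While r s c # K) (conts c (While r s c # K))"
| "conts c K = {c # K}"

lemma conts_self: "c # K \<in> conts c K"
  by (cases c) auto

lemma finite_conts: "finite (conts c K)"
  by (induction c arbitrary: K) auto

text \<open>\<open>conts c K\<close> collects the stacks that may arise while \<open>c\<close> runs
  above \<open>K\<close>; it is finite because a loop returns to the same stack. Control leaves it
  only to \<open>K\<close>.\<close>

lemma next_conts: "\<kappa> \<in> conts c K \<Longrightarrow> next_cont \<kappa> \<rho> \<in> insert K (conts c K)"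
proof (induction c arbitrary: K \<kappa>)
  case (Seq c1 c2)
  from Seq.prems consider "\<kappa> = Seq c1 c2 # K" | "\<kappa> \<in> conts c1 (c2 # K)" | "\<kappa> \<in> conts c2 K" by auto
  then show ?case
    using Seq.IH(1)[of \<kappa> "c2 # K"] Seq.IH(2)[of \<kappa> K] conts_self[of c1] conts_self[of c2]
    by cases auto
next
  case (Cond r s c1 c2)
  from Cond.prems consider "\<kappa> = Cond r s c1 c2 # K" | "\<kappa> \<in> conts c1 K" | "\<kappa> \<in> conts c2 K" by auto
  then show ?case
    using Cond.IH(1)[of \<kappa> K] Cond.IH(2)[of \<kappa> K] conts_self[of c1] conts_self[of c2] by cases auto
next
  case (While r s c)
  from While.prems consider "\<kappa> = While r s c # K" | "\<kappa> \<in> conts c (While r s c # K)" by auto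
  then show ?case
    using While.IH[of \<kappa> "While r s c # K"] conts_self[of c] by cases auto
qed auto

fun cmd_tapes :: "cmd \<Rightarrow> nat set" where
  "cmd_tapes Skip = {}"
| "cmd_tapes (Write r s) = {r}"
| "cmd_tapes (Move r d) = {r}"
| "cmd_tapes (Seq c1 c2) = cmd_tapes c1 \<union> cmd_tapes c2"
| "cmd_tapes (Cond r s c1 c2) = insert r (cmd_tapes c1 \<union> cmd_tapes c2)"
| "cmd_tapes (While r s c) = insert r (cmd_tapes c)"

fun cmd_symbols :: "cmd \<Rightarrow> nat set" where
  "cmd_symbols (Write r s) = {s}"
| "cmd_symbols (Seq c1 c2) = cmd_symbols c1 \<union> cmd_symbols c2"
| "cmd_symbols (Cond r s c1 c2) = cmd_symbols c1 \<union> cmd_symbols c2"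
| "cmd_symbols (While r s c) = cmd_symbols c"
| "cmd_symbols _ = {}"

lemma finite_cmd_tapes: "finite (cmd_tapes c)" and finite_cmd_symbols: "finite (cmd_symbols c)"
  by (induction c) auto

lemma conts_tapes:
  "\<kappa> \<in> conts c K \<Longrightarrow> \<Union> (cmd_tapes ` set \<kappa>) \<subseteq> cmd_tapes c \<union> \<Union> (cmd_tapes ` set K)"
proof (induction c arbitrary: K \<kappa>)
  case (Seq c1 c2)
  from Seq.prems consider "\<kappa> = Seq c1 c2 # K" | "\<kappa> \<in> conts c1 (c2 # K)" | "\<kappa> \<in> conts c2 K" by auto
  then show ?case
    using Seq.IH(1)[of \<kappa> "c2 # K"] Seq.IH(2)[of \<kappa> K] by cases auto
next
  case (Cond r s c1 c2)
  from Cond.prems consider "\<kappa> = Cond r s c1 c2 # K" | "\<kappa> \<in> conts c1 K" | "\<kappa> \<in> conts c2 K" by auto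
  then show ?case
    using Cond.IH(1)[of \<kappa> K] Cond.IH(2)[of \<kappa> K] by cases auto
next
  case (While r s c)
  from While.prems consider "\<kappa> = While r s c # K" | "\<kappa> \<in> conts c (While r s c # K)" by auto
  then show ?case
    using While.IH[of \<kappa> "While r s c # K"] by cases auto
qed auto

lemma conts_symbols:
  "\<kappa> \<in> conts c K \<Longrightarrow> \<Union> (cmd_symbols ` set \<kappa>) \<subseteq> cmd_symbols c \<union> \<Union> (cmd_symbols ` set K)"
proof (induction c arbitrary: K \<kappa>)
  case (Seq c1 c2)
  from Seq.prems consider "\<kappa> = Seq c1 c2 # K" | "\<kappa> \<in> conts c1 (c2 # K)" | "\<kappa> \<in> conts c2 K" by auto
  then show ?case
    using Seq.IH(1)[of \<kappa> "c2 # K"] Seq.IH(2)[of \<kappa> K] by cases auto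
next
  case (Cond r s c1 c2)
  from Cond.prems consider "\<kappa> = Cond r s c1 c2 # K" | "\<kappa> \<in> conts c1 K" | "\<kappa> \<in> conts c2 K" by auto
  then show ?case
    using Cond.IH(1)[of \<kappa> K] Cond.IH(2)[of \<kappa> K] by cases auto
next
  case (While r s c)
  from While.prems consider "\<kappa> = While r s c # K" | "\<kappa> \<in> conts c (While r s c # K)" by auto
  then show ?case
    using While.IH[of \<kappa> "While r s c # K"] by cases auto
qed auto

text \<open>A store has infinitely many tapes and a machine finitely many; the two agree because a
  step inspects only tapes mentioned in the program.\<close>

lemma next_cont_cong:
  assumes "\<And>r. r \<in> \<Union> (cmd_tapes ` set \<kappa>) \<Longrightarrow> \<rho> r = \<rho>' r"
  shows "next_cont \<kappa> \<rho> = next_cont \<kappa> \<rho>'"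
  using assms by (cases "(\<kappa>, \<rho>)" rule: next_cont.cases) auto

lemma action_cong: "\<rho> i = \<rho>' i \<Longrightarrow> action \<kappa> \<rho> i = action \<kappa> \<rho>' i"
  by (cases "(\<kappa>, \<rho>)" rule: action.cases) auto

lemma action_symbol:
  "fst (action \<kappa> \<rho> i) \<in> insert (\<rho> i) (\<Union> (cmd_symbols ` set \<kappa>))"
  by (cases "(\<kappa>, \<rho>)" rule: action.cases) auto

text \<open>The control states are the stacks in \<open>conts c []\<close> together with the empty
  one, and a small step is one machine step, so the running time is preserved exactly.\<close>

theorem compile:
  fixes c :: cmd and r :: nat
  obtains T where "wf_tm T" "r \<le> ntapes T"
    "\<And>\<sigma> t \<sigma>'. exec c \<sigma> t \<sigma>' \<Longrightarrow>
       (step T ^^ t) (0, map \<sigma> [0..<ntapes T]) = (nstates T, map \<sigma>' [0..<ntapes T])"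
proof -
  obtain k where k: "\<And>i. i \<in> cmd_tapes c \<Longrightarrow> i < k" "r \<le> k" "1 \<le> k"
  proof -
    obtain k0 where "\<forall>i\<in>cmd_tapes c. i < k0"
      using finite_cmd_tapes finite_nat_set_iff_bounded by blast
    then show thesis by (intro that[of "k0 + r + 1"]) auto
  qed
  obtain m where m: "\<And>i. i \<in> cmd_symbols c \<Longrightarrow> i < m" "3 \<le> m"
  proof -
    obtain k0 where "\<forall>i\<in>cmd_symbols c. i < k0"
      using finite_cmd_symbols finite_nat_set_iff_bounded by blast
    then show thesis by (intro that[of "k0 + 3"]) auto
  qed
  define S where "S = insert [] (conts c [])"
  obtain ys where ys: "set ys = S - {[c], []}" "distinct ys"
    using finite_distinct_list[of "S - {[c], []}"] finite_conts by (auto simp: S_def)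
  \<comment> \<open>The initial state must have number 0 and the halting state the last number, so
    \<open>[c]\<close> comes first and the empty stack last.\<close>
  define L where "L = [c] # ys @ [[]]"
  have L: "distinct L" "set L = S"
    using ys conts_self[of c "[]"] by (auto simp: L_def S_def)
  define n where "n = length ys + 1"
  have len: "length L = Suc n" "L ! 0 = [c]" "L ! n = []"
    by (auto simp: L_def n_def nth_append)
  define idx where "idx \<kappa> = (THE i. i < length L \<and> L ! i = \<kappa>)" for \<kappa>
  have idx_nth: "idx (L ! i) = i" if "i < length L" for i
    unfolding idx_def using L(1) that by (auto simp: nth_eq_iff_index_eq)
  have nth_idx: "idx \<kappa> \<le> n \<and> L ! idx \<kappa> = \<kappa>" if "\<kappa> \<in> S" for \<kappa>
    using that L(2) idx_nth len(1) by (metis in_set_conv_nth less_Suc_eq_le)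
  have S_next: "next_cont \<kappa> \<rho> \<in> S" if "\<kappa> \<in> S" for \<kappa> \<rho>
    using that next_conts[of \<kappa> c "[]" \<rho>] by (auto simp: S_def)
  define T where "T = \<lparr>ntapes = k, nstates = n, nsymbols = m,
    delta = (\<lambda>q ss. (idx (next_cont (L ! q) ((!) ss)), map (action (L ! q) ((!) ss)) [0..<k]))\<rparr>"
  have T: "ntapes T = k" "nstates T = n" "nsymbols T = m" by (simp_all add: T_def)
  have wf: "wf_tm T"
    unfolding wf_tm_def
  proof (intro conjI allI impI)
    fix q ss assume *: "q < nstates T \<and> length ss = ntapes T \<and> set ss \<subseteq> {..<nsymbols T}"
    then have q: "L ! q \<in> S" using L len T by (metis less_Suc_eq nth_mem)
    have "fst (action (L ! q) ((!) ss) i) < m" if "i < k" for i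
    proof -
      have "\<Union> (cmd_symbols ` set (L ! q)) \<subseteq> cmd_symbols c"
        using q conts_symbols[of "L ! q" c "[]"] by (auto simp: S_def)
      moreover have "ss ! i < m" using * that T by (auto simp: subset_iff)
      ultimately show ?thesis using action_symbol[of "L ! q" "(!) ss" i] m by auto
    qed
    then show "case delta T q ss of (q', as) \<Rightarrow>
      q' \<le> nstates T \<and> length as = ntapes T \<and> fst ` set as \<subseteq> {..<nsymbols T}"
      using nth_idx[OF S_next[OF q]] by (auto simp: T_def)
  qed (use k m in \<open>auto simp: T_def\<close>)
  \<comment> \<open>After halting both sides idle: the machine by definition of \<open>step\<close>,
    the program because the empty stack stays empty and its action rewrites the scanned
    symbols.\<close>
  have sim: "step T (idx \<kappa>, map \<sigma> [0..<k]) =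
      (case small_step (\<kappa>, \<sigma>) of (\<kappa>', \<sigma>') \<Rightarrow> (idx \<kappa>', map \<sigma>' [0..<k]))"
    if "\<kappa> \<in> S" for \<kappa> \<sigma>
  proof (cases "\<kappa> = []")
    case True
    have "idx [] = n" using idx_nth[of n] len by simp
    then show ?thesis using True by (simp add: small_step_def T)
  next
    case False
    then have "idx \<kappa> < n" using nth_idx[OF that] len by (metis le_eq_less_or_eq)
    have tp: "i < k" if "i \<in> \<Union> (cmd_tapes ` set \<kappa>)" for i
      using that \<open>\<kappa> \<in> S\<close> conts_tapes[of \<kappa> c "[]"] k(1) False by (auto simp: S_def)
    let ?\<rho> = "(!) (map scanned (map \<sigma> [0..<k]))"
    have "next_cont \<kappa> ?\<rho> = next_cont \<kappa> (scanned \<circ> \<sigma>)"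
      by (rule next_cont_cong) (use tp in auto)
    moreover have "map2 act (map (action \<kappa> ?\<rho>) [0..<k]) (map \<sigma> [0..<k]) =
        map (\<lambda>r. act (action \<kappa> (scanned \<circ> \<sigma>) r) (\<sigma> r)) [0..<k]"
      by (rule nth_equalityI)
         (auto intro!: arg_cong[where f = "\<lambda>a. act a _"] action_cong)
    ultimately show ?thesis
      using \<open>idx \<kappa> < n\<close> nth_idx[OF that] by (simp add: small_step_def T_def)
  qed
  have S_step: "fst (small_step (\<kappa>, \<sigma>)) \<in> S" if "\<kappa> \<in> S" for \<kappa> \<sigma>
    using S_next[OF that] by (simp add: small_step_def)
  have run: "(step T ^^ t) (idx \<kappa>, map \<sigma> [0..<k]) =
      (case (small_step ^^ t) (\<kappa>, \<sigma>) of (\<kappa>', \<sigma>') \<Rightarrow> (idx \<kappa>', map \<sigma>' [0..<k]))"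
    if "\<kappa> \<in> S" for \<kappa> \<sigma> t
    using that
  proof (induction t arbitrary: \<kappa> \<sigma>)
    case (Suc t)
    obtain \<kappa>1 \<sigma>1 where 1: "small_step (\<kappa>, \<sigma>) = (\<kappa>1, \<sigma>1)" by fastforce
    then have "\<kappa>1 \<in> S" using S_step[OF Suc.prems, of \<sigma>] by simp
    from Suc.IH[OF this, of \<sigma>1] sim[OF Suc.prems, of \<sigma>] 1 show ?case
      by (simp add: funpow_Suc_right del: funpow.simps)
  qed simp
  show thesis
  proof (rule that[OF wf])
    show "r \<le> ntapes T" using k T by simp
    fix \<sigma> t \<sigma>' assume "exec c \<sigma> t \<sigma>'"
    moreover have "idx [c] = 0" "idx [] = n" using idx_nth[of 0] idx_nth[of n] len by simp_all
    moreover have "[c] \<in> S" using conts_self by (auto simp: S_def)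
    ultimately show "(step T ^^ t) (0, map \<sigma> [0..<ntapes T]) = (nstates T, map \<sigma>' [0..<ntapes T])"
      using run[of "[c]" t \<sigma>] by (simp add: exec_def T)
  qed
qed


section \<open>Programs on registers\<close>

text \<open>Nothing is required of the cells to the left of the head, so popping is a move to the
  right that leaves garbage behind, and pushing overwrites it.\<close>

fun rep :: "bool list \<Rightarrow> tape \<Rightarrow> bool" where
  "rep [] (c, h) \<longleftrightarrow> c h = 0"
| "rep (b # w) (c, h) \<longleftrightarrow> c h = bit_symbol b \<and> rep w (c, h + 1)"

type_synonym regs = "nat \<Rightarrow> bool list"

text \<open>
  Register \<open>r\<close> is a stack kept on tape \<open>Suc r\<close>, with its top under the head. Tape \<open>0\<close> is left
  alone, because the final output has to start at its cell \<open>0\<close>.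
\<close>

definition does :: "cmd \<Rightarrow> regs \<Rightarrow> nat \<Rightarrow> regs \<Rightarrow> bool" where
  "does c E t E' \<longleftrightarrow> (\<forall>\<sigma>. (\<forall>r. rep (E r) (\<sigma> (Suc r))) \<longrightarrow>
     (\<exists>t' \<sigma>'. t' \<le> t \<and> exec c \<sigma> t' \<sigma>' \<and> \<sigma>' 0 = \<sigma> 0 \<and> (\<forall>r. rep (E' r) (\<sigma>' (Suc r)))))"

lemma bit_symbol_neq [simp]: "bit_symbol b \<noteq> 0" "bit_symbol b = 2 \<longleftrightarrow> b" "bit_symbol b = 1 \<longleftrightarrow> \<not> b"
  by (auto simp: bit_symbol_def)

lemma rep_cong: "(\<And>i. h \<le> i \<Longrightarrow> c i = c' i) \<Longrightarrow> rep w (c, h) = rep w (c', h)"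
  by (induction w arbitrary: h) auto

lemma rep_push: "rep w (c, h) \<Longrightarrow> rep (b # w) (c(h - 1 := bit_symbol b), h - 1)"
  using rep_cong[of h c "c(h - 1 := bit_symbol b)" w] by auto

lemma rep_scanned: "rep w \<tau> \<Longrightarrow> scanned \<tau> = (case w of [] \<Rightarrow> 0 | b # _ \<Rightarrow> bit_symbol b)"
  by (cases \<tau>; cases w) auto

lemma rep_scanned_0: "rep w \<tau> \<Longrightarrow> scanned \<tau> = 0 \<longleftrightarrow> w = []"
  by (auto simp: rep_scanned split: list.splits)

lemma rep_scanned_2: "rep w \<tau> \<Longrightarrow> scanned \<tau> = 2 \<longleftrightarrow> w \<noteq> [] \<and> hd w"
  by (auto simp: rep_scanned split: list.splits)

lemma doesE:
  assumes "does c E t E'" "\<And>r. rep (E r) (\<sigma> (Suc r))"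
  obtains t' \<sigma>' where "t' \<le> t" "exec c \<sigma> t' \<sigma>'" "\<sigma>' 0 = \<sigma> 0" "\<And>r. rep (E' r) (\<sigma>' (Suc r))"
  using assms unfolding does_def by blast

lemma does_weaken: "does c E t E' \<Longrightarrow> t \<le> t' \<Longrightarrow> E' = E'' \<Longrightarrow> does c E t' E''"
  unfolding does_def by (meson order_trans)

lemma does_Skip: "does Skip E 1 E"
  unfolding does_def
proof (intro allI impI)
  fix \<sigma> assume *: "\<forall>q. rep (E q) (\<sigma> (Suc q))"
  then show "\<exists>t' \<sigma>'. t' \<le> 1 \<and> exec Skip \<sigma> t' \<sigma>' \<and> \<sigma>' 0 = \<sigma> 0 \<and> (\<forall>q. rep (E q) (\<sigma>' (Suc q)))"
    using exec_Skip by (intro exI[of _ 1] exI[of _ \<sigma>]) auto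
qed

lemma does_Seq:
  assumes "does c1 E t1 E1" "does c2 E1 t2 E2"
  shows "does (Seq c1 c2) E (Suc (t1 + t2)) E2"
  unfolding does_def
proof (intro allI impI)
  fix \<sigma> assume "\<forall>r. rep (E r) (\<sigma> (Suc r))"
  then obtain t1' \<sigma>1 where 1: "t1' \<le> t1" "exec c1 \<sigma> t1' \<sigma>1" "\<sigma>1 0 = \<sigma> 0" "\<And>r. rep (E1 r) (\<sigma>1 (Suc r))"
    using doesE[OF assms(1)] by metis
  obtain t2' \<sigma>2 where 2: "t2' \<le> t2" "exec c2 \<sigma>1 t2' \<sigma>2" "\<sigma>2 0 = \<sigma>1 0" "\<And>r. rep (E2 r) (\<sigma>2 (Suc r))"
    using doesE[OF assms(2), of \<sigma>1] 1(4) by metis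
  show "\<exists>t' \<sigma>'. t' \<le> Suc (t1 + t2) \<and> exec (Seq c1 c2) \<sigma> t' \<sigma>' \<and> \<sigma>' 0 = \<sigma> 0 \<and> (\<forall>r. rep (E2 r) (\<sigma>' (Suc r)))"
    using exec_Seq[OF 1(2) 2(2)] 1 2 by (intro exI[of _ "Suc (t1' + t2')"] exI[of _ \<sigma>2]) auto
qed

definition push :: "nat \<Rightarrow> bool \<Rightarrow> cmd" where
  "push r b = Seq (Move (Suc r) Move_Left) (Write (Suc r) (bit_symbol b))"

lemma exec_push:
  assumes "rep w (\<sigma> (Suc r))"
  shows "\<exists>\<tau>. exec (push r b) \<sigma> 3 (\<sigma>(Suc r := \<tau>)) \<and> rep (b # w) \<tau>"
proof -
  obtain c h where ch: "\<sigma> (Suc r) = (c, h)" by fastforce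
  have "exec (push r b) \<sigma> (Suc (1 + 1)) (\<sigma>(Suc r := (c(h - 1 := bit_symbol b), h - 1)))"
    unfolding push_def by (rule exec_Seq, rule exec_Move)
      (use exec_Write[of "Suc r" "bit_symbol b" "\<sigma>(Suc r := (c, h - 1))"] ch in simp)
  then show ?thesis
    using rep_push[of w c h b] assms ch 
    by (intro exI[of _ "(c(h - 1 := bit_symbol b), h - 1)"]) (auto simp: numeral_3_eq_3)
qed

lemma does_push: "does (push r b) E 3 (E(r := b # E r))"
  unfolding does_def
proof (intro allI impI)
  fix \<sigma> assume *: "\<forall>q. rep (E q) (\<sigma> (Suc q))"
  then obtain \<tau> where "exec (push r b) \<sigma> 3 (\<sigma>(Suc r := \<tau>))" "rep (b # E r) \<tau>"
    using exec_push by blast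
  with * show "\<exists>t' \<sigma>'. t' \<le> 3 \<and> exec (push r b) \<sigma> t' \<sigma>' \<and> \<sigma>' 0 = \<sigma> 0 \<and>
      (\<forall>q. rep ((E(r := b # E r)) q) (\<sigma>' (Suc q)))"
    by (intro exI[of _ 3] exI[of _ "\<sigma>(Suc r := \<tau>)"]) auto
qed

lemma does_pop:
  assumes "E r \<noteq> []"
  shows "does (Move (Suc r) Move_Right) E 1 (E(r := tl (E r)))"
  unfolding does_def
proof (intro allI impI)
  fix \<sigma> assume *: "\<forall>q. rep (E q) (\<sigma> (Suc q))"
  obtain c h where ch: "\<sigma> (Suc r) = (c, h)" by fastforce
  have "rep (E r) (c, h)" using * ch by metis
  then have "rep (tl (E r)) (c, h + 1)" using assms by (cases "E r") auto
  then show "\<exists>t' \<sigma>'. t' \<le> 1 \<and> exec (Move (Suc r) Move_Right) \<sigma> t' \<sigma>' \<and> \<sigma>' 0 = \<sigma> 0 \<and>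
      (\<forall>q. rep ((E(r := tl (E r))) q) (\<sigma>' (Suc q)))"
    using exec_Move[of "Suc r" Move_Right \<sigma>] * ch
    by (intro exI[of _ 1] exI[of _ "\<sigma>(Suc r := (c, h + 1))"]) auto
qed

lemma does_Cond:
  assumes "\<And>\<tau>. rep (E r) \<tau> \<Longrightarrow> scanned \<tau> = s \<longleftrightarrow> P" "does (if P then c1 else c2) E t E'"
  shows "does (Cond (Suc r) s c1 c2) E (Suc t) E'"
  unfolding does_def
proof (intro allI impI)
  fix \<sigma> assume *: "\<forall>q. rep (E q) (\<sigma> (Suc q))"
  obtain t' \<sigma>' where 1: "t' \<le> t" "exec (if P then c1 else c2) \<sigma> t' \<sigma>'" "\<sigma>' 0 = \<sigma> 0" "\<And>r. rep (E' r) (\<sigma>' (Suc r))"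
    using doesE[OF assms(2), of \<sigma>] * by metis
  then have "exec (Cond (Suc r) s c1 c2) \<sigma> (Suc t') \<sigma>'"
    using assms(1) * by (intro exec_Cond) auto
  with 1 show "\<exists>t' \<sigma>'. t' \<le> Suc t \<and> exec (Cond (Suc r) s c1 c2) \<sigma> t' \<sigma>' \<and> \<sigma>' 0 = \<sigma> 0 \<and>
      (\<forall>q. rep (E' q) (\<sigma>' (Suc q)))"
    by (intro exI[of _ "Suc t'"] exI[of _ \<sigma>']) auto
qed

lemma does_Cond_empty:
  "P = (E r = []) \<Longrightarrow> does (if P then c1 else c2) E t E' \<Longrightarrow> does (Cond (Suc r) 0 c1 c2) E (Suc t) E'"
  using does_Cond[of E r 0 P] rep_scanned_0 by blast

lemma does_Cond_hd:
  "P = (E r \<noteq> [] \<and> hd (E r)) \<Longrightarrow> does (if P then c1 else c2) E t E' \<Longrightarrow>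
   does (Cond (Suc r) 2 c1 c2) E (Suc t) E'"
  using does_Cond[of E r 2 P] rep_scanned_2 by blast


section \<open>Loops over the bits of a register\<close>

definition loop :: "nat \<Rightarrow> cmd \<Rightarrow> cmd \<Rightarrow> cmd" where
  "loop r c0 c1 = While (Suc r) 0
     (Cond (Suc r) 2 (Seq (Move (Suc r) Move_Right) c1) (Seq (Move (Suc r) Move_Right) c0))"

lemma does_While_step:
  assumes "E r \<noteq> []" "does c E t1 E1" "does (While (Suc r) 0 c) E1 t2 E2"
  shows "does (While (Suc r) 0 c) E (Suc (t1 + t2)) E2"
  unfolding does_def
proof (intro allI impI)
  fix \<sigma> assume *: "\<forall>r. rep (E r) (\<sigma> (Suc r))"
  then obtain t1' \<sigma>1 where 1: "t1' \<le> t1" "exec c \<sigma> t1' \<sigma>1" "\<sigma>1 0 = \<sigma> 0" "\<And>r. rep (E1 r) (\<sigma>1 (Suc r))"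
    using doesE[OF assms(2)] by metis
  obtain t2' \<sigma>2 where 2: "t2' \<le> t2" "exec (While (Suc r) 0 c) \<sigma>1 t2' \<sigma>2" "\<sigma>2 0 = \<sigma>1 0"
      "\<And>r. rep (E2 r) (\<sigma>2 (Suc r))"
    using doesE[OF assms(3), of \<sigma>1] 1(4) by metis
  have "scanned (\<sigma> (Suc r)) \<noteq> 0"
    using * assms(1) rep_scanned_0 by blast
  from exec_While_step[OF this 1(2) 2(2)]
  show "\<exists>t' \<sigma>'. t' \<le> Suc (t1 + t2) \<and> exec (While (Suc r) 0 c) \<sigma> t' \<sigma>' \<and> \<sigma>' 0 = \<sigma> 0 \<and>
      (\<forall>r. rep (E2 r) (\<sigma>' (Suc r)))"
    using 1 2 by (intro exI[of _ "Suc (t1' + t2')"] exI[of _ \<sigma>2]) auto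
qed

lemma does_While_end:
  assumes "E r = []"
  shows "does (While (Suc r) 0 c) E 1 E"
  unfolding does_def
proof (intro allI impI)
  fix \<sigma> assume *: "\<forall>r. rep (E r) (\<sigma> (Suc r))"
  then have "scanned (\<sigma> (Suc r)) = 0"
    using assms rep_scanned_0 by blast
  then show "\<exists>t' \<sigma>'. t' \<le> 1 \<and> exec (While (Suc r) 0 c) \<sigma> t' \<sigma>' \<and> \<sigma>' 0 = \<sigma> 0 \<and>
      (\<forall>r. rep (E r) (\<sigma>' (Suc r)))"
    using exec_While_end * by (intro exI[of _ 1] exI[of _ \<sigma>]) auto
qed

text \<open>\<open>S i\<close> is the invariant after \<open>i\<close> bits; its value at
  \<open>r\<close> is overridden, because \<open>r\<close> holds the unread rest of the word. The 4
  extra steps per round are the loop test, the branch, the unfolding of \<open>Seq\<close> and the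
  pop.\<close>

lemma does_loop:
  assumes "\<And>i. i < length w \<Longrightarrow>
    does (if w ! i then c1 else c0) ((S i)(r := drop (Suc i) w)) T ((S (Suc i))(r := drop (Suc i) w))"
  shows "does (loop r c0 c1) ((S 0)(r := w)) (length w * (T + 4) + 1) ((S (length w))(r := []))"
  using assms
proof (induction w arbitrary: S)
  case Nil
  show ?case unfolding loop_def by (rule does_weaken, rule does_While_end) auto
next
  case (Cons b w)
  have "does (loop r c0 c1) ((S (Suc 0))(r := w)) (length w * (T + 4) + 1) ((S (Suc (length w)))(r := []))"
    using Cons.prems[of "Suc i" for i] Cons.IH[of "\<lambda>i. S (Suc i)"]
    by (simp add: fun_upd_def)
  moreover have "does (Cond (Suc r) 2 (Seq (Move (Suc r) Move_Right) c1) (Seq (Move (Suc r) Move_Right) c0))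
      ((S 0)(r := b # w)) (Suc (Suc (1 + T))) ((S (Suc 0))(r := w))"
  proof (rule does_Cond_hd[where P = b])
    have "does (if b then c1 else c0) ((S 0)(r := w)) T ((S (Suc 0))(r := w))"
      using Cons.prems[of 0] by (simp add: fun_upd_def)
    moreover have "does (Move (Suc r) Move_Right) ((S 0)(r := b # w)) 1 ((S 0)(r := w))"
      using does_pop[of "(S 0)(r := b # w)" r] by simp
    ultimately show "does (if b then Seq (Move (Suc r) Move_Right) c1 else Seq (Move (Suc r) Move_Right) c0)
        ((S 0)(r := b # w)) (Suc (1 + T)) ((S (Suc 0))(r := w))"
      by (cases b) (auto intro: does_Seq[of _ _ 1, simplified])
  qed simp
  ultimately have "does (loop r c0 c1) ((S 0)(r := b # w)) (Suc (Suc (Suc (1 + T)) + (length w * (T + 4) + 1)))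
      ((S (Suc (length w)))(r := []))"
    unfolding loop_def by (intro does_While_step) auto
  then show ?case by (rule does_weaken) auto
qed

section \<open>Clearing, moving and copying stacks\<close>

definition clear :: "nat \<Rightarrow> cmd" where
  "clear r = loop r Skip Skip"

lemma does_clear: "does (clear r) E (length (E r) * 5 + 1) (E(r := []))"
  using does_loop[of "E r" Skip Skip "\<lambda>_. E" r 1] does_Skip by (simp add: clear_def)

definition move_rev :: "nat \<Rightarrow> nat \<Rightarrow> cmd" where
  "move_rev a b = loop a (push b False) (push b True)"

lemma does_move_rev:
  assumes "a \<noteq> b"
  shows "does (move_rev a b) E (length (E a) * 7 + 1) (E(a := [], b := rev (E a) @ E b))"
proof -
  define S where "S i = E(b := rev (take i (E a)) @ E b)" for i
  have "does (loop a (push b False) (push b True)) ((S 0)(a := E a)) (length (E a) * (3 + 4) + 1)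
      ((S (length (E a)))(a := []))"
  proof (rule does_loop)
    fix i assume i: "i < length (E a)"
    show "does (if E a ! i then push b True else push b False) ((S i)(a := drop (Suc i) (E a))) 3
        ((S (Suc i))(a := drop (Suc i) (E a)))"
      using does_push[of b "E a ! i" "(S i)(a := drop (Suc i) (E a))"] assms i
      by (cases "E a ! i") (simp_all add: S_def take_Suc_conv_app_nth fun_upd_twist)
  qed
  then have "does (move_rev a b) E (length (E a) * (3 + 4) + 1) ((S (length (E a)))(a := []))"
    unfolding move_rev_def
    by (rule back_subst[where P = "\<lambda>X. does _ X _ _"]) (auto simp: S_def assms assms[symmetric] fun_eq_iff)
  then show ?thesis
    by (rule does_weaken) (auto simp: S_def assms assms[symmetric] fun_eq_iff)
qed

definition move_rev2 :: "nat \<Rightarrow> nat \<Rightarrow> nat \<Rightarrow> cmd" where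
  "move_rev2 a b c = loop a (Seq (push b False) (push c False)) (Seq (push b True) (push c True))"

lemma does_move_rev2:
  assumes "a \<noteq> b" "a \<noteq> c" "b \<noteq> c"
  shows "does (move_rev2 a b c) E (length (E a) * 11 + 1)
    (E(a := [], b := rev (E a) @ E b, c := rev (E a) @ E c))"
proof -
  define S where "S i = E(b := rev (take i (E a)) @ E b, c := rev (take i (E a)) @ E c)" for i
  have "does (move_rev2 a b c) ((S 0)(a := E a)) (length (E a) * (Suc (3 + 3) + 4) + 1)
      ((S (length (E a)))(a := []))"
    unfolding move_rev2_def
  proof (rule does_loop)
    fix i assume i: "i < length (E a)"
    let ?E = "(S i)(a := drop (Suc i) (E a))"
    have "does (Seq (push b (E a ! i)) (push c (E a ! i))) ?E (Suc (3 + 3))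
        (?E(b := E a ! i # ?E b, c := E a ! i # ?E c))"
      using does_Seq[OF does_push[of b "E a ! i" ?E] does_push[of c "E a ! i"]] assms by simp
    then show "does (if E a ! i then Seq (push b True) (push c True) else Seq (push b False) (push c False))
        ?E (Suc (3 + 3)) ((S (Suc i))(a := drop (Suc i) (E a)))"
      using assms i
      by (cases "E a ! i") (simp_all add: S_def take_Suc_conv_app_nth fun_upd_twist)
  qed
  then have "does (move_rev2 a b c) E (length (E a) * (Suc (3 + 3) + 4) + 1) ((S (length (E a)))(a := []))"
    by (rule back_subst[where P = "\<lambda>X. does _ X _ _"]) (auto simp: S_def assms assms[symmetric] fun_eq_iff)
  then show ?thesis
    by (rule does_weaken) (auto simp: S_def assms assms[symmetric] fun_eq_iff)
qed

text \<open>Reading a stack destroys it and reverses the word. Moving it to the scratch register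
  \<open>t\<close> and back restores the order, and the way back fills both \<open>a\<close> and
  \<open>b\<close>.\<close>

definition copy :: "nat \<Rightarrow> nat \<Rightarrow> nat \<Rightarrow> cmd" where
  "copy a b t = Seq (move_rev a t) (move_rev2 t a b)"

lemma does_copy:
  assumes "a \<noteq> b" "a \<noteq> t" "b \<noteq> t" "E t = []"
  shows "does (copy a b t) E (length (E a) * 18 + 3) (E(b := E a @ E b))"
proof -
  have "does (copy a b t) E (Suc ((length (E a) * 7 + 1) + (length (E a) * 11 + 1))) (E(b := E a @ E b))"
    unfolding copy_def
    by (rule does_Seq, rule does_move_rev, use assms in simp,
        rule does_weaken, rule does_move_rev2) (use assms in \<open>auto simp: fun_eq_iff\<close>)
  then show ?thesis by (rule does_weaken) auto
qed

definition transfer :: "nat \<Rightarrow> nat \<Rightarrow> nat \<Rightarrow> cmd" where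
  "transfer a b t = Seq (move_rev a t) (move_rev t b)"

lemma does_transfer:
  assumes "a \<noteq> b" "a \<noteq> t" "b \<noteq> t" "E t = []"
  shows "does (transfer a b t) E (length (E a) * 14 + 3) (E(a := [], b := E a @ E b))"
proof -
  have "does (transfer a b t) E (Suc ((length (E a) * 7 + 1) + (length (E a) * 7 + 1)))
      (E(a := [], b := E a @ E b))"
    unfolding transfer_def
    by (rule does_Seq, rule does_move_rev, use assms in simp,
        rule does_weaken, rule does_move_rev) (use assms in \<open>auto simp: fun_eq_iff\<close>)
  then show ?thesis by (rule does_weaken) auto
qed


section \<open>Polynomially bounded functions\<close>

definition pbd :: "('e \<Rightarrow> nat) \<Rightarrow> ('e \<Rightarrow> nat) \<Rightarrow> bool" where
  "pbd s g \<longleftrightarrow> (\<exists>p :: nat poly. \<forall>e. g e \<le> poly p (s e))"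

text \<open>Coefficients are natural numbers, so the polynomials are monotone; this is what lets
  bounds be composed.\<close>

lemma poly_mono_nat: "x \<le> y \<Longrightarrow> poly p x \<le> poly (p :: nat poly) y"
  by (induction p) (auto intro!: add_mono mult_mono)

lemma pbd_const: "pbd s (\<lambda>e. c)"
  unfolding pbd_def by (rule exI[of _ "[:c:]"]) simp

lemma pbd_self: "pbd s s"
  unfolding pbd_def by (rule exI[of _ "[:0, 1:]"]) simp

lemma pbd_add: "pbd s g \<Longrightarrow> pbd s h \<Longrightarrow> pbd s (\<lambda>e. g e + h e)"
  unfolding pbd_def by (metis add_mono poly_add)

lemma pbd_mult: "pbd s g \<Longrightarrow> pbd s h \<Longrightarrow> pbd s (\<lambda>e. g e * h e)"
  unfolding pbd_def by (metis mult_le_mono poly_mult)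

lemma pbd_Suc: "pbd s g \<Longrightarrow> pbd s (\<lambda>e. Suc (g e))"
  using pbd_add[OF pbd_const[of s 1]] by simp

lemma pbd_poly: "pbd s g \<Longrightarrow> pbd s (\<lambda>e. poly p (g e))"
  unfolding pbd_def by (metis order_trans poly_mono_nat poly_pcompose)

lemma pbd_le: "pbd s g \<Longrightarrow> (\<And>e. h e \<le> g e) \<Longrightarrow> pbd s h"
  unfolding pbd_def by (meson order_trans)

lemmas pbd_intros = pbd_const pbd_self pbd_add pbd_mult pbd_Suc pbd_poly


section \<open>Functions computable in polynomial time\<close>

definition size_of :: "('e \<Rightarrow> bool list) list \<Rightarrow> 'e \<Rightarrow> nat" where
  "size_of vs e = (\<Sum>v\<leftarrow>vs. length (v e))"

text \<open>Registers below \<open>k\<close> that are not listed may hold data of a surrounding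
  program. The final state \<open>E(out := f e)\<close> demanded by \<open>pt\<close> forces a
  program to leave these, its inputs and the empty scratch area as it found them.\<close>

definition ready ::
    "('e \<Rightarrow> bool list) list \<Rightarrow> nat list \<Rightarrow> nat \<Rightarrow> nat \<Rightarrow> regs \<Rightarrow> 'e \<Rightarrow> bool" where
  "ready vs is out k E e \<longleftrightarrow> length is = length vs \<and> set is \<subseteq> {..<k} \<and> out < k \<and> out \<notin> set is \<and>
     map E is = map (\<lambda>v. v e) vs \<and> E out = [] \<and> (\<forall>j\<ge>k. E j = [])"

text \<open>
  The inputs of \<open>f e\<close> are the words \<open>v e\<close> for \<open>v\<close> in \<open>vs\<close>. A program has to exist for every placement
  of the inputs (registers \<open>is\<close>), the output (\<open>out\<close>) and the scratch area (registers from \<open>k\<close> on),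
  so that programs can be composed without renaming registers.
\<close>

definition pt :: "('e \<Rightarrow> bool list) list \<Rightarrow> ('e \<Rightarrow> bool list) \<Rightarrow> bool" where
  "pt vs f \<longleftrightarrow> pbd (size_of vs) (\<lambda>e. length (f e)) \<and>
     (\<exists>\<tau> C. pbd (size_of vs) \<tau> \<and>
       (\<forall>is out k E e. ready vs is out k E e \<longrightarrow> does (C is out k) E (\<tau> e) (E(out := f e))))"

lemma ptI:
  assumes "pbd (size_of vs) (\<lambda>e. length (f e))" "pbd (size_of vs) \<tau>"
    "\<And>is out k E e. ready vs is out k E e \<Longrightarrow> does (C is out k) E (\<tau> e) (E(out := f e))"
  shows "pt vs f"
  using assms unfolding pt_def by blast

lemma ptE:
  assumes "pt vs f"
  obtains \<tau> C where "pbd (size_of vs) \<tau>"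
    "\<And>is out k E e. ready vs is out k E e \<Longrightarrow> does (C is out k) E (\<tau> e) (E(out := f e))"
  using assms unfolding pt_def by blast

lemma pt_length: "pt vs f \<Longrightarrow> pbd (size_of vs) (\<lambda>e. length (f e))"
  by (simp add: pt_def)

lemma ready_weaken:
  assumes "ready vs is out k E e" "\<And>i. i \<in> set is \<Longrightarrow> E' i = E i"
    "k \<le> out'" "out' < k'" "E' out' = []" "\<And>j. k' \<le> j \<Longrightarrow> E' j = []"
  shows "ready vs is out' k' E' e"
proof -
  have "map E' is = map E is" using assms(2) by simp
  moreover have "map E is = map (\<lambda>v. v e) vs" "length is = length vs" "set is \<subseteq> {..<k}"
    using assms(1) by (simp_all add: ready_def)
  ultimately show ?thesis
    using assms(3-6) unfolding ready_def by (auto simp: subset_iff)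
qed

text \<open>An intermediate result goes to the first scratch register, which moves the scratch area
  up by one; the old output register may already be filled.\<close>

lemma ready_fresh:
  assumes "ready vs is out k E e"
  shows "ready vs is k (Suc k) (E(out := w)) e"
  by (rule ready_weaken[OF assms]) (use assms in \<open>auto simp: ready_def\<close>)

lemma pt_cong: "pt vs f \<Longrightarrow> (\<And>e. f e = g e) \<Longrightarrow> pt vs g"
  by (metis ext)

section \<open>Closure under basic word operations\<close>

lemma pt_var:
  assumes "v \<in> set vs"
  shows "pt vs v"
proof -
  obtain i where i: "i < length vs" "vs ! i = v" using assms by (auto simp: in_set_conv_nth)
  have le: "length (v e) \<le> size_of vs e" for e
    using assms member_le_sum_list[of "length (v e)" "map (\<lambda>v. length (v e)) vs"]
    by (auto simp: size_of_def)
  show ?thesis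
  proof (rule ptI[where \<tau> = "\<lambda>e. size_of vs e * 18 + 3" and C = "\<lambda>is out k. copy (is ! i) out k"])
    show "pbd (size_of vs) (\<lambda>e. length (v e))" by (rule pbd_le[OF pbd_self le])
    show "pbd (size_of vs) (\<lambda>e. size_of vs e * 18 + 3)" by (intro pbd_intros)
    fix "is" out k E e assume r: "ready vs is out k E e"
    then have "is ! i \<in> set is" using i by (simp add: ready_def)
    moreover have "E (is ! i) = v e" using r i unfolding ready_def by (metis length_map nth_map)
    ultimately show "does (copy (is ! i) out k) E (size_of vs e * 18 + 3) (E(out := v e))"
      using r le[of e] by (intro does_weaken[OF does_copy]) (auto simp: ready_def)
  qed
qed

lemma pt_const: "pt vs (\<lambda>e. w)"
proof (rule ptI[where \<tau> = "\<lambda>e. 4 * length w + 1" and C = "\<lambda>is out k. foldr (\<lambda>b c. Seq c (push out b)) w Skip"])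
  fix "is" out k E e assume "ready vs is out k E e"
  then have "E out = []" by (simp add: ready_def)
  then show "does (foldr (\<lambda>b c. Seq c (push out b)) w Skip) E (4 * length w + 1) (E(out := w))"
  proof (induction w)
    case Nil
    then have "E(out := []) = E" by (simp add: fun_upd_idem)
    then show ?case using does_Skip[of E] by simp
  next
    case (Cons b w)
    have "does (Seq (foldr (\<lambda>b c. Seq c (push out b)) w Skip) (push out b)) E
        (Suc ((4 * length w + 1) + 3)) ((E(out := w))(out := b # (E(out := w)) out))"
      by (rule does_Seq[OF Cons.IH[OF Cons.prems] does_push])
    then show ?case unfolding foldr.simps comp_apply by (rule does_weaken) auto
  qed
qed (intro pbd_intros)+

lemma pt_append:
  assumes "pt vs f" "pt vs g"
  shows "pt vs (\<lambda>e. f e @ g e)"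
proof -
  obtain \<tau>f Cf where f: "pbd (size_of vs) \<tau>f"
    "\<And>is out k E e. ready vs is out k E e \<Longrightarrow> does (Cf is out k) E (\<tau>f e) (E(out := f e))"
    using ptE[OF assms(1)] by blast
  obtain \<tau>g Cg where g: "pbd (size_of vs) \<tau>g"
    "\<And>is out k E e. ready vs is out k E e \<Longrightarrow> does (Cg is out k) E (\<tau>g e) (E(out := g e))"
    using ptE[OF assms(2)] by blast
  show ?thesis
  \<comment> \<open>\<open>g e\<close> is computed before \<open>f e\<close>: the output is a stack,
    and the transfer puts \<open>f e\<close> on top of it.\<close>
  proof (rule ptI[where C = "\<lambda>is out k. Seq (Cg is out k) (Seq (Cf is k (Suc k)) (transfer k out (Suc k)))"])
    show "pbd (size_of vs) (\<lambda>e. length (f e @ g e))"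
      using pbd_add[OF pt_length[OF assms(1)] pt_length[OF assms(2)]] by simp
    show "pbd (size_of vs) (\<lambda>e. Suc (\<tau>g e + Suc (\<tau>f e + (length (f e) * 14 + 3))))"
      by (intro pbd_intros f(1) g(1) pt_length[OF assms(1)])
    fix "is" out k E e assume r: "ready vs is out k E e"
    have "does (transfer k out (Suc k)) (E(out := g e, k := f e)) (length (f e) * 14 + 3) (E(out := f e @ g e))"
      using does_transfer[of k out "Suc k" "E(out := g e, k := f e)"] r
      by (auto simp: ready_def fun_upd_twist elim!: does_weaken)
    then show "does (Seq (Cg is out k) (Seq (Cf is k (Suc k)) (transfer k out (Suc k)))) E
       (Suc (\<tau>g e + Suc (\<tau>f e + (length (f e) * 14 + 3)))) (E(out := f e @ g e))"
      by (intro does_Seq[OF g(2)[OF r]] does_Seq[OF f(2)[OF ready_fresh[OF r]]])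
  qed
qed

lemma pt_tl:
  assumes "pt vs f"
  shows "pt vs (\<lambda>e. tl (f e))"
proof -
  obtain \<tau>f Cf where f: "pbd (size_of vs) \<tau>f"
    "\<And>is out k E e. ready vs is out k E e \<Longrightarrow> does (Cf is out k) E (\<tau>f e) (E(out := f e))"
    using ptE[OF assms(1)] by blast
  show ?thesis
  \<comment> \<open>Popping an empty stack would move past its end, hence the test.\<close>
  proof (rule ptI[where C = "\<lambda>is out k. Seq (Cf is out k) (Cond (Suc out) 0 Skip (Move (Suc out) Move_Right))"])
    show "pbd (size_of vs) (\<lambda>e. length (tl (f e)))"
      by (rule pbd_le[OF pt_length[OF assms]]) simp
    show "pbd (size_of vs) (\<lambda>e. Suc (\<tau>f e + Suc 1))"
      by (intro pbd_intros f(1))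
    fix "is" out k E e assume r: "ready vs is out k E e"
    have "does (Cond (Suc out) 0 Skip (Move (Suc out) Move_Right)) (E(out := f e)) (Suc 1) (E(out := tl (f e)))"
    proof (rule does_Cond_empty[OF refl])
      show "does (if (E(out := f e)) out = [] then Skip else Move (Suc out) Move_Right) (E(out := f e)) 1
          (E(out := tl (f e)))"
        using does_pop[of "E(out := f e)" out] does_Skip[of "E(out := f e)"] by auto
    qed
    then show "does (Seq (Cf is out k) (Cond (Suc out) 0 Skip (Move (Suc out) Move_Right))) E
        (Suc (\<tau>f e + Suc 1)) (E(out := tl (f e)))"
      by (intro does_Seq[OF f(2)[OF r]])
  qed
qed

lemma pt_if_hd:
  assumes "pt vs h" "pt vs f" "pt vs g"
  shows "pt vs (\<lambda>e. if h e \<noteq> [] \<and> hd (h e) then f e else g e)"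
proof -
  obtain \<tau>h Ch where h: "pbd (size_of vs) \<tau>h"
    "\<And>is out k E e. ready vs is out k E e \<Longrightarrow> does (Ch is out k) E (\<tau>h e) (E(out := h e))"
    using ptE[OF assms(1)] by blast
  obtain \<tau>f Cf where f: "pbd (size_of vs) \<tau>f"
    "\<And>is out k E e. ready vs is out k E e \<Longrightarrow> does (Cf is out k) E (\<tau>f e) (E(out := f e))"
    using ptE[OF assms(2)] by blast
  obtain \<tau>g Cg where g: "pbd (size_of vs) \<tau>g"
    "\<And>is out k E e. ready vs is out k E e \<Longrightarrow> does (Cg is out k) E (\<tau>g e) (E(out := g e))"
    using ptE[OF assms(3)] by blast
  show ?thesis
  \<comment> \<open>The tested register is the start of the scratch area of both branches and must
    be emptied before either runs.\<close>
  proof (rule ptI[where C = "\<lambda>is out k. Seq (Ch is k (Suc k))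
      (Cond (Suc k) 2 (Seq (clear k) (Cf is out k)) (Seq (clear k) (Cg is out k)))"])
    show "pbd (size_of vs) (\<lambda>e. length (if h e \<noteq> [] \<and> hd (h e) then f e else g e))"
      by (rule pbd_le[OF pbd_add[OF pt_length[OF assms(2)] pt_length[OF assms(3)]]]) simp
    show "pbd (size_of vs) (\<lambda>e. Suc (\<tau>h e + Suc (Suc ((length (h e) * 5 + 1) + (\<tau>f e + \<tau>g e)))))"
      by (intro pbd_intros f(1) g(1) h(1) pt_length[OF assms(1)])
    fix "is" out k E e assume r: "ready vs is out k E e"
    let ?b = "h e \<noteq> [] \<and> hd (h e)"
    have "does (clear k) (E(k := h e)) (length (h e) * 5 + 1) E"
      using does_clear[of k "E(k := h e)"] r by (auto simp: ready_def fun_upd_idem)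
    moreover have "does (if ?b then Cf is out k else Cg is out k) E (\<tau>f e + \<tau>g e) (E(out := if ?b then f e else g e))"
      using f(2)[OF r] g(2)[OF r] by (auto intro: does_weaken)
    ultimately have "does (Seq (clear k) (if ?b then Cf is out k else Cg is out k)) (E(k := h e))
        (Suc ((length (h e) * 5 + 1) + (\<tau>f e + \<tau>g e))) (E(out := if ?b then f e else g e))"
      by (rule does_Seq)
    then have "does (Cond (Suc k) 2 (Seq (clear k) (Cf is out k)) (Seq (clear k) (Cg is out k))) (E(k := h e))
        (Suc (Suc ((length (h e) * 5 + 1) + (\<tau>f e + \<tau>g e)))) (E(out := if ?b then f e else g e))"
      by (intro does_Cond_hd[where P = ?b]) (auto split: if_splits)
    moreover have "does (Ch is k (Suc k)) E (\<tau>h e) (E(k := h e))"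
      using h(2)[OF ready_fresh[OF r, of "E out"]] by simp
    ultimately show "does (Seq (Ch is k (Suc k))
        (Cond (Suc k) 2 (Seq (clear k) (Cf is out k)) (Seq (clear k) (Cg is out k)))) E
        (Suc (\<tau>h e + Suc (Suc ((length (h e) * 5 + 1) + (\<tau>f e + \<tau>g e))))) (E(out := if ?b then f e else g e))"
      by (intro does_Seq)
  qed
qed

text \<open>An index becomes an input in unary: it counts with its value towards the input size, so
  bounds may be polynomial in it.\<close>

definition ext_nat :: "('e \<Rightarrow> bool list) list \<Rightarrow> ('e \<times> nat \<Rightarrow> bool list) list" where
  "ext_nat vs = (\<lambda>p. replicate (snd p) True) # map (\<lambda>v p. v (fst p)) vs"

definition ext_word :: "('e \<Rightarrow> bool list) list \<Rightarrow> ('e \<times> bool list \<Rightarrow> bool list) list" where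
  "ext_word vs = snd # map (\<lambda>v p. v (fst p)) vs"

lemma size_of_ext: "size_of (ext_word (ext_nat vs)) ((e, i), a) = length a + (i + size_of vs e)"
  by (simp add: size_of_def ext_word_def ext_nat_def comp_def)

lemma pt_weaken:
  assumes "pt vs f"
  shows "pt (a # map (\<lambda>v p. v (fst p)) vs) (\<lambda>p. f (fst p))"
proof -
  obtain \<tau>f Cf where f: "pbd (size_of vs) \<tau>f"
    "\<And>is out k E e. ready vs is out k E e \<Longrightarrow> does (Cf is out k) E (\<tau>f e) (E(out := f e))"
    using ptE[OF assms(1)] by blast
  let ?vs = "a # map (\<lambda>v p. v (fst p)) vs"
  have le: "size_of vs (fst p) \<le> size_of ?vs p" for p
    by (simp add: size_of_def comp_def)
  have bd: "pbd (size_of ?vs) (\<lambda>p. g (fst p))" if g: "pbd (size_of vs) g" for g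
  proof -
    obtain q where "g e \<le> poly q (size_of vs e)" for e
      using g by (auto simp: pbd_def)
    then have "g (fst p) \<le> poly q (size_of ?vs p)" for p
      using poly_mono_nat[OF le] order_trans by blast
    then show ?thesis unfolding pbd_def by blast
  qed
  show ?thesis
  proof (rule ptI[where C = "\<lambda>is out k. Cf (tl is) out k"])
    show "pbd (size_of ?vs) (\<lambda>p. length (f (fst p)))" by (rule bd[OF pt_length[OF assms]])
    show "pbd (size_of ?vs) (\<lambda>p. \<tau>f (fst p))" by (rule bd[OF f(1)])
    fix "is" out k E p assume "ready ?vs is out k E p"
    then have "ready vs (tl is) out k E (fst p)"
      by (cases "is") (auto simp: ready_def comp_def)
    then show "does (Cf (tl is) out k) E (\<tau>f (fst p)) (E(out := f (fst p)))" by (rule f(2))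
  qed
qed

text \<open>The bound \<open>B\<close> on all intermediate results is essential: a step such as
  doubling a word is polynomial, but its iteration is not.\<close>

lemma pt_rec:
  fixes h z g B
  defines "R \<equiv> \<lambda>e i. rec_nat (z e) (\<lambda>i a. g ((e, i), a)) i"
  assumes "pt vs h" "pt vs z" "pt (ext_word (ext_nat vs)) g" "pbd (size_of vs) B"
    and B: "\<And>e i. i \<le> length (h e) \<Longrightarrow> length (R e i) \<le> B e"
  shows "pt vs (\<lambda>e. R e (length (h e)))"
proof -
  obtain \<tau>h Ch where h: "pbd (size_of vs) \<tau>h"
    "\<And>is out k E e. ready vs is out k E e \<Longrightarrow> does (Ch is out k) E (\<tau>h e) (E(out := h e))"
    using ptE[OF \<open>pt vs h\<close>] by blast
  obtain \<tau>z Cz where z: "pbd (size_of vs) \<tau>z"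
    "\<And>is out k E e. ready vs is out k E e \<Longrightarrow> does (Cz is out k) E (\<tau>z e) (E(out := z e))"
    using ptE[OF \<open>pt vs z\<close>] by blast
  obtain \<tau>g Cg where g: "pbd (size_of (ext_word (ext_nat vs))) \<tau>g"
    "\<And>is out k E p. ready (ext_word (ext_nat vs)) is out k E p \<Longrightarrow> does (Cg is out k) E (\<tau>g p) (E(out := g p))"
    using ptE[OF \<open>pt (ext_word (ext_nat vs)) g\<close>] by blast
  obtain q where q: "\<tau>g p \<le> poly q (size_of (ext_word (ext_nat vs)) p)" for p
    using g(1) by (auto simp: pbd_def)
  define T where "T e = poly q (B e + (length (h e) + size_of vs e)) + 19 * B e + 20" for e
  \<comment> \<open>Register \<open>k\<close> drives the loop, \<open>k + 1\<close> is the
    accumulator, \<open>k + 2\<close> the index in unary. The new value is built in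
    \<open>k + 3\<close>, since the accumulator is still being read. The bits in \<open>k\<close>
    are ignored, so both branches of the loop are this body.\<close>
  define body where "body is k = Seq (Cg ((k + 1) # (k + 2) # is) (k + 3) (k + 4))
      (Seq (clear (k + 1)) (Seq (transfer (k + 3) (k + 1) (k + 4)) (push (k + 2) True)))" for "is" and k :: nat
  have length_h: "pbd (size_of vs) (\<lambda>e. length (h e))" by (rule pt_length[OF \<open>pt vs h\<close>])
  show ?thesis
  proof (rule ptI[where C = "\<lambda>is out k. Seq (Ch is k (k + 1)) (Seq (Cz is (k + 1) (k + 2))
        (Seq (loop k (body is k) (body is k)) (Seq (clear (k + 2)) (transfer (k + 1) out (k + 2)))))"])
    show "pbd (size_of vs) (\<lambda>e. length (R e (length (h e))))"
      by (rule pbd_le[OF \<open>pbd (size_of vs) B\<close>]) (simp add: B)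
    show "pbd (size_of vs) (\<lambda>e. Suc (\<tau>h e + Suc (\<tau>z e + Suc (length (h e) * (T e + 4) + 1 +
        Suc (length (h e) * 5 + 1 + (B e * 14 + 3))))))"
      unfolding T_def by (intro pbd_intros h(1) z(1) length_h \<open>pbd (size_of vs) B\<close>)
    fix "is" out k E e assume r: "ready vs is out k E e"
    have fresh: "i < k" "i \<noteq> out" if "i \<in> set is" for i using r that by (auto simp: ready_def)
    have out: "out < k" "E out = []" using r by (auto simp: ready_def)
    have empty: "E j = []" if "k \<le> j" for j using r that by (auto simp: ready_def)
    have len: "length is = length vs" and map_is: "map E is = map (\<lambda>v. v e) vs"
      using r by (auto simp: ready_def)
    define S where "S i = E(k + 1 := R e i, k + 2 := replicate i True)" for i
    have step: "does (body is k) ((S i)(k := w)) (T e) ((S (Suc i))(k := w))"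
      if "i < length (h e)" for i w
    proof -
      let ?E = "(S i)(k := w)"
      let ?p = "((e, i), R e i)"
      have E: "?E j = E j" if "j < k" for j using that by (auto simp: S_def)
      have "ready (ext_word (ext_nat vs)) ((k + 1) # (k + 2) # is) (k + 3) (k + 4) ?E ?p"
        unfolding ready_def
      proof (intro conjI)
        have "map ?E is = map (\<lambda>v. v e) vs" using E fresh map_is by (metis (no_types, lifting) map_eq_conv)
        then show "map ?E ((k + 1) # (k + 2) # is) = map (\<lambda>v. v ?p) (ext_word (ext_nat vs))"
          by (simp add: ext_word_def ext_nat_def S_def comp_def)
      qed (use len empty fresh(1) in \<open>fastforce simp: ext_word_def ext_nat_def S_def\<close>)+
      then have 1: "does (Cg ((k + 1) # (k + 2) # is) (k + 3) (k + 4)) ?E (\<tau>g ?p) (?E(k + 3 := R e (Suc i)))"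
        using g(2) by (fastforce simp: R_def)
      have 2: "does (clear (k + 1)) (?E(k + 3 := R e (Suc i))) (B e * 5 + 1) (?E(k + 3 := R e (Suc i), k + 1 := []))"
        using B[of i e] that by (intro does_weaken[OF does_clear]) (auto simp: S_def)
      have 3: "does (transfer (k + 3) (k + 1) (k + 4)) (?E(k + 3 := R e (Suc i), k + 1 := [])) (B e * 14 + 3)
          (?E(k + 1 := R e (Suc i)))"
        using B[of "Suc i" e] that empty
        by (intro does_weaken[OF does_transfer]) (auto simp: S_def fun_eq_iff)
      have 4: "does (push (k + 2) True) (?E(k + 1 := R e (Suc i))) 3 ((S (Suc i))(k := w))"
        by (intro does_weaken[OF does_push]) (auto simp: S_def fun_eq_iff)
      have "\<tau>g ?p \<le> poly q (B e + (length (h e) + size_of vs e))"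
        using q[of ?p] B[of i e] that
        by (auto simp: size_of_ext intro!: order_trans[OF q[of ?p]] poly_mono_nat)
      then show ?thesis
        unfolding body_def
        by (intro does_weaken[OF does_Seq[OF 1 does_Seq[OF 2 does_Seq[OF 3 4]]]]) (auto simp: T_def)
    qed
    have 1: "does (Ch is k (k + 1)) E (\<tau>h e) (E(k := h e))"
      using h(2)[OF ready_fresh[OF r, of "E out"]] by simp
    have "ready vs is (k + 1) (k + 2) (E(k := h e)) e"
      by (rule ready_weaken[OF r]) (use fresh empty in \<open>fastforce+\<close>)
    then have 2: "does (Cz is (k + 1) (k + 2)) (E(k := h e)) (\<tau>z e) ((S 0)(k := h e))"
      by (intro does_weaken[OF z(2)]) (auto simp: S_def R_def fun_eq_iff empty)
    have 3: "does (loop k (body is k) (body is k)) ((S 0)(k := h e)) (length (h e) * (T e + 4) + 1)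
        ((S (length (h e)))(k := []))"
      by (rule does_loop) (simp add: step)
    have 4: "does (clear (k + 2)) ((S (length (h e)))(k := [])) (length (h e) * 5 + 1) (E(k + 1 := R e (length (h e))))"
      by (rule does_weaken[OF does_clear]) (auto simp: S_def fun_eq_iff empty)
    have 5: "does (transfer (k + 1) out (k + 2)) (E(k + 1 := R e (length (h e)))) (B e * 14 + 3)
        (E(out := R e (length (h e))))"
      using out B[of "length (h e)" e] by (intro does_weaken[OF does_transfer]) (auto simp: fun_eq_iff empty)
    show "does (Seq (Ch is k (k + 1)) (Seq (Cz is (k + 1) (k + 2))
        (Seq (loop k (body is k) (body is k)) (Seq (clear (k + 2)) (transfer (k + 1) out (k + 2)))))) E
        (Suc (\<tau>h e + Suc (\<tau>z e + Suc (length (h e) * (T e + 4) + 1 +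
        Suc (length (h e) * 5 + 1 + (B e * 14 + 3)))))) (E(out := R e (length (h e))))"
      by (rule does_Seq[OF 1 does_Seq[OF 2 does_Seq[OF 3 does_Seq[OF 4 5]]]])
  qed
qed


section \<open>From programs to the definition of polynomial-time computability\<close>

definition read_input :: "nat \<Rightarrow> cmd" where
  "read_input r = While 0 0 (Seq (Cond 0 2 (push r True) (push r False)) (Move 0 Move_Right))"

lemma exec_read_input:
  assumes "rep y (\<sigma> 0)" "\<sigma> 0 = (c, h)" "rep w (\<sigma> (Suc r))"
  shows "\<exists>\<tau>. exec (read_input r) \<sigma> (length y * 7 + 1) (\<sigma>(0 := (c, h + int (length y)), Suc r := \<tau>)) \<and>
    rep (rev y @ w) \<tau>"
  using assms
proof (induction y arbitrary: \<sigma> h w)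
  case Nil
  then have "exec (read_input r) \<sigma> 1 \<sigma>"
    unfolding read_input_def by (intro exec_While_end) simp
  then show ?case using Nil by (intro exI[of _ "\<sigma> (Suc r)"]) (simp add: fun_upd_idem)
next
  case (Cons b y)
  obtain \<tau> where \<tau>: "exec (push r b) \<sigma> 3 (\<sigma>(Suc r := \<tau>))" "rep (b # w) \<tau>"
    using exec_push[of w \<sigma> r b] Cons.prems(3) by blast
  let ?\<sigma> = "\<sigma>(Suc r := \<tau>, 0 := (c, h + 1))"
  have scan: "scanned (\<sigma> 0) = bit_symbol b" using Cons.prems by simp
  have "exec (Cond 0 2 (push r True) (push r False)) \<sigma> (Suc 3) (\<sigma>(Suc r := \<tau>))"
    by (rule exec_Cond) (use \<tau> scan in \<open>auto split: if_splits\<close>)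
  moreover have "exec (Move 0 Move_Right) (\<sigma>(Suc r := \<tau>)) 1 ?\<sigma>"
    using exec_Move[of 0 Move_Right "\<sigma>(Suc r := \<tau>)"] Cons.prems by simp
  ultimately have 1: "exec (Seq (Cond 0 2 (push r True) (push r False)) (Move 0 Move_Right)) \<sigma> (Suc (Suc 3 + 1)) ?\<sigma>"
    by (rule exec_Seq)
  have "rep y (?\<sigma> 0)" "?\<sigma> 0 = (c, h + 1)" "rep (b # w) (?\<sigma> (Suc r))"
    using Cons.prems \<tau> by auto
  from Cons.IH[OF this] obtain \<tau>' where \<tau>': "exec (read_input r) ?\<sigma> (length y * 7 + 1)
      (?\<sigma>(0 := (c, h + 1 + int (length y)), Suc r := \<tau>'))" "rep (rev y @ b # w) \<tau>'"
    by blast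
  have "exec (read_input r) \<sigma> (Suc (Suc (Suc 3 + 1) + (length y * 7 + 1)))
      (?\<sigma>(0 := (c, h + 1 + int (length y)), Suc r := \<tau>'))"
    using \<tau>'(1) scan unfolding read_input_def by (intro exec_While_step[OF _ 1]) simp_all
  moreover have "?\<sigma>(0 := (c, h + 1 + int (length y)), Suc r := \<tau>') =
      \<sigma>(0 := (c, h + int (length (b # y))), Suc r := \<tau>')"
    by (auto simp: fun_eq_iff)
  ultimately have "exec (read_input r) \<sigma> (length (b # y) * 7 + 1) (\<sigma>(0 := (c, h + int (length (b # y))), Suc r := \<tau>'))"
    by (simp only:) (simp add: eval_nat_numeral)
  moreover have "rep (rev (b # y) @ w) \<tau>'" using \<tau>'(2) by simp
  ultimately show ?case by blast
qed

text \<open>The blank in cell \<open>- 1\<close> stops the search to the left;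
  \<open>h = - 1\<close> is the case of an empty input.\<close>

lemma exec_rewind:
  assumes "\<And>j. 0 \<le> j \<Longrightarrow> j \<le> h \<Longrightarrow> c j \<noteq> 0" "c (- 1) = 0" "\<sigma> 0 = (c, h)" "h \<ge> - 1"
  shows "exec (While 0 0 (Move 0 Move_Left)) \<sigma> (nat (h + 1) * 2 + 1) (\<sigma>(0 := (c, - 1)))"
  using assms
proof (induction "nat (h + 1)" arbitrary: h \<sigma>)
  case 0
  then have "h = - 1" by simp
  with 0 have "exec (While 0 0 (Move 0 Move_Left)) \<sigma> 1 \<sigma>" by (intro exec_While_end) simp
  with 0 \<open>h = - 1\<close> show ?case by (simp add: fun_upd_idem)
next
  case (Suc n)
  then have h: "h \<ge> 0" by simp
  have "exec (While 0 0 (Move 0 Move_Left)) (\<sigma>(0 := (c, h - 1))) (nat h * 2 + 1) (\<sigma>(0 := (c, - 1)))"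
    using Suc.hyps(1)[of "h - 1" "\<sigma>(0 := (c, h - 1))"] Suc.hyps(2) Suc.prems h by fastforce
  moreover have "exec (Move 0 Move_Left) \<sigma> 1 (\<sigma>(0 := (c, h - 1)))"
    using exec_Move[of 0 Move_Left \<sigma>] Suc.prems by simp
  ultimately have "exec (While 0 0 (Move 0 Move_Left)) \<sigma> (Suc (1 + (nat h * 2 + 1))) (\<sigma>(0 := (c, - 1)))"
    using Suc.prems(1)[of h] Suc.prems(3) h by (intro exec_While_step) simp_all
  moreover have "Suc (1 + (nat h * 2 + 1)) = nat (h + 1) * 2 + 1" using h by simp
  ultimately show ?case by argo
qed

definition write_output :: "nat \<Rightarrow> cmd" where
  "write_output r = While (Suc r) 0 (Seq (Cond (Suc r) 2 (Write 0 2) (Write 0 1))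
     (Seq (Move 0 Move_Right) (Move (Suc r) Move_Right)))"

lemma exec_write_output:
  assumes "rep w (\<sigma> (Suc r))" "\<sigma> 0 = (c, h)"
  shows "\<exists>\<sigma>' c'. exec (write_output r) \<sigma> (length w * 7 + 1) \<sigma>' \<and> \<sigma>' 0 = (c', h + int (length w)) \<and>
    (\<forall>i<length w. c' (h + int i) = bit_symbol (w ! i)) \<and> (\<forall>j<h. c' j = c j)"
  using assms
proof (induction w arbitrary: \<sigma> c h)
  case Nil
  then have "exec (write_output r) \<sigma> 1 \<sigma>"
    unfolding write_output_def by (intro exec_While_end) (use rep_scanned_0 in blast)
  then show ?case using Nil by (intro exI[of _ \<sigma>] exI[of _ c]) simp
next
  case (Cons b w)
  obtain d g where dg: "\<sigma> (Suc r) = (d, g)" by fastforce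
  have scan: "scanned (\<sigma> (Suc r)) = bit_symbol b" using Cons.prems dg by simp
  let ?\<sigma>1 = "\<sigma>(0 := (c(h := bit_symbol b), h))"
  let ?\<sigma>2 = "\<sigma>(0 := (c(h := bit_symbol b), h + 1))"
  let ?\<sigma> = "\<sigma>(0 := (c(h := bit_symbol b), h + 1), Suc r := (d, g + 1))"
  have "exec (Cond (Suc r) 2 (Write 0 2) (Write 0 1)) \<sigma> (Suc 1) ?\<sigma>1"
    using exec_Write[of 0 "bit_symbol b" \<sigma>] scan Cons.prems
    by (intro exec_Cond) (cases b, simp_all add: bit_symbol_def)
  moreover have "exec (Seq (Move 0 Move_Right) (Move (Suc r) Move_Right)) ?\<sigma>1 (Suc (1 + 1)) ?\<sigma>"
    using exec_Move[of 0 Move_Right ?\<sigma>1] exec_Move[of "Suc r" Move_Right ?\<sigma>2] dg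
    by (intro exec_Seq[of _ _ 1 ?\<sigma>2]) auto
  ultimately have 1: "exec (Seq (Cond (Suc r) 2 (Write 0 2) (Write 0 1))
     (Seq (Move 0 Move_Right) (Move (Suc r) Move_Right))) \<sigma> (Suc (Suc 1 + Suc (1 + 1))) ?\<sigma>"
    by (rule exec_Seq)
  have "rep w (?\<sigma> (Suc r))" "?\<sigma> 0 = (c(h := bit_symbol b), h + 1)" using Cons.prems dg by auto
  then obtain \<sigma>' c' where *: "exec (write_output r) ?\<sigma> (length w * 7 + 1) \<sigma>'"
      "\<sigma>' 0 = (c', h + 1 + int (length w))"
      "\<And>i. i < length w \<Longrightarrow> c' (h + 1 + int i) = bit_symbol (w ! i)"
      "\<And>j. j < h + 1 \<Longrightarrow> c' j = (c(h := bit_symbol b)) j"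
    using Cons.IH by blast
  have "exec (write_output r) \<sigma> (Suc (Suc (Suc 1 + Suc (1 + 1)) + (length w * 7 + 1))) \<sigma>'"
    using exec_While_step[OF _ 1] *(1) scan unfolding write_output_def by simp
  then have "exec (write_output r) \<sigma> (length (b # w) * 7 + 1) \<sigma>'"
    by (simp add: eval_nat_numeral)
  moreover have "c' (h + int i) = bit_symbol ((b # w) ! i)" if "i < length (b # w)" for i
    using *(3)[of "i - 1"] *(4)[of h] that by (cases i) (auto simp: algebra_simps)
  ultimately show ?case using *(2,4) by (intro exI[of _ \<sigma>'] exI[of _ c']) auto
qed

lemma rep_nth: "rep w (c, h) \<longleftrightarrow> (\<forall>i<length w. c (h + int i) = bit_symbol (w ! i)) \<and> c (h + int (length w)) = 0"
proof (induction w arbitrary: h)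
  case (Cons b w)
  then show ?case by (auto simp: less_Suc_eq_0_disj algebra_simps)
qed simp

lemma rep_tape_of: "rep w (tape_of w)"
  by (simp add: tape_of_def rep_nth)

lemma funpow_fixpoint: "f x = x \<Longrightarrow> (f ^^ n) x = x"
  by (induction n) auto

text \<open>Word \<open>i > 0\<close> lies on tape \<open>i\<close> and so already is register
  \<open>i - 1\<close>. Word 0 lies on tape 0 and has to be moved: it is read in reverse into
  register \<open>r\<close>, which later receives the output, and reversed again into the free
  register \<open>r - 1\<close>.\<close>

theorem pt_poly_time_computable:
  assumes r: "1 \<le> r" and "pt (map (\<lambda>i ws. ws ! i) [0..<r]) f"
  shows "poly_time_computable r f"
proof -
  let ?vs = "map (\<lambda>i ws. ws ! i) [0..<r] :: (bool list list \<Rightarrow> bool list) list"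
  obtain \<tau> C where \<tau>: "pbd (size_of ?vs) \<tau>"
    and C: "\<And>is out k E e. ready ?vs is out k E e \<Longrightarrow> does (C is out k) E (\<tau> e) (E(out := f e))"
    using ptE[OF assms(2)] by blast
  have length_f: "pbd (size_of ?vs) (\<lambda>ws. length (f ws))" by (rule pt_length[OF assms(2)])
  define s where "s = size_of ?vs"
  have s: "s ws = sum_list (map length ws)" if "length ws = r" for ws
    using that by (auto simp: s_def size_of_def comp_def intro!: arg_cong[where f = sum_list] nth_equalityI)
  define "is" where "is = map (\<lambda>i. if i = 0 then r - 1 else i - 1) [0..<r]"
  define main where "main = C is r (Suc r)"
  \<comment> \<open>Reading ends on the blank behind the input; one step left, the search for the
    blank in cell \<open>- 1\<close> and one step right bring the head to cell 0, where the output
    starts. The final \<open>Write 0 0\<close> ends the output, as symbols of a longer input may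
    follow it.\<close>
  define c where "c = Seq (read_input r) (Seq (Move 0 Move_Left) (Seq (While 0 0 (Move 0 Move_Left))
    (Seq (Move 0 Move_Right) (Seq (move_rev r (r - 1)) (Seq main (Seq (write_output r) (Write 0 0)))))))"
  define B where "B ws = s ws * 16 + \<tau> ws + length (f ws) * 7 + 20" for ws
  have "pbd s B" unfolding B_def s_def by (intro pbd_intros \<tau> length_f)
  then obtain p where p: "B ws \<le> poly p (s ws)" for ws by (auto simp: pbd_def)
  obtain T where T: "wf_tm T" "r \<le> ntapes T"
    "\<And>\<sigma> t \<sigma>'. exec c \<sigma> t \<sigma>' \<Longrightarrow>
       (step T ^^ t) (0, map \<sigma> [0..<ntapes T]) = (nstates T, map \<sigma>' [0..<ntapes T])"
    using compile[of r c] by blast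
  have "computes_within T ws (poly p (sum_list (map length ws))) (f ws)" if ws: "length ws = r" for ws
  proof -
    define x where "x = ws ! 0"
    define n where "n = length x"
    have "x \<in> set ws" using ws r by (simp add: x_def)
    then have n_le: "n \<le> s ws"
      using member_le_sum_list[of n "map length ws"] s[OF ws] by (simp add: n_def)
    define \<sigma>0 where "\<sigma>0 i = tape_of (if i < length ws then ws ! i else [])" for i
    obtain cx where cx: "tape_of x = (cx, 0)" by (simp add: tape_of_def)
    have cx_nz: "cx j \<noteq> 0" if "0 \<le> j" "j < int n" for j
      using cx that bit_symbol_neq(1) by (auto simp: tape_of_def n_def simp del: bit_symbol_neq)
    have cx_m1: "cx (- 1) = 0" using cx by (auto simp: tape_of_def)
    have \<sigma>0: "\<sigma>0 0 = (cx, 0)" using ws r cx by (simp add: \<sigma>0_def x_def)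
    have "rep x (\<sigma>0 0)" "rep [] (\<sigma>0 (Suc r))"
      using ws r rep_tape_of[of x] rep_tape_of[of "[]"] by (auto simp: \<sigma>0_def x_def)
    from exec_read_input[OF this(1) \<sigma>0 this(2)] obtain \<tau>x where
      1: "exec (read_input r) \<sigma>0 (n * 7 + 1) (\<sigma>0(0 := (cx, int n), Suc r := \<tau>x))" and \<tau>x: "rep (rev x) \<tau>x"
      by (auto simp: n_def)
    define \<sigma>1 where "\<sigma>1 i = \<sigma>0(0 := (cx, i), Suc r := \<tau>x)" for i
    have 2: "exec (Move 0 Move_Left) (\<sigma>1 (int n)) 1 (\<sigma>1 (int n - 1))"
      using exec_Move[of 0 Move_Left "\<sigma>1 (int n)"] by (simp add: \<sigma>1_def fun_upd_twist)
    have 3: "exec (While 0 0 (Move 0 Move_Left)) (\<sigma>1 (int n - 1)) (n * 2 + 1) (\<sigma>1 (- 1))"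
      using exec_rewind[of "int n - 1" cx "\<sigma>1 (int n - 1)"] cx_nz cx_m1 by (simp add: \<sigma>1_def fun_upd_twist)
    have 4: "exec (Move 0 Move_Right) (\<sigma>1 (- 1)) 1 (\<sigma>1 0)"
      using exec_Move[of 0 Move_Right "\<sigma>1 (- 1)"] by (simp add: \<sigma>1_def fun_upd_twist)
    define E0 :: regs where "E0 j = (if j = r then rev x else if Suc j < r then ws ! Suc j else [])" for j
    define E1 where "E1 = E0(r := [], r - 1 := x)"
    have rep1: "rep (E0 j) (\<sigma>1 0 (Suc j))" for j
      using ws \<tau>x rep_tape_of by (simp add: E0_def \<sigma>1_def \<sigma>0_def)
    have "r - 1 \<noteq> r" "\<not> Suc (r - 1) < r" using r by auto
    then have "does (move_rev r (r - 1)) E0 (n * 7 + 1) E1"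
      using does_move_rev[of r "r - 1" E0] by (simp add: E0_def E1_def n_def)
    moreover have "does main E1 (\<tau> ws) (E1(r := f ws))"
      unfolding main_def
    proof (rule C)
      have "map E1 is = map (\<lambda>i. ws ! i) [0..<r]"
        using r by (auto simp: is_def E1_def E0_def x_def)
      then show "ready ?vs is r (Suc r) E1 ws"
        using r by (auto simp: ready_def is_def E1_def E0_def comp_def)
    qed
    ultimately have "does (Seq (move_rev r (r - 1)) main) E0 (Suc (n * 7 + 1 + \<tau> ws)) (E1(r := f ws))"
      by (rule does_Seq)
    then obtain \<sigma>2 t2 t3 \<sigma>3 where
      5: "exec (move_rev r (r - 1)) (\<sigma>1 0) t2 \<sigma>2" "t2 \<le> n * 7 + 1" and
      6: "exec main \<sigma>2 t3 \<sigma>3" "t3 \<le> \<tau> ws" and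
      \<sigma>3: "\<sigma>3 0 = \<sigma>1 0 0" "\<And>j. rep ((E1(r := f ws)) j) (\<sigma>3 (Suc j))"
      using doesE[OF \<open>does (move_rev r (r - 1)) E0 _ _\<close>, of "\<sigma>1 0"] doesE[OF \<open>does main E1 _ _\<close>] rep1
      by metis
    have "\<sigma>3 0 = (cx, 0)" "rep (f ws) (\<sigma>3 (Suc r))"
      using \<sigma>3(1) \<sigma>3(2)[of r] by (auto simp: \<sigma>1_def)
    from exec_write_output[OF this(2,1)] obtain \<sigma>4 c4 where
      7: "exec (write_output r) \<sigma>3 (length (f ws) * 7 + 1) \<sigma>4"
      and \<sigma>4: "\<sigma>4 0 = (c4, int (length (f ws)))" "\<And>i. i < length (f ws) \<Longrightarrow> c4 (int i) = bit_symbol (f ws ! i)"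
      by auto
    define \<sigma>5 where "\<sigma>5 = \<sigma>4(0 := (c4(int (length (f ws)) := 0), int (length (f ws))))"
    have 8: "exec (Write 0 0) \<sigma>4 1 \<sigma>5"
      using exec_Write[of 0 0 \<sigma>4] \<sigma>4(1) by (simp add: \<sigma>5_def)
    obtain t where t: "exec c \<sigma>0 t \<sigma>5" "t \<le> B ws"
    proof -
      note all = exec_Seq[OF 1[folded \<sigma>1_def] exec_Seq[OF 2 exec_Seq[OF 3 exec_Seq[OF 4 exec_Seq[OF 5(1)
          exec_Seq[OF 6(1) exec_Seq[OF 7 8]]]]]]]
      show thesis
        by (rule that[OF all[folded c_def]]) (use 5(2) 6(2) n_le in \<open>simp add: B_def\<close>)
    qed
    define P where "P = poly p (sum_list (map length ws))"
    have "t \<le> P" using t(2) p[of ws] s[OF ws] by (simp add: P_def)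
    have init: "init_config T ws = (0, map \<sigma>0 [0..<ntapes T])"
      by (simp add: init_config_def \<sigma>0_def)
    have "(step T ^^ t) (init_config T ws) = (nstates T, map \<sigma>5 [0..<ntapes T])"
      using T(3)[OF t(1)] init by simp
    \<comment> \<open>The definition asks for the configuration after exactly \<open>P\<close>
      steps; a halted machine stays as it is.\<close>
    moreover have "(step T ^^ (P - t)) (nstates T, map \<sigma>5 [0..<ntapes T]) = (nstates T, map \<sigma>5 [0..<ntapes T])"
      by (rule funpow_fixpoint) simp
    ultimately have "(step T ^^ (t + (P - t))) (init_config T ws) = (nstates T, map \<sigma>5 [0..<ntapes T])"
      by (rule funpow_append)
    then have "(step T ^^ P) (init_config T ws) = (nstates T, map \<sigma>5 [0..<ntapes T])"
      using \<open>t \<le> P\<close> by simp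
    moreover have "output_word (nstates T, map \<sigma>5 [0..<ntapes T]) (f ws)"
      using T(2) r \<sigma>4 by (simp add: output_word_def \<sigma>5_def)
    ultimately show ?thesis by (simp add: computes_within_def P_def)
  qed
  with T show ?thesis unfolding poly_time_computable_def by blast
qed


section \<open>Bounded arithmetic in polynomial time\<close>

text \<open>With unary output every such value is polynomially bounded, so terms can be nested
  without separate size bounds.\<close>

definition ptn :: "('e \<Rightarrow> bool list) list \<Rightarrow> ('e \<Rightarrow> nat) \<Rightarrow> bool" where
  "ptn vs f \<longleftrightarrow> pt vs (\<lambda>e. replicate (f e) True)"

definition ptb :: "('e \<Rightarrow> bool list) list \<Rightarrow> ('e \<Rightarrow> bool) \<Rightarrow> bool" where
  "ptb vs P \<longleftrightarrow> pt vs (\<lambda>e. [P e])"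

lemma ptn_cong: "ptn vs f \<Longrightarrow> (\<And>e. f e = g e) \<Longrightarrow> ptn vs g"
  using ext[of f g] by simp

lemma ptb_cong: "ptb vs f \<Longrightarrow> (\<And>e. f e = g e) \<Longrightarrow> ptb vs g"
  using ext[of f g] by simp

lemma ptn_pbd: "ptn vs f \<Longrightarrow> pbd (size_of vs) f"
  using pt_length[of vs "\<lambda>e. replicate (f e) True"] by (simp add: ptn_def)

lemma pt_if: "ptb vs P \<Longrightarrow> pt vs f \<Longrightarrow> pt vs g \<Longrightarrow> pt vs (\<lambda>e. if P e then f e else g e)"
  using pt_if_hd[of vs "\<lambda>e. [P e]" f g] by (simp add: ptb_def)

section \<open>Connectives, arithmetic and bounded quantifiers\<close>

lemma ptb_const: "ptb vs (\<lambda>e. c)"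
  unfolding ptb_def by (rule pt_const)

lemma ptb_not: "ptb vs P \<Longrightarrow> ptb vs (\<lambda>e. \<not> P e)"
  using pt_if[OF _ pt_const pt_const, of vs P "[False]" "[True]"]
  unfolding ptb_def by (rule pt_cong) auto

lemma ptb_conj: "ptb vs P \<Longrightarrow> ptb vs Q \<Longrightarrow> ptb vs (\<lambda>e. P e \<and> Q e)"
  using pt_if[OF _ _ pt_const, of vs P "\<lambda>e. [Q e]" "[False]"]
  unfolding ptb_def by (rule pt_cong) auto

lemma ptb_disj: "ptb vs P \<Longrightarrow> ptb vs Q \<Longrightarrow> ptb vs (\<lambda>e. P e \<or> Q e)"
  using pt_if[OF _ pt_const, of vs P "\<lambda>e. [Q e]" "[True]"]
  unfolding ptb_def by (rule pt_cong) auto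

lemma ptb_imp: "ptb vs P \<Longrightarrow> ptb vs Q \<Longrightarrow> ptb vs (\<lambda>e. P e \<longrightarrow> Q e)"
  using ptb_disj[OF ptb_not, of vs P Q] by (rule ptb_cong) auto

lemma ptb_iff: "ptb vs P \<Longrightarrow> ptb vs Q \<Longrightarrow> ptb vs (\<lambda>e. P e = Q e)"
  using ptb_disj[OF ptb_conj ptb_conj[OF ptb_not ptb_not], of vs P Q P Q] by (rule ptb_cong) auto

lemma ptb_hd: "pt vs f \<Longrightarrow> ptb vs (\<lambda>e. f e \<noteq> [] \<and> hd (f e))"
  using pt_if_hd[OF _ pt_const pt_const, of vs f "[True]" "[False]"]
  unfolding ptb_def by (rule pt_cong) auto

lemma ptb_pos: "ptn vs f \<Longrightarrow> ptb vs (\<lambda>e. 0 < f e)"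
  using ptb_hd[of vs "\<lambda>e. replicate (f e) True"] unfolding ptn_def by (rule ptb_cong) auto

lemma ptn_const: "ptn vs (\<lambda>e. c)"
  unfolding ptn_def by (rule pt_const)

lemma ptn_add: "ptn vs f \<Longrightarrow> ptn vs g \<Longrightarrow> ptn vs (\<lambda>e. f e + g e)"
  unfolding ptn_def replicate_add by (rule pt_append)

lemma ptn_Suc: "ptn vs f \<Longrightarrow> ptn vs (\<lambda>e. Suc (f e))"
  using ptn_add[OF ptn_const[of vs 1], of f] by simp

lemma ptn_if: "ptb vs P \<Longrightarrow> ptn vs f \<Longrightarrow> ptn vs g \<Longrightarrow> ptn vs (\<lambda>e. if P e then f e else g e)"
  using pt_if[of vs P "\<lambda>e. replicate (f e) True" "\<lambda>e. replicate (g e) True"]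
  unfolding ptn_def by (auto intro: pt_cong)

lemma ptn_snd: "ptn (ext_nat vs) (\<lambda>p. snd p)"
  unfolding ptn_def by (rule pt_var) (simp add: ext_nat_def)

lemma pt_weaken_nat: "pt vs f \<Longrightarrow> pt (ext_nat vs) (\<lambda>p. f (fst p))"
  unfolding ext_nat_def by (rule pt_weaken)

lemma pt_weaken_word: "pt vs f \<Longrightarrow> pt (ext_word vs) (\<lambda>p. f (fst p))"
  unfolding ext_word_def by (rule pt_weaken)

lemma ptn_weaken_nat: "ptn vs f \<Longrightarrow> ptn (ext_nat vs) (\<lambda>p. f (fst p))"
  unfolding ptn_def by (rule pt_weaken_nat)

lemma pt_acc: "pt (ext_word vs) (\<lambda>p. snd p)"
  by (rule pt_var) (simp add: ext_word_def)

lemma ptn_length: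
  assumes "pt vs f"
  shows "ptn vs (\<lambda>e. length (f e))"
proof -
  have R: "rec_nat [] (\<lambda>i a. a @ [True]) i = replicate i True" for i
    by (induction i) (auto simp: replicate_append_same)
  have "pt vs (\<lambda>e. rec_nat [] (\<lambda>i a. snd ((e, i), a) @ [True]) (length (f e)))"
  proof (rule pt_rec[where B = "\<lambda>e. length (f e)"])
    show "pt (ext_word (ext_nat vs)) (\<lambda>p. snd p @ [True])"
      by (intro pt_append pt_acc pt_const)
  qed (simp_all add: R assms pt_const pt_length[OF assms])
  then have "pt vs (\<lambda>e. rec_nat [] (\<lambda>i a. a @ [True]) (length (f e)))" by simp
  then show ?thesis unfolding R ptn_def .
qed

lemma pt_drop:
  assumes "ptn vs n" "pt vs f"
  shows "pt vs (\<lambda>e. drop (n e) (f e))"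
proof -
  have R: "rec_nat w (\<lambda>i a. tl a) i = drop i w" for i and w :: "bool list"
    by (induction i) (auto simp: drop_Suc tl_drop)
  have "pt vs (\<lambda>e. rec_nat (f e) (\<lambda>i a. tl (snd ((e, i), a))) (length (replicate (n e) True)))"
  proof (rule pt_rec[where B = "\<lambda>e. length (f e)"])
    show "pt (ext_word (ext_nat vs)) (\<lambda>p. tl (snd p))"
      by (intro pt_tl pt_acc)
    show "pt vs (\<lambda>e. replicate (n e) True)" using assms(1) by (simp add: ptn_def)
  qed (simp_all add: R assms pt_length[OF assms(2)])
  then show ?thesis by (simp add: R)
qed

text \<open>This is the general loop: bit tables, products, counting and codes are all
  concatenations of one word per index.\<close>

lemma pt_concat:
  assumes "ptn vs n" "pt (ext_nat vs) (\<lambda>p. g (fst p) (snd p))"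
  shows "pt vs (\<lambda>e. concat (map (\<lambda>i. g e i) [0..<n e]))"
proof -
  have R: "rec_nat [] (\<lambda>i a. a @ g e i) i = concat (map (g e) [0..<i])" for i e
    by (induction i) auto
  obtain q where q: "length (g e i) \<le> poly q (i + size_of vs e)" for e i
    using pt_length[OF assms(2)] by (force simp: pbd_def ext_nat_def size_of_def comp_def)
  have bound: "length (concat (map (g e) [0..<i])) \<le> n e * poly q (n e + size_of vs e)" if "i \<le> n e" for i e
  proof -
    have "length (concat (map (g e) [0..<i])) \<le> (\<Sum>j\<leftarrow>[0..<i]. poly q (n e + size_of vs e))"
      unfolding length_concat map_map
    proof (rule sum_list_mono)
      fix j assume "j \<in> set [0..<i]"
      then have "j + size_of vs e \<le> n e + size_of vs e" using that by simp
      then show "(length \<circ> g e) j \<le> poly q (n e + size_of vs e)"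
        using order_trans[OF q[of e j] poly_mono_nat] by simp
    qed
    also have "\<dots> \<le> n e * poly q (n e + size_of vs e)" using that by (simp add: sum_list_triv)
    finally show ?thesis .
  qed
  have "pt vs (\<lambda>e. rec_nat [] (\<lambda>i a. snd ((e, i), a) @ g (fst (fst ((e, i), a))) (snd (fst ((e, i), a))))
      (length (replicate (n e) True)))"
  proof (rule pt_rec[where B = "\<lambda>e. n e * poly q (n e + size_of vs e)"])
    show "pt vs (\<lambda>e. replicate (n e) True)" using assms(1) by (simp add: ptn_def)
    show "pbd (size_of vs) (\<lambda>e. n e * poly q (n e + size_of vs e))"
      by (intro pbd_intros ptn_pbd assms(1))
    show "pt (ext_word (ext_nat vs)) (\<lambda>p. snd p @ g (fst (fst p)) (snd (fst p)))"
      by (intro pt_append pt_acc pt_weaken_word[OF assms(2)])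
  qed (use bound R in \<open>auto intro: pt_const\<close>)
  then show ?thesis by (simp add: R)
qed

lemma pt_map_bits:
  assumes "ptn vs n" "ptb (ext_nat vs) (\<lambda>p. P (fst p) (snd p))"
  shows "pt vs (\<lambda>e. map (\<lambda>i. P e i) [0..<n e])"
proof -
  have "pt vs (\<lambda>e. concat (map (\<lambda>i. [P e i]) [0..<n e]))"
    using assms(2) unfolding ptb_def by (rule pt_concat[OF assms(1)])
  moreover have "concat (map (\<lambda>i. [P e i]) xs) = map (P e) xs" for e xs
    by (induction xs) auto
  ultimately show ?thesis by simp
qed

text \<open>Truncated subtraction is dropping a prefix of a unary word.\<close>

lemma ptn_diff: "ptn vs f \<Longrightarrow> ptn vs g \<Longrightarrow> ptn vs (\<lambda>e. f e - g e)"
  using ptn_length[OF pt_drop, of vs g "\<lambda>e. replicate (f e) True"] by (simp add: ptn_def)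

lemma ptb_less: "ptn vs f \<Longrightarrow> ptn vs g \<Longrightarrow> ptb vs (\<lambda>e. f e < g e)"
  using ptb_pos[OF ptn_diff, of vs g f] by simp

lemma ptb_le: "ptn vs f \<Longrightarrow> ptn vs g \<Longrightarrow> ptb vs (\<lambda>e. f e \<le> g e)"
  using ptb_not[OF ptb_less, of vs g f] by (simp add: not_less)

lemma ptb_eq: "ptn vs f \<Longrightarrow> ptn vs g \<Longrightarrow> ptb vs (\<lambda>e. f e = g e)"
  using ptb_conj[OF ptb_le ptb_le, of vs f g g f] by (simp add: eq_iff)

lemma ptn_mult:
  assumes "ptn vs f" "ptn vs g"
  shows "ptn vs (\<lambda>e. f e * g e)"
proof -
  have "concat (map (\<lambda>i. replicate m True) [0..<n]) = replicate (n * m) True" for m n :: nat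
    by (induction n) (auto simp: replicate_add[symmetric] add.commute)
  moreover have "pt vs (\<lambda>e. concat (map (\<lambda>i. replicate (g e) True) [0..<f e]))"
    using assms(2) unfolding ptn_def by (intro pt_concat assms(1) pt_weaken_nat)
  ultimately show ?thesis by (simp add: ptn_def)
qed

text \<open>Bounded quantifiers and division are read off such a count.\<close>

lemma ptn_count:
  assumes "ptn vs n" "ptb (ext_nat vs) (\<lambda>p. P (fst p) (snd p))"
  shows "ptn vs (\<lambda>e. card {i. i < n e \<and> P e i})"
proof -
  have "concat (map (\<lambda>i. if Q i then [True] else []) [0..<n]) = replicate (card {i. i < n \<and> Q i}) True" for Q n
  proof (induction n)
    case (Suc n)
    have "{i. i < Suc n \<and> Q i} = (if Q n then insert n {i. i < n \<and> Q i} else {i. i < n \<and> Q i})"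
      by (auto simp: less_Suc_eq)
    then show ?case using Suc by (simp add: replicate_append_same)
  qed simp
  moreover have "pt vs (\<lambda>e. concat (map (\<lambda>i. if P e i then [True] else []) [0..<n e]))"
    by (intro pt_concat assms(1) pt_if[OF assms(2)] pt_const)
  ultimately show ?thesis by (simp add: ptn_def)
qed

lemma ptb_ex:
  assumes "ptn vs n" "ptb (ext_nat vs) (\<lambda>p. P (fst p) (snd p))"
  shows "ptb vs (\<lambda>e. \<exists>i<n e. P e i)"
  using ptb_pos[OF ptn_count[OF assms]] by (rule ptb_cong) (auto simp: card_gt_0_iff)

lemma ptb_all:
  assumes "ptn vs n" "ptb (ext_nat vs) (\<lambda>p. P (fst p) (snd p))"
  shows "ptb vs (\<lambda>e. \<forall>i<n e. P e i)"
  using ptb_not[OF ptb_ex[OF assms(1) ptb_not[OF assms(2)]]] by (rule ptb_cong) auto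

lemma ptn_div:
  assumes "ptn vs f" "ptn vs g"
  shows "ptn vs (\<lambda>e. f e div g e)"
proof -
  \<comment> \<open>The quotient is the number of positive multiples of \<open>g e\<close> up to
    \<open>f e\<close>; the guard \<open>0 < g e\<close> yields the value 0 of a division by
    0.\<close>
  have "ptn vs (\<lambda>e. card {i. i < f e \<and> 0 < g e \<and> Suc i * g e \<le> f e})"
    by (intro ptn_count assms ptb_conj ptb_less ptb_le ptn_mult ptn_const ptn_Suc ptn_snd ptn_weaken_nat)
  moreover have "{i. i < m \<and> 0 < d \<and> Suc i * d \<le> m} = {..<m div d}" for m d :: nat
  proof (cases "d = 0")
    case False
    then have "Suc i * d \<le> m \<longleftrightarrow> i < m div d" for i
      by (simp only: less_eq_div_iff_mult_less_eq[symmetric] Suc_le_eq)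
    then show ?thesis using False by (auto intro: less_le_trans)
  qed simp
  ultimately show ?thesis by simp
qed

lemma ptn_mod: "ptn vs f \<Longrightarrow> ptn vs g \<Longrightarrow> ptn vs (\<lambda>e. f e mod g e)"
  using ptn_diff[OF _ ptn_mult[OF ptn_div]] by (metis (no_types, lifting) minus_div_mult_eq_mod ptn_cong)

text \<open>An access out of range has no known value, whereas the program yields
  \<open>False\<close>; hence the guard, which recurs in \<open>tab\<close> and
  \<open>initial\<close>.\<close>

lemma ptb_nth:
  assumes "pt vs f" "ptn vs i"
  shows "ptb vs (\<lambda>e. i e < length (f e) \<and> f e ! i e)"
  using ptb_hd[OF pt_drop[OF assms(2,1)]] by (rule ptb_cong) (auto simp: hd_drop_conv_nth)

lemma ptn_poly:
  assumes "ptn vs f"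
  shows "ptn vs (\<lambda>e. poly p (f e))"
proof (induction p)
  case (pCons a p)
  then show ?case using assms by (simp add: ptn_add ptn_const ptn_mult)
qed (simp add: ptn_const)

lemma ptb_fixed: 
  assumes "\<And>a b. a < (D::nat) \<Longrightarrow> b < D \<Longrightarrow> ptb vs (\<lambda>e. Q a b e)"
  shows "ptb vs (\<lambda>e. \<exists>a<D. \<exists>b<D. Q a b e)"
proof -
  have 1: "ptb vs (\<lambda>e. \<exists>b<m. R b e)" if "\<And>b. b < m \<Longrightarrow> ptb vs (\<lambda>e. R b e)" for m :: nat and R
    using that by (induction m) (auto simp: less_Suc_eq ptb_const ex_disj_distrib conj_disj_distribR intro!: ptb_disj)
  show ?thesis by (intro 1 assms)
qed

text \<open>Arbitrary finite tables are available because they can be stored in the finite control.\<close>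

lemma ptb_table2:
  assumes "ptn vs a" "ptn vs b" "D > 0"
  shows "ptb vs (\<lambda>e. P (a e mod D) (b e mod D))"
proof -
  have "ptb vs (\<lambda>e. \<exists>i<D. \<exists>j<D. P i j \<and> a e mod D = i \<and> b e mod D = j)"
    by (intro ptb_fixed ptb_conj ptb_const ptb_eq ptn_mod ptn_const assms)
  then show ?thesis by (rule ptb_cong) (use assms in auto)
qed

lemma ptb_table:
  assumes "ptn vs a" "D > 0"
  shows "ptb vs (\<lambda>e. P (a e mod D))"
  using ptb_table2[OF assms(1,1,2), of "\<lambda>i j. P i"] .

text \<open>The power itself may be exponentially large and has no short unary form; repeated
  halving avoids it.\<close>

lemma ptn_div_pow2:
  assumes "ptn vs f" "ptn vs g"
  shows "ptn vs (\<lambda>e. f e div 2 ^ g e)"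
proof -
  have R: "rec_nat (replicate m True) (\<lambda>i a. replicate (length a div 2) True) i = replicate (m div 2 ^ i) True" for i m
    by (induction i) (auto simp: div_mult2_eq[symmetric] mult.commute)
  have "pt vs (\<lambda>e. rec_nat (replicate (f e) True) (\<lambda>i a. replicate (length (snd ((e, i), a)) div 2) True)
      (length (replicate (g e) True)))"
  proof (rule pt_rec[where B = f])
    have "ptn (ext_word (ext_nat vs)) (\<lambda>p. length (snd p) div 2)"
      by (intro ptn_div ptn_length pt_acc ptn_const)
    then show "pt (ext_word (ext_nat vs)) (\<lambda>p. replicate (length (snd p) div 2) True)" by (simp add: ptn_def)
  qed (use assms in \<open>auto simp: ptn_def R ptn_pbd\<close>)
  then show ?thesis by (simp add: R ptn_def)
qed

text \<open>A number has at most as many digits as its value, and positions beyond the leading digit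
  contribute nothing.\<close>

lemma binary_concat:
  "n \<le> m \<Longrightarrow> binary n = concat (map (\<lambda>i. if 0 < n div 2 ^ i then [odd (n div 2 ^ i)] else []) [0..<m])"
proof (induction m arbitrary: n)
  case 0
  then show ?case by (simp add: binary_0)
next
  case (Suc m)
  show ?case
  proof (cases "n = 0")
    case True
    then show ?thesis by (simp add: binary_0)
  next
    case False
    then have "n div 2 \<le> m" using Suc.prems by linarith
    have pow: "n div 2 ^ Suc i = n div 2 div 2 ^ i" for i
      by (simp add: div_mult2_eq)
    have "[0..<Suc m] = 0 # map Suc [0..<m]"
      by (simp add: map_Suc_upt upt_conv_Cons del: upt_Suc)
    then have "concat (map (\<lambda>i. if 0 < n div 2 ^ i then [odd (n div 2 ^ i)] else []) [0..<Suc m]) =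
        odd n # binary (n div 2)"
      using False by (simp only: Suc.IH[OF \<open>n div 2 \<le> m\<close>] list.map map_map comp_def pow) simp
    then show ?thesis using False binary_pos by simp
  qed
qed

lemma ptb_odd: "ptn vs f \<Longrightarrow> ptb vs (\<lambda>e. odd (f e))"
  using ptb_eq[OF ptn_mod[OF _ ptn_const[of _ 2]] ptn_const[of _ 1]] by (simp add: odd_iff_mod_2_eq_one)

lemma pt_binary:
  assumes "ptn vs f"
  shows "pt vs (\<lambda>e. binary (f e))"
proof -
  have "pt vs (\<lambda>e. concat (map (\<lambda>i. if 0 < f e div 2 ^ i then [odd (f e div 2 ^ i)] else []) [0..<f e]))"
    by (intro pt_concat pt_if pt_const ptb_less ptn_const ptn_div_pow2 assms ptn_weaken_nat ptn_snd
        ptb_odd[unfolded ptb_def])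
  then show ?thesis by (rule pt_cong) (simp add: binary_concat[OF order_refl])
qed

lemma pt_delimit:
  assumes "pt vs f"
  shows "pt vs (\<lambda>e. delimit (f e))"
proof -
  have *: "delimit w = concat (map (\<lambda>i. [True] @ [i < length w \<and> w ! i]) [0..<length w]) @ [False]" for w
  proof (induction w)
    case (Cons b w)
    have "[0..<length (b # w)] = 0 # map Suc [0..<length w]"
      by (simp add: map_Suc_upt upt_conv_Cons del: upt_Suc)
    with Cons show ?case by (simp add: comp_def del: upt_Suc)
  qed simp
  have "ptb (ext_nat vs) (\<lambda>p. snd p < length (f (fst p)) \<and> f (fst p) ! snd p)"
    by (intro ptb_nth pt_weaken_nat assms ptn_snd)
  then show ?thesis
    unfolding * ptb_def by (intro pt_append pt_concat ptn_length assms pt_const)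
qed

lemma ptb_eq_word:
  assumes "pt vs f" "pt vs g"
  shows "ptb vs (\<lambda>e. f e = g e)"
proof -
  have "ptb vs (\<lambda>e. length (f e) = length (g e) \<and>
      (\<forall>i<length (f e). (i < length (f e) \<and> f e ! i) = (i < length (g e) \<and> g e ! i)))"
    by (intro ptb_conj ptb_eq ptn_length assms ptb_all ptb_iff ptb_nth pt_weaken_nat ptn_snd)
  then show ?thesis by (rule ptb_cong) (auto simp: list_eq_iff_nth_eq)
qed


section \<open>Consecutive ones and orderings\<close>

text \<open>Keys refer to the original row and column numbers, so they survive the deletion of rows
  without renumbering.\<close>

definition order_convex :: "(nat \<Rightarrow> nat) \<Rightarrow> nat set \<Rightarrow> (nat \<Rightarrow> bool) \<Rightarrow> bool" where
  "order_convex f A P \<longleftrightarrow> (\<forall>a\<in>A. \<forall>b\<in>A. \<forall>c\<in>A. P a \<and> P c \<and> f a \<le> f b \<and> f b \<le> f c \<longrightarrow> P b)"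

text \<open>The key \<open>f\<close> need not be injective: ties are broken arbitrarily.\<close>

lemma permutation_of_order:
  fixes f :: "nat \<Rightarrow> nat"
  assumes "\<And>i. i \<in> I \<Longrightarrow> order_convex f {..<n} (P i)"
  shows "\<exists>\<pi>. \<pi> permutes {..<n} \<and> (\<forall>i\<in>I. consecutive {j. j < n \<and> P i (\<pi> j)})"
proof -
  define xs where "xs = sort_key f [0..<n]"
  have xs: "length xs = n" "distinct xs" "set xs = {..<n}" by (auto simp: xs_def)
  define \<pi> where "\<pi> j = (if j < n then xs ! j else j)" for j
  have "bij_betw ((!) xs) {..<n} {..<n}"
    by (rule bij_betw_nth[OF xs(2)]) (simp_all only: xs)
  then have "bij_betw \<pi> {..<n} {..<n}"
    by (rule bij_betw_cong[THEN iffD1, rotated]) (simp add: \<pi>_def)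
  then have permutes: "\<pi> permutes {..<n}" by (intro bij_imp_permutes) (auto simp: \<pi>_def)
  have mono: "f (\<pi> a) \<le> f (\<pi> b)" if "a \<le> b" "b < n" for a b
    using sorted_nth_mono[of "map f xs" a b] that xs by (simp add: \<pi>_def) (simp add: xs_def)
  have less: "\<pi> a < n" if "a < n" for a
    using permutes_in_image[OF permutes, of a] that by simp
  show ?thesis
  proof (intro exI conjI ballI)
    show "\<pi> permutes {..<n}" by (rule permutes)
    fix i assume "i \<in> I"
    show "consecutive {j. j < n \<and> P i (\<pi> j)}"
      unfolding consecutive_def
    proof (intro ballI allI impI)
      fix a c b assume "a \<in> {j. j < n \<and> P i (\<pi> j)}" "c \<in> {j. j < n \<and> P i (\<pi> j)}" "a \<le> b \<and> b \<le> c"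
      then show "b \<in> {j. j < n \<and> P i (\<pi> j)}"
        using assms[OF \<open>i \<in> I\<close>, unfolded order_convex_def, rule_format, of "\<pi> a" "\<pi> b" "\<pi> c"]
          mono[of a b] mono[of b c] less[of a] less[of b] less[of c]
        by auto
    qed
  qed
qed

text \<open>The inverse permutation is the key. Keys have to stay below \<open>n\<close> in order to
  fit into a certificate.\<close>

lemma order_of_permutation:
  assumes "\<pi> permutes {..<n}" "\<And>i. i \<in> I \<Longrightarrow> consecutive {j. j < n \<and> P i (\<pi> j)}"
  shows "\<exists>f::nat \<Rightarrow> nat. (\<forall>j<n. f j < n) \<and> (\<forall>i\<in>I. order_convex f {..<n} (P i))"
proof (intro exI conjI)
  have inv: "\<pi> (inv_into UNIV \<pi> a) = a" for a using permutes_inverses[OF assms(1)] by simp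
  have less: "inv_into UNIV \<pi> a < n" if "a < n" for a
    using permutes_in_image[OF permutes_inv[OF assms(1)], of a] that by simp
  show "\<forall>j<n. inv_into UNIV \<pi> j < n" using less by blast
  show "\<forall>i\<in>I. order_convex (inv_into UNIV \<pi>) {..<n} (P i)"
    unfolding order_convex_def
  proof (intro ballI impI)
    fix i a b c assume "i \<in> I" "a \<in> {..<n}" "b \<in> {..<n}" "c \<in> {..<n}"
      "P i a \<and> P i c \<and> inv_into UNIV \<pi> a \<le> inv_into UNIV \<pi> b \<and> inv_into UNIV \<pi> b \<le> inv_into UNIV \<pi> c"
    then show "P i b"
      using assms(2)[of i, unfolded consecutive_def, rule_format,
          of "inv_into UNIV \<pi> a" "inv_into UNIV \<pi> c" "inv_into UNIV \<pi> b"] less[of a] less[of b] less[of c]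
      by (simp add: inv)
  qed
qed

lemma dim_delete_rows:
  "R \<subseteq> {..<dim_row M} \<Longrightarrow> dim_row (delete_rows M R) = card ({..<dim_row M} - R)"
  "dim_col (delete_rows M R) = dim_col M"
proof -
  have "{i. i < dim_row M \<and> i \<in> {..<dim_row M} - R} = {..<dim_row M} - R" by auto
  then show "dim_row (delete_rows M R) = card ({..<dim_row M} - R)"
    by (simp add: delete_rows_def dim_submatrix)
qed (simp add: delete_rows_def dim_submatrix)

lemma delete_rows_index:
  assumes "i < card ({..<dim_row M} - R)" "j < dim_col M"
  shows "delete_rows M R $$ (i, j) = M $$ (pick ({..<dim_row M} - R) i, j)"
proof -
  have "{i. i < dim_row M \<and> i \<in> {..<dim_row M} - R} = {..<dim_row M} - R" by auto
  then show ?thesis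
    using assms by (simp add: delete_rows_def submatrix_index pick_UNIV)
qed

lemma SC1P_delete_rowsI:
  fixes f g :: "nat \<Rightarrow> nat"
  assumes R: "R \<subseteq> {..<dim_row M}"
    and rows: "\<And>i. i \<in> {..<dim_row M} - R \<Longrightarrow> order_convex f {..<dim_col M} (\<lambda>j. M $$ (i, j))"
    and cols: "\<And>j. j < dim_col M \<Longrightarrow> order_convex g ({..<dim_row M} - R) (\<lambda>i. M $$ (i, j))"
  shows "SC1P (delete_rows M R)"
proof -
  let ?I = "{..<dim_row M} - R"
  have pick: "pick ?I i \<in> ?I" if "i < card ?I" for i using pick_in_set_le[OF that] .
  have "\<exists>\<pi>. \<pi> permutes {..<dim_col M} \<and>
      (\<forall>i\<in>{..<card ?I}. consecutive {j. j < dim_col M \<and> M $$ (pick ?I i, \<pi> j)})"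
    by (intro permutation_of_order[of _ f] rows pick) auto
  then obtain \<pi> where \<pi>: "\<pi> permutes {..<dim_col M}"
    "\<And>i. i < card ?I \<Longrightarrow> consecutive {j. j < dim_col M \<and> M $$ (pick ?I i, \<pi> j)}" by auto
  have "{j. j < dim_col M \<and> delete_rows M R $$ (i, \<pi> j)} = {j. j < dim_col M \<and> M $$ (pick ?I i, \<pi> j)}"
    if "i < card ?I" for i
    using delete_rows_index[OF that] permutes_in_image[OF \<pi>(1)] by fastforce
  then have 1: "C1P_rows (delete_rows M R)"
    unfolding C1P_rows_def dim_delete_rows(1)[OF R] dim_delete_rows(2) using \<pi> by auto
  have "\<exists>\<pi>. \<pi> permutes {..<card ?I} \<and>
      (\<forall>j\<in>{..<dim_col M}. consecutive {i. i < card ?I \<and> M $$ (pick ?I (\<pi> i), j)})"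
  proof (rule permutation_of_order[where f = "\<lambda>i. g (pick ?I i)"])
    fix j assume "j \<in> {..<dim_col M}"
    then show "order_convex (\<lambda>i. g (pick ?I i)) {..<card ?I} (\<lambda>i. M $$ (pick ?I i, j))"
      using cols[of j] pick unfolding order_convex_def by (meson lessThan_iff)
  qed
  then obtain \<pi>' where \<pi>': "\<pi>' permutes {..<card ?I}"
    "\<And>j. j < dim_col M \<Longrightarrow> consecutive {i. i < card ?I \<and> M $$ (pick ?I (\<pi>' i), j)}" by auto
  have "{i. i < card ?I \<and> delete_rows M R $$ (\<pi>' i, j)} = {i. i < card ?I \<and> M $$ (pick ?I (\<pi>' i), j)}"
    if "j < dim_col M" for j
    using delete_rows_index[OF _ that, of _ R] permutes_in_image[OF \<pi>'(1)] by fastforce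
  then have 2: "C1P_cols (delete_rows M R)"
    unfolding C1P_cols_def dim_delete_rows(1)[OF R] dim_delete_rows(2) using \<pi>' by auto
  show ?thesis unfolding SC1P_def using 1 2 by blast
qed

lemma SC1P_delete_rowsD:
  assumes R: "R \<subseteq> {..<dim_row M}" and "SC1P (delete_rows M R)"
  obtains f g :: "nat \<Rightarrow> nat" where
    "\<And>j. j < dim_col M \<Longrightarrow> f j < dim_col M"
    "\<And>i. i \<in> {..<dim_row M} - R \<Longrightarrow> g i < dim_row M"
    "\<And>i. i \<in> {..<dim_row M} - R \<Longrightarrow> order_convex f {..<dim_col M} (\<lambda>j. M $$ (i, j))"
    "\<And>j. j < dim_col M \<Longrightarrow> order_convex g ({..<dim_row M} - R) (\<lambda>i. M $$ (i, j))"
proof -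
  let ?I = "{..<dim_row M} - R"
  \<comment> \<open>The rank among the surviving rows, inverse to \<open>pick\<close>.\<close>
  define idx where "idx i = card {a \<in> ?I. a < i}" for i
  have idx: "idx i < card ?I" "pick ?I (idx i) = i" if "i \<in> ?I" for i
    using that pick_card_in_set[OF that] unfolding idx_def by (auto intro!: psubset_card_mono)
  obtain \<pi> where \<pi>: "\<pi> permutes {..<dim_col M}"
    "\<And>i. i < card ?I \<Longrightarrow> consecutive {j. j < dim_col M \<and> delete_rows M R $$ (i, \<pi> j)}"
    using assms(2) unfolding SC1P_def C1P_rows_def dim_delete_rows(1)[OF R] dim_delete_rows(2) by auto
  obtain f where f: "\<And>j. j < dim_col M \<Longrightarrow> f j < dim_col M"
    "\<And>i. i < card ?I \<Longrightarrow> order_convex f {..<dim_col M} (\<lambda>j. delete_rows M R $$ (i, j))"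
    using order_of_permutation[OF \<pi>(1), of "{..<card ?I}" "\<lambda>i j. delete_rows M R $$ (i, j)"] \<pi>(2) by auto
  obtain \<pi>' where \<pi>': "\<pi>' permutes {..<card ?I}"
    "\<And>j. j < dim_col M \<Longrightarrow> consecutive {i. i < card ?I \<and> delete_rows M R $$ (\<pi>' i, j)}"
    using assms(2) unfolding SC1P_def C1P_cols_def dim_delete_rows(1)[OF R] dim_delete_rows(2) by auto
  obtain g where g: "\<And>i. i < card ?I \<Longrightarrow> g i < card ?I"
    "\<And>j. j < dim_col M \<Longrightarrow> order_convex g {..<card ?I} (\<lambda>i. delete_rows M R $$ (i, j))"
    using order_of_permutation[OF \<pi>'(1), of "{..<dim_col M}" "\<lambda>j i. delete_rows M R $$ (i, j)"] \<pi>'(2) by auto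
  have entry: "M $$ (i, j) = delete_rows M R $$ (idx i, j)" if "i \<in> ?I" "j < dim_col M" for i j
    using delete_rows_index[OF idx(1)[OF that(1)] that(2)] idx(2)[OF that(1)] by simp
  show thesis
  proof (rule that[of f "\<lambda>i. g (idx i)"])
    fix j assume "j < dim_col M"
    then show "f j < dim_col M" by (rule f(1))
    show "order_convex (\<lambda>i. g (idx i)) ?I (\<lambda>i. M $$ (i, j))"
      using g(2)[OF \<open>j < dim_col M\<close>] idx(1) entry[OF _ \<open>j < dim_col M\<close>]
      unfolding order_convex_def by (meson lessThan_iff)
  next
    fix i assume i: "i \<in> ?I"
    have "card ?I \<le> dim_row M" using card_mono[of "{..<dim_row M}" ?I] by simp
    then show "g (idx i) < dim_row M" using g(1)[OF idx(1)[OF i]] by simp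
    show "order_convex f {..<dim_col M} (\<lambda>j. M $$ (i, j))"
      using f(2)[OF idx(1)[OF i]] entry[OF i] unfolding order_convex_def by (meson lessThan_iff)
  qed
qed


section \<open>Membership in NP\<close>

fun binary_value :: "bool list \<Rightarrow> nat" where
  "binary_value [] = 0"
| "binary_value (b # w) = of_bool b + 2 * binary_value w"

lemma binary_value_binary: "binary_value (binary n) = n"
proof (induction n rule: less_induct)
  case (less n)
  then show ?case by (cases "n = 0") (auto simp: binary_0 binary_pos odd_iff_mod_2_eq_one)
qed

lemma last_binary: "n \<noteq> 0 \<Longrightarrow> binary n \<noteq> [] \<and> last (binary n)"
proof (induction n rule: less_induct)
  case (less n)
  show ?case
  proof (cases "n div 2 = 0")
    case True
    then have "n = 1" using less.prems by linarith
    then show ?thesis by (simp add: binary_0 binary_pos)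
  next
    case False
    then show ?thesis using less.IH[of "n div 2"] less.prems by (simp add: binary_pos)
  qed
qed

text \<open>The last bit is the most significant one; the hypothesis excludes leading zeros, the
  only ambiguity of the notation.\<close>

lemma binary_binary_value: "w = [] \<or> last w \<Longrightarrow> binary (binary_value w) = w"
proof (induction w)
  case (Cons b w)
  show ?case
  proof (cases "w = []")
    case True
    then show ?thesis using Cons.prems by (simp add: binary_pos binary_0)
  next
    case False
    then have IH: "binary (binary_value w) = w" using Cons by auto
    have "binary_value w \<noteq> 0" using IH False binary_0 by metis
    then show ?thesis using IH by (simp add: binary_pos)
  qed
qed (simp add: binary_0)

text \<open>
  A certificate is read as eight tables of \<open>S * S\<close> bits; a row of a table can also be read as a
  number below \<open>S\<close> in unary.
\<close>

definition tab :: "bool list \<Rightarrow> nat \<Rightarrow> nat \<Rightarrow> nat \<Rightarrow> nat \<Rightarrow> bool" where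
  "tab u S t i j \<longleftrightarrow> t + 8 * (i + S * j) < length u \<and> u ! (t + 8 * (i + S * j))"

definition tab_num :: "bool list \<Rightarrow> nat \<Rightarrow> nat \<Rightarrow> nat \<Rightarrow> nat" where
  "tab_num u S t i = card {j. j < S \<and> tab u S t i j}"

text \<open>The tables are interleaved: a position \<open>t + 8 * (i + S * j)\<close> gives back
  \<open>t\<close>, \<open>i\<close> and \<open>j\<close> by division with remainder.\<close>

lemma tab_exists:
  obtains u where "length u = 8 * S * S" "\<And>t i j. t < 8 \<Longrightarrow> i < S \<Longrightarrow> j < S \<Longrightarrow> tab u S t i j = \<Phi> t i j"
proof (rule that)
  let ?u = "map (\<lambda>z. \<Phi> (z mod 8) (z div 8 mod S) (z div 8 div S)) [0..<8 * S * S]"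
  show "length ?u = 8 * S * S" by simp
  fix t i j :: nat assume *: "t < 8" "i < S" "j < S"
  have "i + S * j < S * S"
  proof -
    have "i + S * j < S + S * j" using * by simp
    also have "\<dots> = S * Suc j" by simp
    also have "\<dots> \<le> S * S" using * by (intro mult_le_mono2) simp
    finally show ?thesis .
  qed
  moreover have "t + 8 * y < 8 * (S * S)" if "y < S * S" for y using that * by linarith
  ultimately have "t + 8 * (i + S * j) < 8 * S * S" by (simp only: mult.assoc)
  moreover define y where "y = i + S * j"
  moreover have "y mod S = i" "y div S = j" using * by (simp_all add: y_def)
  ultimately show "tab ?u S t i j = \<Phi> t i j" using * unfolding tab_def y_def[symmetric] by simp
qed

lemma tab_num_less:
  assumes "\<And>j. j < S \<Longrightarrow> tab u S t i j \<longleftrightarrow> j < n" "n \<le> S"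
  shows "tab_num u S t i = n"
proof -
  have "{j. j < S \<and> tab u S t i j} = {..<n}" using assms by auto
  then show ?thesis by (simp add: tab_num_def)
qed

text \<open>The input is not parsed: the certificate supplies the instance, which is encoded afresh
  and compared with \<open>x\<close>. The last condition excludes leading zeros in \<open>k\<close>,
  with which \<open>x\<close> would not be an encoding.\<close>

definition verify_encoding :: "bool list \<Rightarrow> bool list \<Rightarrow> nat \<Rightarrow> nat \<Rightarrow> nat \<Rightarrow> nat \<Rightarrow> bool" where
  "verify_encoding x u S l n m \<longleftrightarrow>
     x = delimit (map (\<lambda>i. tab u S 0 i 0) [0..<l]) @ delimit (map (\<lambda>i. True) [0..<n]) @
       concat (map (\<lambda>i. delimit (map (\<lambda>j. tab u S 1 i j) [0..<n])) [0..<m]) \<and>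
     (l = 0 \<or> tab u S 0 (l - 1) 0)"

text \<open>
  The numbers in table 4 are lower bounds for the values of the suffixes of the binary
  representation of \<open>k\<close>.
\<close>

definition verify_bound :: "bool list \<Rightarrow> nat \<Rightarrow> nat \<Rightarrow> nat \<Rightarrow> bool" where
  "verify_bound u S l m \<longleftrightarrow>
     card {i. i < m \<and> tab u S 2 i 0} \<le> tab_num u S 4 0 \<and> tab_num u S 4 l = 0 \<and>
     (\<forall>i<l. tab_num u S 4 i \<le> (if tab u S 0 i 0 then 1 else 0) + 2 * tab_num u S 4 (Suc i))"

definition verify_rows :: "bool list \<Rightarrow> nat \<Rightarrow> nat \<Rightarrow> nat \<Rightarrow> bool" where
  "verify_rows u S n m \<longleftrightarrow> (\<forall>i<m. \<not> tab u S 2 i 0 \<longrightarrow> (\<forall>a<n. \<forall>b<n. \<forall>c<n.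
     tab u S 1 i a \<and> tab u S 1 i c \<and> tab_num u S 3 a \<le> tab_num u S 3 b \<and>
     tab_num u S 3 b \<le> tab_num u S 3 c \<longrightarrow> tab u S 1 i b))"

definition verify_cols :: "bool list \<Rightarrow> nat \<Rightarrow> nat \<Rightarrow> nat \<Rightarrow> bool" where
  "verify_cols u S n m \<longleftrightarrow> (\<forall>j<n. \<forall>a<m. \<forall>b<m. \<forall>c<m.
     \<not> tab u S 2 a 0 \<and> \<not> tab u S 2 b 0 \<and> \<not> tab u S 2 c 0 \<and>
     tab u S 1 a j \<and> tab u S 1 c j \<and> tab_num u S 5 a \<le> tab_num u S 5 b \<and>
     tab_num u S 5 b \<le> tab_num u S 5 c \<longrightarrow> tab u S 1 b j)"

definition verify :: "bool list \<Rightarrow> bool list \<Rightarrow> bool" where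
  "verify x u \<longleftrightarrow> (\<exists>l<Suc (length x). \<exists>n<Suc (length x). \<exists>m<Suc (length x).
     verify_encoding x u (Suc (length x)) l n m \<and> verify_bound u (Suc (length x)) l m \<and>
     verify_rows u (Suc (length x)) n m \<and> verify_cols u (Suc (length x)) n m)"

section \<open>Correctness of the certificate check\<close>

lemma verify_sound:
  assumes "verify x u"
  shows "x \<in> encode ` SC1P_row_deletion"
proof -
  define S where "S = Suc (length x)"
  obtain l n m where enc: "verify_encoding x u S l n m" and bound: "verify_bound u S l m"
    and rows: "verify_rows u S n m" and cols: "verify_cols u S n m"
    using assms unfolding verify_def S_def by blast
  define w where "w = map (\<lambda>i. tab u S 0 i 0) [0..<l]"
  define k where "k = binary_value w"
  define M where "M = mat m n (\<lambda>(i, j). tab u S 1 i j)"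
  define R where "R = {i. i < m \<and> tab u S 2 i 0}"
  have dim: "dim_row M = m" "dim_col M = n" by (simp_all add: M_def)
  have "w = [] \<or> last w"
    using enc by (cases "l = 0") (auto simp: verify_encoding_def w_def last_conv_nth)
  then have "binary k = w" unfolding k_def by (rule binary_binary_value)
  moreover have "mat_to_list M = map (\<lambda>i. map (\<lambda>j. tab u S 1 i j) [0..<n]) [0..<m]"
    by (simp add: mat_to_list_def M_def)
  ultimately have "x = encode (M, k)"
    using enc by (simp add: encode_def verify_encoding_def w_def dim comp_def map_replicate_const)
  moreover have "(M, k) \<in> SC1P_row_deletion"
    unfolding SC1P_row_deletion_def
  proof (clarify, intro exI conjI)
    show R: "R \<subseteq> {..<dim_row M}" by (auto simp: R_def dim)
    \<comment> \<open>Induction from the most significant end of \<open>binary k\<close>: each entry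
      is at most the value of its suffix.\<close>
    have "tab_num u S 4 (l - i) \<le> binary_value (drop (l - i) w)" if "i \<le> l" for i
      using that
    proof (induction i)
      case 0
      then show ?case using bound by (simp add: verify_bound_def)
    next
      case (Suc i)
      then have "l - Suc i < l" "Suc (l - Suc i) = l - i" by auto
      moreover from this have "drop (l - Suc i) w = tab u S 0 (l - Suc i) 0 # drop (l - i) w"
        using Cons_nth_drop_Suc[of "l - Suc i" w] by (simp add: w_def)
      moreover have "tab_num u S 4 (l - Suc i) \<le>
          (if tab u S 0 (l - Suc i) 0 then 1 else 0) + 2 * tab_num u S 4 (Suc (l - Suc i))"
        using bound \<open>l - Suc i < l\<close> unfolding verify_bound_def by blast
      ultimately show ?case using Suc by (auto split: if_splits)
    qed
    from this[of l] show "card R \<le> k" using bound by (simp add: verify_bound_def k_def R_def)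
    show "SC1P (delete_rows M R)"
    proof (rule SC1P_delete_rowsI[OF R, of "tab_num u S 3" "tab_num u S 5"])
      fix i assume "i \<in> {..<dim_row M} - R"
      then have "i < m" "\<not> tab u S 2 i 0" by (auto simp: dim R_def)
      show "order_convex (tab_num u S 3) {..<dim_col M} (\<lambda>j. M $$ (i, j))"
        unfolding order_convex_def
      proof (intro ballI impI)
        fix a b c assume "a \<in> {..<dim_col M}" "b \<in> {..<dim_col M}" "c \<in> {..<dim_col M}"
          "M $$ (i, a) \<and> M $$ (i, c) \<and> tab_num u S 3 a \<le> tab_num u S 3 b \<and> tab_num u S 3 b \<le> tab_num u S 3 c"
        then show "M $$ (i, b)"
          using rows[unfolded verify_rows_def, rule_format, of i a b c] \<open>i < m\<close> \<open>\<not> tab u S 2 i 0\<close>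
          by (simp add: M_def)
      qed
    next
      fix j assume "j < dim_col M"
      show "order_convex (tab_num u S 5) ({..<dim_row M} - R) (\<lambda>i. M $$ (i, j))"
        unfolding order_convex_def
      proof (intro ballI impI)
        fix a b c assume "a \<in> {..<dim_row M} - R" "b \<in> {..<dim_row M} - R" "c \<in> {..<dim_row M} - R"
          "M $$ (a, j) \<and> M $$ (c, j) \<and> tab_num u S 5 a \<le> tab_num u S 5 b \<and> tab_num u S 5 b \<le> tab_num u S 5 c"
        then show "M $$ (b, j)"
          using cols[unfolded verify_cols_def, rule_format, of j a b c] \<open>j < dim_col M\<close>
          by (simp add: M_def R_def)
      qed
    qed
  qed
  ultimately show ?thesis by blast
qed

lemma length_delimit: "length (delimit w) = 2 * length w + 1"
  by (induction w) auto

lemma length_concat_ge: "(\<And>v. v \<in> set vs \<Longrightarrow> v \<noteq> []) \<Longrightarrow> length vs \<le> length (concat vs)"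
proof (induction vs)
  case (Cons v vs)
  then have "length vs \<le> length (concat vs)" "0 < length v" by auto
  then show ?case unfolding concat.simps length_append list.size by linarith
qed simp

lemma verify_complete:
  assumes "x \<in> encode ` SC1P_row_deletion"
  shows "\<exists>u. length u \<le> poly [:8, 16, 8:] (length x) \<and> verify x u"
proof -
  obtain M k R where x: "x = encode (M, k)" and R: "R \<subseteq> {..<dim_row M}" "card R \<le> k"
    and sc: "SC1P (delete_rows M R)"
    using assms unfolding SC1P_row_deletion_def by auto
  define S n m w where "S = Suc (length x)" and "n = dim_col M" and "m = dim_row M" and "w = binary k"
  define l where "l = length w"
  obtain f g where f: "\<And>j. j < n \<Longrightarrow> f j < n" and g: "\<And>i. i \<in> {..<m} - R \<Longrightarrow> g i < m"
    and rows: "\<And>i. i \<in> {..<m} - R \<Longrightarrow> order_convex f {..<n} (\<lambda>j. M $$ (i, j))"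
    and cols: "\<And>j. j < n \<Longrightarrow> order_convex g ({..<m} - R) (\<lambda>i. M $$ (i, j))"
    using SC1P_delete_rowsD[OF R(1) sc] unfolding n_def m_def by metis
  have x': "x = delimit w @ delimit (replicate n True) @ concat (map delimit (mat_to_list M))"
    by (simp add: x encode_def w_def n_def)
  \<comment> \<open>Every row has a nonempty code even if there are no columns, so \<open>m\<close>
    is bounded by the length of the input.\<close>
  have "delimit v \<noteq> []" for v using length_delimit[of v] by auto
  then have "m \<le> length (concat (map delimit (mat_to_list M)))"
    using length_concat_ge[of "map delimit (mat_to_list M)"] by (force simp: mat_to_list_def m_def)
  then have less: "l < S" "n < S" "m < S"
    unfolding S_def x' l_def by (simp_all add: length_delimit)
  \<comment> \<open>The suffix values may be exponentially large; capped at \<open>card R\<close>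
    they still satisfy the digit recursion and fit into a table row.\<close>
  define d where "d i = min (card R) (binary_value (drop i w))" for i
  have "card R \<le> m" using card_mono[OF _ R(1)] by (simp add: m_def)
  then have d_less: "d i < S" for i using less by (simp add: d_def)
  define \<Phi> where "\<Phi> t i j = (if t = 0 then w ! i else if t = 1 then M $$ (i, j) else if t = 2 then i \<in> R
    else if t = 3 then j < f i else if t = 4 then j < d i else j < g i)" for t i j :: nat
  obtain u where u: "length u = 8 * S * S"
    "\<And>t i j. t < 8 \<Longrightarrow> i < S \<Longrightarrow> j < S \<Longrightarrow> tab u S t i j = \<Phi> t i j"
    using tab_exists by blast
  have "0 < S" by (simp add: S_def)
  have t0: "tab u S 0 i 0 = w ! i" if "i < l" for i using u(2)[of 0 i 0] that less \<open>0 < S\<close> by (simp add: \<Phi>_def)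
  have t1: "tab u S 1 i j = M $$ (i, j)" if "i < m" "j < n" for i j using u(2)[of 1 i j] that less by (simp add: \<Phi>_def)
  have t2: "tab u S 2 i 0 \<longleftrightarrow> i \<in> R" if "i < m" for i using u(2)[of 2 i 0] that less \<open>0 < S\<close> by (simp add: \<Phi>_def)
  have t3: "tab_num u S 3 i = f i" if "i < n" for i
    using u(2)[of 3 i] that less f[OF that] by (intro tab_num_less) (simp_all add: \<Phi>_def)
  have t4: "tab_num u S 4 i = d i" if "i \<le> l" for i
    using u(2)[of 4 i] that less d_less[of i] by (intro tab_num_less) (simp_all add: \<Phi>_def)
  have t5: "tab_num u S 5 i = g i" if "i \<in> {..<m} - R" for i
    using u(2)[of 5 i] that less g[OF that] by (intro tab_num_less) (simp_all add: \<Phi>_def)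
  have "verify_encoding x u S l n m"
    unfolding verify_encoding_def
  proof
    have "map (\<lambda>i. tab u S 0 i 0) [0..<l] = w"
      by (rule nth_equalityI) (simp_all add: t0 l_def[symmetric])
    moreover have "map (\<lambda>i. delimit (map (\<lambda>j. tab u S 1 i j) [0..<n])) [0..<m] = map delimit (mat_to_list M)"
      by (auto simp: mat_to_list_def n_def[symmetric] m_def[symmetric] t1[unfolded One_nat_def] intro!: arg_cong[where f = delimit])
    ultimately show "x = delimit (map (\<lambda>i. tab u S 0 i 0) [0..<l]) @ delimit (map (\<lambda>i. True) [0..<n]) @
       concat (map (\<lambda>i. delimit (map (\<lambda>j. tab u S 1 i j) [0..<n])) [0..<m])"
      using x' by (simp add: map_replicate_const)
    show "l = 0 \<or> tab u S 0 (l - 1) 0"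
    proof (cases "k = 0")
      case True
      then show ?thesis by (simp add: l_def w_def binary_0)
    next
      case False
      then have "w \<noteq> []" "last w" using last_binary by (auto simp: w_def)
      then show ?thesis using t0[of "l - 1"] by (simp add: last_conv_nth l_def)
    qed
  qed
  moreover have "verify_bound u S l m"
    unfolding verify_bound_def
  proof (intro conjI allI impI)
    have "{i. i < m \<and> tab u S 2 i 0} = R" using t2 R(1) by (auto simp: m_def)
    then show "card {i. i < m \<and> tab u S 2 i 0} \<le> tab_num u S 4 0"
      using t4[of 0] R(2) by (simp add: d_def w_def binary_value_binary)
    show "tab_num u S 4 l = 0" using t4[of l] by (simp add: d_def l_def)
    fix i assume i: "i < l"
    then have "drop i w = w ! i # drop (Suc i) w" by (simp add: Cons_nth_drop_Suc l_def)
    then show "tab_num u S 4 i \<le> (if tab u S 0 i 0 then 1 else 0) + 2 * tab_num u S 4 (Suc i)"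
      using t4[of i] t4[of "Suc i"] t0[OF i] i by (auto simp: d_def)
  qed
  moreover have "verify_rows u S n m"
    unfolding verify_rows_def
  proof (intro allI impI)
    fix i a b c
    assume *: "i < m" "\<not> tab u S 2 i 0" "a < n" "b < n" "c < n"
      "tab u S 1 i a \<and> tab u S 1 i c \<and> tab_num u S 3 a \<le> tab_num u S 3 b \<and> tab_num u S 3 b \<le> tab_num u S 3 c"
    then show "tab u S 1 i b"
      using rows[of i, unfolded order_convex_def, rule_format, of a b c] t1[of i] t2[of i] t3 by simp
  qed
  moreover have "verify_cols u S n m"
    unfolding verify_cols_def
  proof (intro allI impI)
    fix j a b c
    assume *: "j < n" "a < m" "b < m" "c < m" "\<not> tab u S 2 a 0 \<and> \<not> tab u S 2 b 0 \<and> \<not> tab u S 2 c 0 \<and>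
      tab u S 1 a j \<and> tab u S 1 c j \<and> tab_num u S 5 a \<le> tab_num u S 5 b \<and> tab_num u S 5 b \<le> tab_num u S 5 c"
    then have "a \<in> {..<m} - R" "b \<in> {..<m} - R" "c \<in> {..<m} - R" using t2 by auto
    with * show "tab u S 1 b j"
      using cols[of j, unfolded order_convex_def, rule_format, of a b c] t1[of _ j] t5 by simp
  qed
  ultimately have "verify x u"
    using less unfolding verify_def S_def by blast
  \<comment> \<open>The polynomial is \<open>8 * (X + 1) ^ 2\<close>, the size of eight tables of
    side \<open>S\<close>.\<close>
  moreover have "length u \<le> poly [:8, 16, 8:] (length x)"
    by (simp add: u(1) S_def algebra_simps)
  ultimately show ?thesis by blast
qed

section \<open>Running time of the certificate check\<close>

lemma ptb_tab:
  assumes "pt vs u" "ptn vs S" "ptn vs i" "ptn vs j"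
  shows "ptb vs (\<lambda>e. tab (u e) (S e) t (i e) (j e))"
  unfolding tab_def by (intro ptb_nth ptn_add ptn_mult ptn_const assms)

lemma ptn_tab_num:
  assumes "pt vs u" "ptn vs S" "ptn vs i"
  shows "ptn vs (\<lambda>e. tab_num (u e) (S e) t (i e))"
  unfolding tab_num_def by (intro ptn_count ptb_tab pt_weaken_nat ptn_weaken_nat ptn_snd assms)

lemmas pt_intros =
  ptb_conj ptb_disj ptb_imp ptb_not ptb_all ptb_ex ptb_less ptb_le ptb_eq ptb_tab ptb_const
  ptn_tab_num ptn_count ptn_Suc ptn_add ptn_mult ptn_diff ptn_if ptn_const ptn_snd ptn_length
  pt_append pt_concat pt_delimit pt_map_bits ptb_eq_word
  ptn_weaken_nat pt_weaken_nat

lemma pt_verify: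
  "pt (map (\<lambda>i ws. ws ! i) [0..<2]) (\<lambda>ws. [verify (ws ! 0) (ws ! 1)])"
proof -
  let ?vs = "map (\<lambda>i ws. ws ! i) [0..<2] :: (bool list list \<Rightarrow> bool list) list"
  have x: "pt ?vs (\<lambda>ws. ws ! 0)" and u: "pt ?vs (\<lambda>ws. ws ! 1)"
    by (rule pt_var; simp add: numeral_2_eq_2)+
  have "ptb ?vs (\<lambda>ws. verify (ws ! 0) (ws ! 1))"
    unfolding verify_def verify_encoding_def verify_bound_def verify_rows_def verify_cols_def
    by (intro pt_intros x u)
  then show ?thesis by (simp add: ptb_def)
qed

theorem SC1P_row_deletion_in_NP: "encode ` SC1P_row_deletion \<in> NP"
proof -
  have "poly_time_computable 2 (\<lambda>ws. [verify (ws ! 0) (ws ! 1)])"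
    by (rule pt_poly_time_computable[OF _ pt_verify]) simp
  moreover have "x \<in> encode ` SC1P_row_deletion \<longleftrightarrow>
      (\<exists>u. length u \<le> poly [:8, 16, 8:] (length x) \<and> verify x u)" for x
    using verify_sound verify_complete by blast
  ultimately show ?thesis unfolding NP_def by blast
qed


section \<open>From binary constraint satisfaction to row deletion\<close>

text \<open>
  A binary constraint satisfaction problem has variables \<open>v < N\<close> with values \<open>a < D\<close>; the pair
  \<open>(v, a)\<close> is the vertex \<open>v * D + a\<close>, and \<open>bad\<close> lists the forbidden pairs of vertices. Pairs
  \<open>bad p p\<close> express unary constraints.
\<close>

definition csp_solvable :: "nat \<Rightarrow> nat \<Rightarrow> (nat \<Rightarrow> nat \<Rightarrow> bool) \<Rightarrow> bool" where
  "csp_solvable N D bad \<longleftrightarrow> (\<exists>\<alpha>. (\<forall>v<N. \<alpha> v < D) \<and>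
     (\<forall>v<N. \<forall>v'<N. \<not> bad (v * D + \<alpha> v) (v' * D + \<alpha> v')))"

text \<open>Distinct values of one variable conflict as well, so a conflict-free set of vertices
  assigns at most one value to each variable.\<close>

definition conflict :: "nat \<Rightarrow> (nat \<Rightarrow> nat \<Rightarrow> bool) \<Rightarrow> nat \<Rightarrow> nat \<Rightarrow> bool" where
  "conflict D bad p q \<longleftrightarrow> p div D = q div D \<and> p \<noteq> q \<or> bad p q"

text \<open>
  Every vertex has \<open>t\<close> twin rows, row \<open>r\<close> belonging to vertex \<open>r div t\<close>. There is one column for
  every pair of rows; it has its 1-entries in these two rows if their vertices are in conflict.
  Deleting as few rows as allowed forces four twins of some vertex of every variable to survive,
  and four twins of each of two conflicting vertices cannot be ordered consecutively.
\<close>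

definition csp_twins :: "nat \<Rightarrow> nat \<Rightarrow> nat" where
  "csp_twins N D = 3 * (N * D) + 1"

definition csp_rows :: "nat \<Rightarrow> nat \<Rightarrow> nat" where
  "csp_rows N D = N * D * csp_twins N D"

definition csp_entry :: "nat \<Rightarrow> nat \<Rightarrow> (nat \<Rightarrow> nat \<Rightarrow> bool) \<Rightarrow> nat \<Rightarrow> nat \<Rightarrow> bool" where
  "csp_entry N D bad r c \<longleftrightarrow> (r = c div csp_rows N D \<or> r = c mod csp_rows N D) \<and>
     conflict D bad (c div csp_rows N D div csp_twins N D) (c mod csp_rows N D div csp_twins N D)"

definition csp_matrix :: "nat \<Rightarrow> nat \<Rightarrow> (nat \<Rightarrow> nat \<Rightarrow> bool) \<Rightarrow> bool mat" where
  "csp_matrix N D bad = mat (csp_rows N D) (csp_rows N D * csp_rows N D)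
     (\<lambda>(r, c). csp_entry N D bad r c)"

text \<open>This leaves as many rows as \<open>N\<close> twin classes have, one class for each
  variable.\<close>

definition csp_deletions :: "nat \<Rightarrow> nat \<Rightarrow> nat" where
  "csp_deletions N D = csp_rows N D - N * csp_twins N D"

section \<open>Correctness of the reduction to row deletion\<close>

lemma div_eq_interval:
  fixes t :: nat
  assumes "t > 0"
  shows "{r. r div t = p} = {p * t..<p * t + t}"
proof (intro equalityI subsetI)
  fix r assume "r \<in> {r. r div t = p}"
  then have "r = p * t + r mod t" using div_mult_mod_eq[of r t] by simp
  moreover have "r mod t < t" using assms by simp
  ultimately have "p * t \<le> r" "r < p * t + t" by linarith+
  then show "r \<in> {p * t..<p * t + t}" by simp
next
  fix r assume "r \<in> {p * t..<p * t + t}"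
  then have "r = p * t + (r - p * t)" "r - p * t < t" by auto
  then have "r div t = p" using assms by (metis add.right_neutral div_less div_mult_self3 less_not_refl)
  then show "r \<in> {r. r div t = p}" by simp
qed

lemma card_block:
  assumes "t > (0::nat)"
  shows "card {r. r div t = p} = t" "finite {r. r div t = p}"
  by (simp_all add: div_eq_interval[OF assms])

lemma index_less:
  assumes "v < N" "a < (D :: nat)"
  shows "v * D + a < N * D"
proof -
  have "v * D + a < Suc v * D" using assms by simp
  also have "\<dots> \<le> N * D" using assms by (intro mult_le_mono1) simp
  finally show ?thesis .
qed

text \<open>Keep the twin classes of the chosen values. The 1-entries of a column belong to
  conflicting vertices, so no column meets two kept rows; any row order works, and the columns are
  sorted by the kept row that they meet.\<close>

lemma csp_solvable_imp_row_deletion: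
  assumes "csp_solvable N D bad"
  shows "(csp_matrix N D bad, csp_deletions N D) \<in> SC1P_row_deletion"
proof -
  obtain \<alpha> where \<alpha>: "\<And>v. v < N \<Longrightarrow> \<alpha> v < D"
    "\<And>v v'. v < N \<Longrightarrow> v' < N \<Longrightarrow> \<not> bad (v * D + \<alpha> v) (v' * D + \<alpha> v')"
    using assms unfolding csp_solvable_def by blast
  define t m M where "t = csp_twins N D" and "m = csp_rows N D" and "M = csp_matrix N D bad"
  have t: "t > 0" by (simp add: t_def csp_twins_def)
  have dim: "dim_row M = m" "dim_col M = m * m" by (simp_all add: M_def csp_matrix_def m_def)
  have var: "(v * D + \<alpha> v) div D = v" if "v < N" for v using \<alpha>(1)[OF that] by simp
  define P where "P = (\<lambda>v. v * D + \<alpha> v) ` {..<N}"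
  define K where "K = (\<Union>p\<in>P. {r. r div t = p})"
  have "inj_on (\<lambda>v. v * D + \<alpha> v) {..<N}"
    by (rule inj_on_inverseI[where g = "\<lambda>p. p div D"]) (simp add: var)
  then have "card P = N" by (simp add: P_def card_image)
  have "card K = (\<Sum>p\<in>P. card {r. r div t = p})"
    unfolding K_def by (rule card_UN_disjoint) (auto simp: P_def card_block[OF t])
  then have card_K: "card K = N * t" using \<open>card P = N\<close> by (simp add: card_block[OF t])
  have K_le: "r < m" if r: "r \<in> K" for r
  proof -
    obtain v where "v < N" "r div t = v * D + \<alpha> v" using r by (auto simp: K_def P_def)
    then have "r div t < N * D" using index_less \<alpha>(1) by simp
    then show "r < m" using t by (simp add: m_def csp_rows_def t_def div_less_iff_less_mult)
  qed
  have no_conflict: "\<not> conflict D bad (r div t) (s div t)" if rs: "r \<in> K" "s \<in> K" for r s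
  proof -
    obtain v w where vw: "v < N" "r div t = v * D + \<alpha> v" "w < N" "s div t = w * D + \<alpha> w"
      using rs by (auto simp: K_def P_def)
    then show ?thesis using \<alpha>(2)[of v w] var[of v] var[of w] by (auto simp: conflict_def)
  qed
  have entry: "M $$ (r, c) \<longleftrightarrow> (r = c div m \<or> r = c mod m) \<and> conflict D bad (c div m div t) (c mod m div t)"
    if "r < m" "c < m * m" for r c
    using that by (simp add: M_def csp_matrix_def csp_entry_def m_def t_def)
  have unique: "r = s" if rs: "r \<in> K" "s \<in> K" "c < m * m" "M $$ (r, c)" "M $$ (s, c)" for r s c
  proof (rule ccontr)
    assume "r \<noteq> s"
    then have "c div m \<in> K" "c mod m \<in> K" "conflict D bad (c div m div t) (c mod m div t)"
      using rs entry[OF K_le[OF rs(1)] rs(3)] entry[OF K_le[OF rs(2)] rs(3)] by auto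
    then show False using no_conflict by blast
  qed
  define R where "R = {..<m} - K"
  have R: "R \<subseteq> {..<dim_row M}" "{..<dim_row M} - R = K"
    using K_le by (auto simp: R_def dim)
  have "K \<subseteq> {..<m}" using K_le by auto
  then have "card R = csp_deletions N D"
    using card_K by (simp add: R_def card_Diff_subset finite_subset csp_deletions_def m_def t_def)
  moreover have "SC1P (delete_rows M R)"
  proof (rule SC1P_delete_rowsI[OF R(1)])
    \<comment> \<open>Columns without a kept 1-entry get the key \<open>m\<close>, above all row
      numbers, so they never fall between two columns of one row.\<close>
    define owner where "owner c = (if \<exists>r\<in>K. M $$ (r, c) then (SOME r. r \<in> K \<and> M $$ (r, c)) else m)" for c
    have owner_in: "owner c \<in> K \<and> M $$ (owner c, c)" if "r \<in> K" "M $$ (r, c)" for r c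
      using that someI_ex[of "\<lambda>r. r \<in> K \<and> M $$ (r, c)"] by (auto simp: owner_def)
    have owner_none: "owner c = m" if "\<not> (\<exists>r\<in>K. M $$ (r, c))" for c
      unfolding owner_def using that by (rule if_not_P)
    have owner: "owner c = r" if "r \<in> K" "c < m * m" "M $$ (r, c)" for r c
      using unique[of "owner c" r c] owner_in[OF that(1,3)] that by blast
    fix i assume "i \<in> {..<dim_row M} - R"
    then have i: "i \<in> K" "i < m" using R K_le by auto
    show "order_convex owner {..<dim_col M} (\<lambda>j. M $$ (i, j))"
      unfolding order_convex_def dim
    proof (intro ballI impI)
      fix a b c assume *: "a \<in> {..<m * m}" "b \<in> {..<m * m}" "c \<in> {..<m * m}"
        "M $$ (i, a) \<and> M $$ (i, c) \<and> owner a \<le> owner b \<and> owner b \<le> owner c"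
      then have "owner b = i" using owner[OF i(1), of a] owner[OF i(1), of c] by simp
      moreover from this have "\<exists>r\<in>K. M $$ (r, b)" using owner_none[of b] i by auto
      ultimately show "M $$ (i, b)" using owner_in by blast
    qed
  next
    fix j assume j: "j < dim_col M"
    show "order_convex id ({..<dim_row M} - R) (\<lambda>i. M $$ (i, j))"
      unfolding order_convex_def R(2)
    proof (intro ballI impI)
      fix a b c assume "a \<in> K" "b \<in> K" "c \<in> K" "M $$ (a, j) \<and> M $$ (c, j) \<and> id a \<le> id b \<and> id b \<le> id c"
      then show "M $$ (b, j)" using unique[of a c j] j dim by auto
    qed
  qed
  ultimately show ?thesis
    unfolding SC1P_row_deletion_def M_def[symmetric] using R(1) by auto
qed

lemma row_deletion_imp_csp_solvable:
  assumes "(csp_matrix N D bad, csp_deletions N D) \<in> SC1P_row_deletion" "D > 0"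
  shows "csp_solvable N D bad"
proof -
  define t m M where "t = csp_twins N D" and "m = csp_rows N D" and "M = csp_matrix N D bad"
  have t: "t > 0" by (simp add: t_def csp_twins_def)
  have dim: "dim_row M = m" "dim_col M = m * m" by (simp_all add: M_def csp_matrix_def m_def)
  obtain R where R: "R \<subseteq> {..<dim_row M}" "card R \<le> csp_deletions N D" "SC1P (delete_rows M R)"
    using assms(1) unfolding SC1P_row_deletion_def M_def[symmetric] by auto
  define K where "K = {..<m} - R"
  obtain g where g: "\<And>j. j < m * m \<Longrightarrow> order_convex g K (\<lambda>i. M $$ (i, j))"
    using SC1P_delete_rowsD[OF R(1,3)] unfolding dim K_def by metis
  have K: "finite K" "\<And>r. r \<in> K \<Longrightarrow> r < m" by (auto simp: K_def)
  have "card K = m - card R" using R(1) by (simp add: K_def dim card_Diff_subset finite_subset)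
  moreover have "N * t \<le> m" using \<open>D > 0\<close> by (simp add: m_def csp_rows_def t_def)
  ultimately have card_K: "N * t \<le> card K"
    using R(2) by (simp add: csp_deletions_def m_def t_def)
  \<comment> \<open>The column of the pair \<open>(r, r2)\<close> has its 1-entries exactly in these
    two rows, so no third surviving row may lie between them.\<close>
  have no_star: "\<not> (g r \<le> g r1 \<and> g r1 \<le> g r2 \<or> g r2 \<le> g r1 \<and> g r1 \<le> g r)"
    if rs: "r \<in> K" "r1 \<in> K" "r2 \<in> K" "r1 \<noteq> r2" "r \<noteq> r1"
    and confl: "conflict D bad (r div t) (r2 div t)" for r r1 r2
  proof
    assume g12: "g r \<le> g r1 \<and> g r1 \<le> g r2 \<or> g r2 \<le> g r1 \<and> g r1 \<le> g r"
    let ?j = "r * m + r2"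
    have less: "r < m" "r1 < m" "r2 < m" using rs K by auto
    then have j: "?j < m * m" "?j div m = r" "?j mod m = r2" using index_less by auto
    have entry: "M $$ (i, ?j) \<longleftrightarrow> i = r \<or> i = r2" if "i < m" for i
      using that j confl by (simp add: M_def csp_matrix_def csp_entry_def m_def t_def)
    have "M $$ (r1, ?j)"
      using g[OF j(1), unfolded order_convex_def, rule_format, of r r1 r2]
        g[OF j(1), unfolded order_convex_def, rule_format, of r2 r1 r] g12 rs(1-3) entry less by auto
    then show False using entry[OF less(2)] rs by simp
  qed
  define J where "J = {p. p < N * D \<and> 4 \<le> card (K \<inter> {r. r div t = p})}"
  have J_fin: "finite J" "J \<subseteq> {..<N * D}" by (auto simp: J_def)
  have indep: "\<not> conflict D bad p q" if "p \<in> J" "q \<in> J" for p q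
  proof
    assume confl: "conflict D bad p q"
    have "K \<inter> {r. r div t = p} \<noteq> {}" using that(1) by (force simp: J_def)
    then obtain r where r: "r \<in> K" "r div t = p" by blast
    \<comment> \<open>The case \<open>p = q\<close> comes from unary constraints. Then
      \<open>r\<close> itself is one of the twins of \<open>q\<close>; this is why four are required
      to have three others.\<close>
    have "3 \<le> card (K \<inter> {r. r div t = q} - {r})"
      using that(2) K(1) by (cases "r \<in> K \<inter> {r. r div t = q}") (auto simp: J_def)
    then obtain A where A: "A \<subseteq> K \<inter> {r. r div t = q} - {r}" "card A = 3"
      using obtain_subset_with_card_n by metis
    then obtain r1 r2 r3 where "A = {r1, r2, r3}" and d: "r1 \<noteq> r2" "r2 \<noteq> r3" "r1 \<noteq> r3"
      by (auto simp: card_3_iff)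
    with A have *: "r1 \<in> K" "r2 \<in> K" "r3 \<in> K" "r1 div t = q" "r2 div t = q" "r3 div t = q"
      "r \<noteq> r1" "r \<noteq> r2" "r \<noteq> r3" by auto
    note star = no_star[OF r(1), unfolded r(2)]
    show False
      using star[OF *(1,2) d(1) *(7)] star[OF *(1,3) d(3) *(7)] star[OF *(2,1) d(1)[symmetric] *(8)]
        star[OF *(2,3) d(2) *(8)] star[OF *(3,1) d(3)[symmetric] *(9)] star[OF *(3,2) d(2)[symmetric] *(9)]
      unfolding *(4-6) using confl by linarith
  qed
  have "N \<le> card J"
  proof -
    have "K = (\<Union>p\<in>{..<N * D}. K \<inter> {r. r div t = p})"
      using K t by (auto simp: m_def csp_rows_def t_def div_less_iff_less_mult)
    moreover have "card (\<Union>p\<in>{..<N * D}. K \<inter> {r. r div t = p}) = (\<Sum>p<N * D. card (K \<inter> {r. r div t = p}))"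
      using K(1) by (intro card_UN_disjoint) auto
    ultimately have "card K = (\<Sum>p<N * D. card (K \<inter> {r. r div t = p}))" by simp
    also have "\<dots> \<le> (\<Sum>p<N * D. (if p \<in> J then t else 0) + 3)"
    proof (rule sum_mono)
      fix p assume "p \<in> {..<N * D}"
      moreover have "card (K \<inter> {r. r div t = p}) \<le> t"
        using card_mono[OF card_block(2)[OF t], of "K \<inter> {r. r div t = p}" p] card_block(1)[OF t] by simp
      ultimately show "card (K \<inter> {r. r div t = p}) \<le> (if p \<in> J then t else 0) + 3"
        by (auto simp: J_def)
    qed
    also have "\<dots> = card J * t + 3 * (N * D)"
      using J_fin by (simp add: sum.distrib sum.If_cases inf.absorb2)
    \<comment> \<open>Three rows from each of the \<open>N * D\<close> vertices are together fewer
      than one class, by the choice of \<open>csp_twins\<close>.\<close>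
    also have "\<dots> < Suc (card J) * t" by (simp add: t_def csp_twins_def)
    finally have "N * t < Suc (card J) * t" using card_K by linarith
    then show ?thesis by (simp only: mult_less_cancel2) simp
  qed
  \<comment> \<open>Values of one variable conflict, so \<open>J\<close> has at most one vertex per
    variable; as it has \<open>N\<close> elements, it has exactly one.\<close>
  have inj: "inj_on (\<lambda>p. p div D) J"
    using indep unfolding conflict_def inj_on_def by blast
  have sub: "(\<lambda>p. p div D) ` J \<subseteq> {..<N}"
    using J_fin(2) \<open>D > 0\<close> by (auto simp: div_less_iff_less_mult)
  have image: "(\<lambda>p. p div D) ` J = {..<N}"
  proof (rule card_subset_eq[OF _ sub])
    show "card ((\<lambda>p. p div D) ` J) = card {..<N}"
      using \<open>N \<le> card J\<close> card_image[OF inj] card_mono[OF _ sub] by simp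
  qed simp
  have "\<exists>p. p \<in> J \<and> p div D = v" if "v < N" for v
    using image that by (metis (no_types, lifting) imageE lessThan_iff)
  then obtain P where P: "\<And>v. v < N \<Longrightarrow> P v \<in> J \<and> P v div D = v" by metis
  have \<alpha>: "v * D + P v mod D \<in> J" if "v < N" for v
    using P[OF that] by (metis div_mult_mod_eq)
  show ?thesis
    unfolding csp_solvable_def
  proof (intro exI[of _ "\<lambda>v. P v mod D"] conjI allI impI)
    show "P v mod D < D" for v using \<open>D > 0\<close> by simp
    show "\<not> bad (v * D + P v mod D) (v' * D + P v' mod D)" if "v < N" "v' < N" for v v'
      using indep[OF \<alpha>[OF that(1)] \<alpha>[OF that(2)]] by (simp add: conflict_def)
  qed
qed

section \<open>Computability of the constructed instance\<close>

lemma ptn_csp_twins: "ptn vs n \<Longrightarrow> ptn vs (\<lambda>e. csp_twins (n e) D)"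
  unfolding csp_twins_def by (intro pt_intros)

lemma ptn_csp_rows: "ptn vs n \<Longrightarrow> ptn vs (\<lambda>e. csp_rows (n e) D)"
  unfolding csp_rows_def by (intro pt_intros ptn_csp_twins)

lemma ptn_csp_deletions: "ptn vs n \<Longrightarrow> ptn vs (\<lambda>e. csp_deletions (n e) D)"
  unfolding csp_deletions_def by (intro pt_intros ptn_csp_twins ptn_csp_rows)

lemma encode_csp:
  "encode (csp_matrix N D bad, k) = delimit (binary k) @
     delimit (map (\<lambda>i. True) [0..<csp_rows N D * csp_rows N D]) @
     concat (map (\<lambda>r. delimit (map (\<lambda>c. csp_entry N D bad r c) [0..<csp_rows N D * csp_rows N D]))
       [0..<csp_rows N D])"
proof -
  have "mat_to_list (csp_matrix N D bad) =
      map (\<lambda>r. map (\<lambda>c. csp_entry N D bad r c) [0..<csp_rows N D * csp_rows N D]) [0..<csp_rows N D]"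
    by (simp add: mat_to_list_def csp_matrix_def)
  then show ?thesis by (simp add: encode_def csp_matrix_def comp_def map_replicate_const)
qed

text \<open>The hypothesis on \<open>bad\<close> has the shape in which it occurs in an entry:
  \<open>snd (fst q)\<close> is the row, \<open>snd q\<close> the column, and div and mod turn the
  column into a pair of rows and these into vertices.\<close>

lemma pt_encode_csp:
  assumes N: "ptn vs N"
    and bad: "ptb (ext_nat (ext_nat vs)) (\<lambda>q. bad (fst (fst q))
      (snd q div csp_rows (N (fst (fst q))) D div csp_twins (N (fst (fst q))) D)
      (snd q mod csp_rows (N (fst (fst q))) D div csp_twins (N (fst (fst q))) D))"
  shows "pt vs (\<lambda>e. encode (csp_matrix (N e) D (bad e), csp_deletions (N e) D))"
  unfolding encode_csp csp_entry_def conflict_def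
  by (intro bad pt_binary ptn_div ptn_mod pt_intros ptn_csp_twins ptn_csp_rows ptn_csp_deletions N)


section \<open>Computations as constraint satisfaction\<close>

text \<open>
  A cell of the tableau describes one tape position at one time: for every tape the symbol there and
  whether the head is there. It also repeats the control state and all scanned symbols, so that
  the transition is known locally and all constraints are between two cells.
\<close>

datatype cell = Cell (cell_state: nat) (cell_scanned: "nat list")
  (cell_symbols: "nat list") (cell_heads: "bool list")

text \<open>A halted machine is given an idling transition, so that the tableau needs no separate
  rule for it.\<close>

definition transition :: "tm \<Rightarrow> nat \<Rightarrow> nat list \<Rightarrow> nat \<times> (nat \<times> move) list" where
  "transition T q ss = (if q < nstates T then delta T q ss else (q, map (\<lambda>s. (s, Stay)) ss))"

definition cell_of :: "config \<Rightarrow> int \<Rightarrow> cell" where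
  "cell_of cf z = Cell (fst cf) (map scanned (snd cf)) (map (\<lambda>\<tau>. fst \<tau> z) (snd cf))
     (map (\<lambda>\<tau>. snd \<tau> = z) (snd cf))"

lemma step_transition:
  "step T (q, ts) = (case transition T q (map scanned ts) of (q', as) \<Rightarrow> (q', map2 act as ts))"
proof -
  have "map2 act (map (\<lambda>s. (s, Stay)) (map scanned ts)) ts = ts"
    by (rule nth_equalityI) simp_all
  then show ?thesis by (simp add: transition_def)
qed

locale verifier =
  fixes T :: tm and V :: "bool list \<Rightarrow> bool list \<Rightarrow> bool" and pw pr :: "nat poly"
  assumes wf: "wf_tm T" and two_tapes: "2 \<le> ntapes T"
    and computes: "computes_within T [x, u] (poly pr (length x + length u)) [V x u]"
begin

section \<open>Cells and constraints of the tableau\<close>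

definition cells :: "cell set" where
  "cells = (\<lambda>(q, ss, sy, fl). Cell q ss sy fl) ` ({..nstates T} \<times>
     {ss. set ss \<subseteq> {..<nsymbols T} \<and> length ss = ntapes T} \<times>
     {sy. set sy \<subseteq> {..<nsymbols T} \<and> length sy = ntapes T} \<times>
     {fl. set fl \<subseteq> UNIV \<and> length fl = ntapes T})"

definition D :: nat where
  "D = card cells"

text \<open>Any enumeration will do, even one chosen abstractly: it enters the reduction only
  through finite tables over \<open>{..<D}\<close>.\<close>

definition decode :: "nat \<Rightarrow> cell" where
  "decode = (SOME f. bij_betw f {..<D} cells)"

lemma finite_cells: "finite cells"
  unfolding cells_def by (intro finite_imageI finite_cartesian_product finite_lists_length_eq) auto

lemma bij_decode: "bij_betw decode {..<D} cells"
proof -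
  obtain f where "bij_betw f {..<D} cells"
    using ex_bij_betw_nat_finite[OF finite_cells] by (auto simp: D_def atLeast0LessThan)
  then show ?thesis unfolding decode_def using someI_ex[of "\<lambda>f. bij_betw f {..<D} cells"] by blast
qed

lemma decode_in: "a < D \<Longrightarrow> decode a \<in> cells"
  using bij_decode by (auto simp: bij_betw_def)

lemma decode_ex: "c \<in> cells \<Longrightarrow> \<exists>a<D. decode a = c"
  using bij_decode by (metis bij_betw_imp_surj_on imageE lessThan_iff)

lemma D_pos: "0 < D"
proof -
  have "nsymbols T \<ge> 3" using wf by (simp add: wf_tm_def)
  then have "Cell 0 (replicate (ntapes T) 0) (replicate (ntapes T) 0) (replicate (ntapes T) False) \<in> cells"
    unfolding cells_def by (intro image_eqI[where x = "(0, replicate (ntapes T) 0, replicate (ntapes T) 0, replicate (ntapes T) False)"]) auto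
  then show ?thesis using finite_cells by (auto simp: D_def card_gt_0_iff)
qed

definition witness_bound :: "nat \<Rightarrow> nat" where
  "witness_bound n = poly pw n"

text \<open>A time bound for all witnesses of admissible length at once; earlier halts are harmless,
  as the configuration no longer changes.\<close>

definition horizon :: "nat \<Rightarrow> nat" where
  "horizon n = poly pr (n + witness_bound n)"

text \<open>
  Position \<open>i\<close> stands for tape cell \<open>i - centre n\<close>. The window is so wide that what happens at its
  borders does not matter up to time \<open>horizon n\<close>.
\<close>

definition centre :: "nat \<Rightarrow> nat" where
  "centre n = 2 * horizon n + 2 + witness_bound n"

definition width :: "nat \<Rightarrow> nat" where
  "width n = 2 * centre n"

definition num_vars :: "nat \<Rightarrow> nat" where
  "num_vars n = Suc (horizon n) * width n"

text \<open>Imposed on all pairs of cells at one time, this spreads the symbol under each head to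
  the whole row of the tableau.\<close>

definition scans_match :: "cell \<Rightarrow> cell \<Rightarrow> bool" where
  "scans_match a b \<longleftrightarrow> (\<forall>k<ntapes T. cell_heads a ! k \<longrightarrow> cell_scanned b ! k = cell_symbols a ! k)"

definition updated :: "cell \<Rightarrow> cell \<Rightarrow> bool" where
  "updated a b \<longleftrightarrow> (case transition T (cell_state a) (cell_scanned a) of (q, as) \<Rightarrow>
     cell_state b = q \<and> (\<forall>k<ntapes T. cell_symbols b ! k =
       (if cell_heads a ! k then fst (as ! k) else cell_symbols a ! k)))"

text \<open>\<open>a\<close> is the cell from which a head moving by \<open>d\<close> enters
  \<open>b\<close>. For such a tape this one cell decides the head mark of \<open>b\<close>, which
  keeps the constraint binary.\<close>

definition shifted :: "move \<Rightarrow> cell \<Rightarrow> cell \<Rightarrow> bool" where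
  "shifted d a b \<longleftrightarrow> (\<forall>k<ntapes T. snd (snd (transition T (cell_state a) (cell_scanned a)) ! k) = d \<longrightarrow>
     cell_heads b ! k = cell_heads a ! k)"

definition started :: "cell \<Rightarrow> bool" where
  "started a \<longleftrightarrow> cell_state a = 0 \<and> cell_symbols a ! 1 < 3 \<and>
     (\<forall>k<ntapes T. 2 \<le> k \<longrightarrow> cell_symbols a ! k = 0)"

definition heads_are :: "bool \<Rightarrow> cell \<Rightarrow> bool" where
  "heads_are b a \<longleftrightarrow> (\<forall>k<ntapes T. cell_heads a ! k = b)"

definition symbol_is :: "nat \<Rightarrow> nat \<Rightarrow> cell \<Rightarrow> bool" where
  "symbol_is k s a \<longleftrightarrow> cell_symbols a ! k = s"

text \<open>Tape 1 may hold any bits or blanks on the first \<open>witness_bound\<close> positions: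
  there the witness is guessed. Cases are spelled out so that each conjunct combines arithmetic in
  \<open>i\<close> with a fixed predicate of the cell.\<close>

definition initial :: "bool list \<Rightarrow> nat \<Rightarrow> cell \<Rightarrow> bool" where
  "initial x i a \<longleftrightarrow> started a \<and>
     (i = centre (length x) \<longrightarrow> heads_are True a) \<and> (i \<noteq> centre (length x) \<longrightarrow> heads_are False a) \<and>
     (centre (length x) \<le> i \<and> i - centre (length x) < length x \<longrightarrow>
       (i - centre (length x) < length x \<and> x ! (i - centre (length x)) \<longrightarrow> symbol_is 0 2 a) \<and>
       (\<not> (i - centre (length x) < length x \<and> x ! (i - centre (length x))) \<longrightarrow> symbol_is 0 1 a)) \<and>
     (\<not> (centre (length x) \<le> i \<and> i - centre (length x) < length x) \<longrightarrow> symbol_is 0 0 a) \<and>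
     (\<not> (centre (length x) \<le> i \<and> i - centre (length x) < witness_bound (length x)) \<longrightarrow> symbol_is 1 0 a)"

text \<open>The condition on adjacent cells at time 0 forbids gaps in the guessed word. The last
  condition is acceptance: the symbol of bit 1 in output cell 0.\<close>

definition compatible :: "bool list \<Rightarrow> nat \<Rightarrow> nat \<Rightarrow> cell \<Rightarrow> nat \<Rightarrow> nat \<Rightarrow> cell \<Rightarrow> bool" where
  "compatible x t i a t' i' a' \<longleftrightarrow>
     (t = t' \<longrightarrow> scans_match a a') \<and>
     (t' = Suc t \<longrightarrow> (i' = i \<longrightarrow> updated a a' \<and> shifted Stay a a') \<and>
       (i' = Suc i \<longrightarrow> shifted Move_Right a a') \<and> (Suc i' = i \<longrightarrow> shifted Move_Left a a')) \<and>
     (t = 0 \<longrightarrow> initial x i a) \<and>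
     (t = 0 \<and> t' = 0 \<and> centre (length x) \<le> i \<and> i' = Suc i \<and> symbol_is 1 0 a \<longrightarrow> symbol_is 1 0 a') \<and>
     (t = horizon (length x) \<and> i = centre (length x) \<longrightarrow> symbol_is 0 2 a)"

definition bad :: "bool list \<Rightarrow> nat \<Rightarrow> nat \<Rightarrow> bool" where
  "bad x p p' \<longleftrightarrow> \<not> compatible x
     (p div D div width (length x)) (p div D mod width (length x)) (decode (p mod D))
     (p' div D div width (length x)) (p' div D mod width (length x)) (decode (p' mod D))"

definition tableau :: "bool list \<Rightarrow> (nat \<Rightarrow> nat \<Rightarrow> cell) \<Rightarrow> bool" where
  "tableau x A \<longleftrightarrow> (\<forall>t\<le>horizon (length x). \<forall>i<width (length x). A t i \<in> cells \<and>
     (\<forall>t'\<le>horizon (length x). \<forall>i'<width (length x). compatible x t i (A t i) t' i' (A t' i')))"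

text \<open>Variable \<open>t * W + i\<close> is the cell at time \<open>t\<close> and position
  \<open>i\<close>.\<close>

lemma csp_solvable_iff_tableau:
  "csp_solvable (num_vars (length x)) D (bad x) \<longleftrightarrow> (\<exists>A. tableau x A)"
proof -
  define H W where "H = horizon (length x)" and "W = width (length x)"
  have W: "W > 0" by (simp add: W_def width_def centre_def)
  have N: "num_vars (length x) = Suc H * W" by (simp add: num_vars_def H_def W_def)
  show ?thesis
  proof
    assume "csp_solvable (num_vars (length x)) D (bad x)"
    then obtain \<alpha> where \<alpha>: "\<And>v. v < Suc H * W \<Longrightarrow> \<alpha> v < D"
      "\<And>v v'. v < Suc H * W \<Longrightarrow> v' < Suc H * W \<Longrightarrow> \<not> bad x (v * D + \<alpha> v) (v' * D + \<alpha> v')"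
      unfolding csp_solvable_def N by blast
    define A where "A t i = decode (\<alpha> (t * W + i))" for t i
    have "tableau x A"
      unfolding tableau_def H_def[symmetric] W_def[symmetric]
    proof (intro allI impI conjI)
      fix t i assume "t \<le> H" "i < W"
      then have v: "t * W + i < Suc H * W" using index_less[of t "Suc H" i W] by simp
      then show "A t i \<in> cells" using \<alpha>(1) decode_in by (simp add: A_def)
      fix t' i' assume "t' \<le> H" "i' < W"
      then have v': "t' * W + i' < Suc H * W" using index_less[of t' "Suc H" i' W] by simp
      show "compatible x t i (A t i) t' i' (A t' i')"
        using \<alpha>(2)[OF v v'] \<alpha>(1)[OF v] \<alpha>(1)[OF v'] \<open>i < W\<close> \<open>i' < W\<close>
        by (simp add: bad_def W_def[symmetric] A_def)
    qed
    then show "\<exists>A. tableau x A" by blast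
  next
    assume "\<exists>A. tableau x A"
    then obtain A where A: "\<And>t i. t \<le> H \<Longrightarrow> i < W \<Longrightarrow> A t i \<in> cells"
      "\<And>t i t' i'. t \<le> H \<Longrightarrow> i < W \<Longrightarrow> t' \<le> H \<Longrightarrow> i' < W \<Longrightarrow> compatible x t i (A t i) t' i' (A t' i')"
      unfolding tableau_def H_def W_def by blast
    define \<alpha> where "\<alpha> v = (SOME a. a < D \<and> decode a = A (v div W) (v mod W))" for v
    have less: "v div W \<le> H" "v mod W < W" if "v < Suc H * W" for v
      using that W by (auto simp: div_less_iff_less_mult less_Suc_eq_le[symmetric])
    have \<alpha>: "\<alpha> v < D \<and> decode (\<alpha> v) = A (v div W) (v mod W)" if "v < Suc H * W" for v
      unfolding \<alpha>_def by (rule someI_ex) (use decode_ex[OF A(1)[OF less[OF that]]] in blast)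
    show "csp_solvable (num_vars (length x)) D (bad x)"
      unfolding csp_solvable_def N
    proof (intro exI conjI allI impI)
      fix v v' assume v: "v < Suc H * W" "v' < Suc H * W"
      then show "\<alpha> v < D" using \<alpha> by blast
      show "\<not> bad x (v * D + \<alpha> v) (v' * D + \<alpha> v')"
        using A(2)[OF less[OF v(1)] less[OF v(2)]] \<alpha>[OF v(1)] \<alpha>[OF v(2)]
        by (simp add: bad_def W_def[symmetric])
    qed
  qed
qed

section \<open>Runs of the verifier and their cells\<close>

definition run :: "bool list \<Rightarrow> bool list \<Rightarrow> nat \<Rightarrow> config" where
  "run x u t = (step T ^^ t) (init_config T [x, u])"

lemma run_0: "run x u 0 = (0, map (\<lambda>k. tape_of (if k = 0 then x else if k = 1 then u else [])) [0..<ntapes T])"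
  by (auto simp: run_def init_config_def numeral_2_eq_2 less_Suc_eq)

lemma run_Suc: "run x u (Suc t) = step T (run x u t)"
  by (simp add: run_def)

lemma transition_wf:
  assumes "q \<le> nstates T" "length ss = ntapes T" "set ss \<subseteq> {..<nsymbols T}"
  shows "fst (transition T q ss) \<le> nstates T" "length (snd (transition T q ss)) = ntapes T"
    "fst ` set (snd (transition T q ss)) \<subseteq> {..<nsymbols T}"
proof -
  have "fst (transition T q ss) \<le> nstates T \<and> length (snd (transition T q ss)) = ntapes T \<and>
    fst ` set (snd (transition T q ss)) \<subseteq> {..<nsymbols T}"
  proof (cases "q < nstates T")
    case True
    obtain q' as where d: "delta T q ss = (q', as)" by fastforce
    have "case delta T q ss of (q', as) \<Rightarrow>
        q' \<le> nstates T \<and> length as = ntapes T \<and> fst ` set as \<subseteq> {..<nsymbols T}"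
      by (rule wf[unfolded wf_tm_def, THEN conjunct2, THEN conjunct2, rule_format]) (use True assms in simp)
    then show ?thesis using True d by (simp add: transition_def)
  next
    case False
    then show ?thesis using assms by (auto simp: transition_def)
  qed
  then show "fst (transition T q ss) \<le> nstates T" "length (snd (transition T q ss)) = ntapes T"
    "fst ` set (snd (transition T q ss)) \<subseteq> {..<nsymbols T}" by blast+
qed

text \<open>A head moves by at most one per step, so it stays within distance \<open>t\<close> of
  the start; this is what makes a finite window suffice.\<close>

lemma run_wf:
  "fst (run x u t) \<le> nstates T \<and> length (snd (run x u t)) = ntapes T \<and>
   (\<forall>k<ntapes T. (\<forall>z. fst (snd (run x u t) ! k) z < nsymbols T) \<and> \<bar>snd (snd (run x u t) ! k)\<bar> \<le> int t)"
proof (induction t)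
  case 0
  have "nsymbols T \<ge> 3" using wf by (simp add: wf_tm_def)
  then show ?case by (simp add: run_0 tape_of_def bit_symbol_def)
next
  case (Suc t)
  obtain q ts where r: "run x u t = (q, ts)" by fastforce
  have len: "length ts = ntapes T" using Suc r by simp
  have scan: "scanned (ts ! k) < nsymbols T" if "k < ntapes T" for k
    using Suc r that by (cases "ts ! k") (metis fst_conv scanned.simps snd_conv)
  then have ss: "set (map scanned ts) \<subseteq> {..<nsymbols T}"
  proof -
    have "\<forall>\<tau>\<in>set ts. scanned \<tau> < nsymbols T" using scan len by (simp add: all_set_conv_all_nth)
    then show ?thesis by auto
  qed
  obtain q' as where tr: "transition T q (map scanned ts) = (q', as)" by fastforce
  have q: "q \<le> nstates T" using Suc r by simp
  have wf': "q' \<le> nstates T" "length as = ntapes T" "fst ` set as \<subseteq> {..<nsymbols T}"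
    using transition_wf[OF q _ ss] len tr by simp_all
  have next_run: "run x u (Suc t) = (q', map2 act as ts)"
    using tr by (simp add: run_Suc r step_transition del: step.simps)
  have "(\<forall>z. fst (act (as ! k) (ts ! k)) z < nsymbols T) \<and> \<bar>snd (act (as ! k) (ts ! k))\<bar> \<le> int (Suc t)"
    if k: "k < ntapes T" for k
  proof -
    obtain c h where ch: "ts ! k = (c, h)" by fastforce
    obtain s d where sd: "as ! k = (s, d)" by fastforce
    have "as ! k \<in> set as" using k wf'(2) by simp
    then have "s < nsymbols T" using wf'(3) sd by force
    moreover have "(\<forall>z. c z < nsymbols T) \<and> \<bar>h\<bar> \<le> int t" using Suc k ch r by auto
    moreover have "\<bar>offset d\<bar> \<le> 1" by (cases d) auto
    ultimately show ?thesis using ch sd by auto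
  qed
  then show ?case using wf' len by (simp add: next_run)
qed

lemma run_symbols:
  "set (map scanned (snd (run x u t))) \<subseteq> {..<nsymbols T}"
  "set (map (\<lambda>\<tau>. fst \<tau> z) (snd (run x u t))) \<subseteq> {..<nsymbols T}"
proof -
  have *: "\<forall>\<tau>\<in>set (snd (run x u t)). \<forall>z. fst \<tau> z < nsymbols T"
    using run_wf[of x u t] by (simp add: all_set_conv_all_nth)
  have "scanned \<tau> = fst \<tau> (snd \<tau>)" for \<tau> by (cases \<tau>) simp
  with * show "set (map scanned (snd (run x u t))) \<subseteq> {..<nsymbols T}" by auto
  from * show "set (map (\<lambda>\<tau>. fst \<tau> z) (snd (run x u t))) \<subseteq> {..<nsymbols T}" by auto
qed

lemma cell_of_in_cells: "cell_of (run x u t) z \<in> cells"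
  unfolding cells_def cell_of_def
  by (rule image_eqI[where x = "(fst (run x u t), map scanned (snd (run x u t)),
      map (\<lambda>\<tau>. fst \<tau> z) (snd (run x u t)), map (\<lambda>\<tau>. snd \<tau> = z) (snd (run x u t)))"])
     (use run_wf[of x u t] run_symbols in auto)

lemma cell_of_step:
  assumes "run x u t = (q, ts)" "transition T q (map scanned ts) = (q', as)"
  shows "cell_state (cell_of (run x u (Suc t)) z) = q'"
    "k < ntapes T \<Longrightarrow> cell_symbols (cell_of (run x u (Suc t)) z) ! k =
       (if snd (ts ! k) = z then fst (as ! k) else fst (ts ! k) z)"
    "k < ntapes T \<Longrightarrow> cell_heads (cell_of (run x u (Suc t)) z) ! k \<longleftrightarrow>
       snd (ts ! k) + offset (snd (as ! k)) = z"
proof -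
  have len: "length ts = ntapes T" using run_wf[of x u t] assms(1) by simp
  have "q \<le> nstates T" "set (map scanned ts) \<subseteq> {..<nsymbols T}"
    using run_wf[of x u t] run_symbols(1)[of x u t] assms(1) by auto
  then have len': "length as = ntapes T"
    using transition_wf(2)[of q "map scanned ts"] len assms(2) by simp
  have next_run: "run x u (Suc t) = (q', map2 act as ts)"
    using assms by (simp add: run_Suc step_transition del: step.simps)
  obtain c h where ch: "ts ! k = (c, h)" by fastforce
  obtain s d where sd: "as ! k = (s, d)" by fastforce
  show "cell_state (cell_of (run x u (Suc t)) z) = q'" by (simp add: next_run cell_of_def)
  assume "k < ntapes T"
  then show "cell_symbols (cell_of (run x u (Suc t)) z) ! k =
       (if snd (ts ! k) = z then fst (as ! k) else fst (ts ! k) z)"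
    "cell_heads (cell_of (run x u (Suc t)) z) ! k \<longleftrightarrow> snd (ts ! k) + offset (snd (as ! k)) = z"
    using len len' ch sd by (auto simp: next_run cell_of_def)
qed

lemma cell_of_simps:
  assumes "run x u t = (q, ts)"
  shows "cell_state (cell_of (run x u t) z) = q"
    "cell_scanned (cell_of (run x u t) z) = map scanned ts"
    "k < ntapes T \<Longrightarrow> cell_symbols (cell_of (run x u t) z) ! k = fst (ts ! k) z"
    "k < ntapes T \<Longrightarrow> cell_heads (cell_of (run x u t) z) ! k \<longleftrightarrow> snd (ts ! k) = z"
  using assms run_wf[of x u t] by (simp_all add: cell_of_def)

lemma run_accept:
  assumes "length u \<le> witness_bound (length x)"
  shows "fst (snd (run x u (horizon (length x))) ! 0) 0 = bit_symbol (V x u)"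
proof -
  define t where "t = poly pr (length x + length u)"
  have "t \<le> horizon (length x)"
    unfolding t_def horizon_def using assms by (intro poly_mono_nat) simp
  have c: "fst (run x u t) = nstates T" "output_word (run x u t) [V x u]"
    using computes[of x u] by (auto simp: computes_within_def run_def t_def Let_def)
  then have "step T (run x u t) = run x u t" by (cases "run x u t") simp
  then have "(step T ^^ (horizon (length x) - t)) (run x u t) = run x u t"
    by (rule funpow_fixpoint)
  then have "run x u (t + (horizon (length x) - t)) = run x u t"
    unfolding run_def by (intro funpow_append) auto
  then have "run x u (horizon (length x)) = run x u t"
    using \<open>t \<le> horizon (length x)\<close> by simp
  then show ?thesis using c(2) by (auto simp: output_word_def)
qed

text \<open>Cells read off a genuine run satisfy the constraints at every position, so the borders
  need no attention in this direction.\<close>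

lemma tableau_complete:
  assumes "length u \<le> witness_bound (length x)" "V x u"
  shows "\<exists>A. tableau x A"
proof -
  define C where "C = centre (length x)"
  define A where "A t i = cell_of (run x u t) (int i - int C)" for t i
  have "compatible x t i (A t i) t' i' (A t' i')" for t i t' i'
    unfolding compatible_def
  proof (intro conjI impI)
    obtain q ts where r: "run x u t = (q, ts)" by fastforce
    obtain q' as where tr: "transition T q (map scanned ts) = (q', as)" by fastforce
    have len: "length ts = ntapes T" using run_wf[of x u t] r by simp
    show "scans_match (A t i) (A t' i')" if "t = t'"
      unfolding scans_match_def
    proof (intro allI impI)
      fix k assume k: "k < ntapes T" "cell_heads (A t i) ! k"
      then show "cell_scanned (A t' i') ! k = cell_symbols (A t i) ! k"
        using cell_of_simps[OF r] \<open>t = t'\<close> len by (cases "ts ! k") (auto simp: A_def)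
    qed
    show "updated (A t i) (A t' i')" if "t' = Suc t" "i' = i"
      using cell_of_step[OF r tr] cell_of_simps[OF r] tr that
      by (auto simp: updated_def A_def)
    show "shifted Stay (A t i) (A t' i')" if "t' = Suc t" "i' = i"
      using cell_of_step[OF r tr] cell_of_simps[OF r] tr that
      by (auto simp: shifted_def A_def)
    show "shifted Move_Right (A t i) (A t' i')" if "t' = Suc t" "i' = Suc i"
      using cell_of_step[OF r tr] cell_of_simps[OF r] tr that
      by (auto simp: shifted_def A_def)
    show "shifted Move_Left (A t i) (A t' i')" if "t' = Suc t" "Suc i' = i"
      using cell_of_step[OF r tr] cell_of_simps[OF r] tr that
      by (auto simp: shifted_def A_def)
    have sym: "cell_symbols (A 0 j) ! k = (let w = (if k = 0 then x else if k = 1 then u else []) in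
        if C \<le> j \<and> j - C < length w then bit_symbol (w ! (j - C)) else 0)" if "k < ntapes T" for j k
      using that by (auto simp: A_def cell_of_def run_0 tape_of_def Let_def nat_diff_distrib' simp flip: of_nat_diff)
    have heads: "cell_heads (A 0 j) ! k \<longleftrightarrow> j = C" if "k < ntapes T" for j k
      using that by (auto simp: A_def cell_of_def run_0 tape_of_def)
    have state: "cell_state (A 0 j) = 0" for j by (simp add: A_def cell_of_def run_0)
    show "initial x i (A t i)" if "t = 0"
      using that two_tapes assms(1) state heads sym
      by (auto simp: initial_def C_def[symmetric] started_def heads_are_def symbol_is_def bit_symbol_def Let_def)
    show "symbol_is 1 0 (A t' i')"
      if "t = 0 \<and> t' = 0 \<and> centre (length x) \<le> i \<and> i' = Suc i \<and> symbol_is 1 0 (A t i)"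
      using that two_tapes sym[of 1]
      by (auto simp: symbol_is_def C_def[symmetric] Let_def split: if_splits)
    show "symbol_is 0 2 (A t i)" if "t = horizon (length x) \<and> i = centre (length x)"
      using that two_tapes run_accept[OF assms(1)] assms(2) r cell_of_simps(3)[OF r, of 0]
      by (auto simp: symbol_is_def A_def C_def bit_symbol_def)
  qed
  then have "tableau x A"
    unfolding tableau_def using cell_of_in_cells by (simp add: A_def)
  then show ?thesis by blast
qed


text \<open>Cells at a border lack a neighbour that would determine their heads, so agreement with
  the run recedes by one position per step on either side. The window is so wide that every head up
  to time \<open>H\<close>, and the centre at time \<open>H\<close>, is still in the reliable
  part.\<close>

lemma tableau_sound:
  assumes "tableau x A"
  shows "\<exists>u. length u \<le> witness_bound (length x) \<and> V x u"
proof -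
  define H C W B where "H = horizon (length x)" and "C = centre (length x)"
    and "W = width (length x)" and "B = witness_bound (length x)"
  have sizes: "C = 2 * H + 2 + B" "W = 2 * C"
    by (simp_all add: C_def centre_def H_def B_def W_def width_def)
  have comp: "compatible x t i (A t i) t' i' (A t' i')"
    if "t \<le> H" "i < W" "t' \<le> H" "i' < W" for t i t' i'
    using assms that unfolding tableau_def H_def W_def by blast
  have length_scanned: "length (cell_scanned (A t i)) = ntapes T" if "t \<le> H" "i < W" for t i
  proof -
    have "A t i \<in> cells" using assms that unfolding tableau_def H_def W_def by blast
    then show ?thesis by (auto simp: cells_def)
  qed
  have init: "initial x i (A 0 i)" if "i < W" for i
    using comp[of 0 i 0 i] that by (simp add: compatible_def)
  define s where "s j = cell_symbols (A 0 (C + j)) ! 1" for j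
  \<comment> \<open>The witness is read from tape 1 up to the first blank, but has at most
    \<open>B\<close> symbols.\<close>
  define len where "len = (LEAST j. B \<le> j \<or> s j = 0)"
  have len: "B \<le> len \<or> s len = 0" "len \<le> B"
    unfolding len_def by (rule LeastI[of _ B], simp) (rule Least_le, simp)
  define u where "u = map (\<lambda>j. s j = 2) [0..<len]"
  have s_zero: "s j = 0" if "len \<le> j" "j < C" for j
    using that
  proof (induction j rule: dec_induct)
    \<comment> \<open>At \<open>len\<close> either the bound is reached, and \<open>initial\<close>
      demands a blank, or the symbol is blank already.\<close>
    case base
    then show ?case
      using len(1) init[of "C + len"] sizes
      by (auto simp: initial_def symbol_is_def s_def C_def[symmetric] B_def[symmetric])
  next
    case (step j)
    then show ?case
      using comp[of 0 "C + j" 0 "C + Suc j"] sizes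
      by (simp add: compatible_def symbol_is_def s_def C_def[symmetric])
  qed
  have s_bit: "s j = bit_symbol (u ! j)" if "j < len" for j
  proof -
    have "s j \<noteq> 0" using not_less_Least[of j "\<lambda>j. B \<le> j \<or> s j = 0"] that by (auto simp: len_def)
    moreover have "s j < 3"
      using init[of "C + j"] that len(2) sizes by (simp add: initial_def started_def s_def)
    ultimately show ?thesis using that by (auto simp: u_def bit_symbol_def)
  qed
  define ref where "ref t i = cell_of (run x u t) (int i - int C)" for t i
  \<comment> \<open>The copies of the scanned symbols are left out; they are recovered from the head
    marks by \<open>scans_match\<close>.\<close>
  define agree where "agree t i \<longleftrightarrow> cell_state (A t i) = cell_state (ref t i) \<and>
    (\<forall>k<ntapes T. cell_symbols (A t i) ! k = cell_symbols (ref t i) ! k \<and>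
      cell_heads (A t i) ! k = cell_heads (ref t i) ! k)" for t i
  have scanned: "cell_scanned (A t i) = map scanned (snd (run x u t))"
    if t: "t \<le> H" and i: "i < W" and agr: "\<And>j. t \<le> j \<Longrightarrow> j < W - t \<Longrightarrow> agree t j" for t i
  proof (rule nth_equalityI)
    have len_run: "length (snd (run x u t)) = ntapes T" using run_wf by blast
    show "length (cell_scanned (A t i)) = length (map scanned (snd (run x u t)))"
      using length_scanned[OF t i] len_run by simp
    fix k assume "k < length (cell_scanned (A t i))"
    then have k: "k < ntapes T" using length_scanned[OF t i] by simp
    obtain q ts where r: "run x u t = (q, ts)" by fastforce
    obtain c h where ch: "ts ! k = (c, h)" by fastforce
    have "\<bar>h\<bar> \<le> int t" using run_wf[of x u t] k r ch by auto
    \<comment> \<open>As \<open>2 * H < C\<close>, the position of the head lies in the part of the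
      window that is reliable at time \<open>t\<close>.\<close>
    then have h: "int (nat (int C + h)) = int C + h" "t \<le> nat (int C + h)" "nat (int C + h) < W - t"
      using t sizes by linarith+
    have "agree t (nat (int C + h))" by (rule agr[OF h(2,3)])
    then have "cell_heads (A t (nat (int C + h))) ! k" "cell_symbols (A t (nat (int C + h))) ! k = c h"
      using k ch h(1) cell_of_simps[OF r] by (auto simp: agree_def ref_def)
    moreover have "scans_match (A t (nat (int C + h))) (A t i)"
      using comp[OF t _ t i, of "nat (int C + h)"] h by (simp add: compatible_def)
    ultimately have "cell_scanned (A t i) ! k = c h" using k by (simp add: scans_match_def)
    then show "cell_scanned (A t i) ! k = map scanned (snd (run x u t)) ! k"
      using k r ch len_run by simp
  qed
  have agree: "\<forall>i. t \<le> i \<and> i < W - t \<longrightarrow> agree t i" if "t \<le> H" for t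
    using that
  proof (induction t)
    case 0
    show ?case
    proof (intro allI impI)
      fix i assume "0 \<le> i \<and> i < W - 0"
      then have i: "i < W" by simp
      note ini = init[OF i, unfolded initial_def started_def heads_are_def symbol_is_def C_def[symmetric] B_def[symmetric]]
      note simps = cell_of_simps[OF run_0]
      have heads: "cell_heads (A 0 i) ! k = cell_heads (ref 0 i) ! k" if "k < ntapes T" for k
        using ini simps(4)[of k x u "int i - int C"] that by (cases "i = C") (auto simp: ref_def tape_of_def)
      have "cell_symbols (A 0 i) ! k = cell_symbols (ref 0 i) ! k" if k: "k < ntapes T" for k
      proof -
        consider "k = 0" | "k = 1" | "2 \<le> k" by linarith
        then show ?thesis
        proof cases
          case 1
          then show ?thesis
            using ini simps(3)[of k x u "int i - int C"] k
            by (cases "C \<le> i \<and> i - C < length x")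
               (auto simp: ref_def tape_of_def bit_symbol_def nat_diff_distrib' split: if_splits)
        next
          case 2
          show ?thesis
          proof (cases "C \<le> i")
            case True
            then have "cell_symbols (A 0 i) ! 1 = s (i - C)" by (simp add: s_def)
            also have "\<dots> = (if i - C < len then bit_symbol (u ! (i - C)) else 0)"
              using s_bit[of "i - C"] s_zero[of "i - C"] i sizes by auto
            also have "\<dots> = cell_symbols (ref 0 i) ! 1"
              using simps(3)[of 1 x u "int i - int C"] 2 k True
              by (auto simp: ref_def tape_of_def u_def nat_diff_distrib')
            finally show ?thesis using 2 by simp
          next
            case False
            then show ?thesis
              using ini simps(3)[of k x u "int i - int C"] 2 k by (auto simp: ref_def tape_of_def)
          qed
        next
          case 3
          then show ?thesis
            using ini simps(3)[of k x u "int i - int C"] k by (auto simp: ref_def tape_of_def)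
        qed
      qed
      with heads ini show "agree 0 i"
        using simps(1)[of x u "int i - int C"] by (simp add: agree_def ref_def)
    qed
  next
    case (Suc t)
    then have t: "t \<le> H" "Suc t \<le> H" by simp_all
    have agr: "agree t j" if "t \<le> j" "j < W - t" for j using Suc.IH[OF t(1)] that by blast
    obtain q ts where r: "run x u t = (q, ts)" by fastforce
    obtain q' as where tr: "transition T q (map scanned ts) = (q', as)" by fastforce
    have loc: "transition T (cell_state (A t j)) (cell_scanned (A t j)) = (q', as)"
      if "t \<le> j" "j < W - t" for j
    proof -
      have "cell_state (A t j) = q" using agr[OF that] cell_of_simps(1)[OF r] by (simp add: agree_def ref_def)
      moreover have "cell_scanned (A t j) = map scanned ts" using scanned[OF t(1) _ agr, of j] that r by simp
      ultimately show ?thesis using tr by simp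
    qed
    show ?case
    proof (intro allI impI)
      fix i assume i: "Suc t \<le> i \<and> i < W - Suc t"
      then have cone: "t \<le> i" "i < W - t" "t \<le> i - 1" "i - 1 < W - t" "t \<le> Suc i" "Suc i < W - t"
        "i < W" "i - 1 < W" "Suc i < W" "Suc (i - 1) = i" by linarith+
      have heads: "cell_heads (A t j) ! k \<longleftrightarrow> snd (ts ! k) = int j - int C"
        and symbols: "cell_symbols (A t j) ! k = fst (ts ! k) (int j - int C)"
        if "k < ntapes T" "t \<le> j" "j < W - t" for j k
        using agr[OF that(2,3)] that(1) cell_of_simps[OF r] by (simp_all add: agree_def ref_def)
      note step = cell_of_step[OF r tr, where z = "int i - int C", folded ref_def]
      have "updated (A t i) (A (Suc t) i)" "shifted Stay (A t i) (A (Suc t) i)"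
        using comp[OF t(1) cone(7) t(2) cone(7)] by (simp_all add: compatible_def)
      moreover have "shifted Move_Right (A t (i - 1)) (A (Suc t) i)"
        using comp[OF t(1) cone(8) t(2) cone(7)] cone(10) by (simp add: compatible_def)
      moreover have "shifted Move_Left (A t (Suc i)) (A (Suc t) i)"
        using comp[OF t(1) cone(9) t(2) cone(7)] by (simp add: compatible_def)
      ultimately have upd: "cell_state (A (Suc t) i) = q'"
        "\<And>k. k < ntapes T \<Longrightarrow> cell_symbols (A (Suc t) i) ! k =
          (if cell_heads (A t i) ! k then fst (as ! k) else cell_symbols (A t i) ! k)"
        and stay: "\<And>k. k < ntapes T \<Longrightarrow> snd (as ! k) = Stay \<Longrightarrow> cell_heads (A (Suc t) i) ! k = cell_heads (A t i) ! k"
        and right: "\<And>k. k < ntapes T \<Longrightarrow> snd (as ! k) = Move_Right \<Longrightarrow> cell_heads (A (Suc t) i) ! k = cell_heads (A t (i - 1)) ! k"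
        and left: "\<And>k. k < ntapes T \<Longrightarrow> snd (as ! k) = Move_Left \<Longrightarrow> cell_heads (A (Suc t) i) ! k = cell_heads (A t (Suc i)) ! k"
        using loc[OF cone(1,2)] loc[OF cone(3,4)] loc[OF cone(5,6)]
        by (simp_all add: updated_def shifted_def)
      have "cell_heads (A (Suc t) i) ! k \<longleftrightarrow> snd (ts ! k) + offset (snd (as ! k)) = int i - int C"
        if k: "k < ntapes T" for k
      proof (cases "snd (as ! k)")
        case Move_Left
        then show ?thesis using left[OF k] heads[OF k cone(5,6)] by auto
      next
        case Stay
        then show ?thesis using stay[OF k] heads[OF k cone(1,2)] by auto
      next
        case Move_Right
        have "int (i - 1) = int i - 1" using cone(10) by linarith
        then show ?thesis using Move_Right right[OF k] heads[OF k cone(3,4)] by auto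
      qed
      then show "agree (Suc t) i"
        unfolding agree_def using step upd heads[OF _ cone(1,2)] symbols[OF _ cone(1,2)] by simp
    qed
  qed
  have "length u \<le> B" using len(2) by (simp add: u_def)
  have "agree H C" using agree[of H] sizes by simp
  moreover have "symbol_is 0 2 (A H C)"
    using comp[of H C H C] sizes by (simp add: compatible_def H_def[symmetric] C_def[symmetric])
  ultimately have "fst (snd (run x u H) ! 0) 0 = 2"
    using two_tapes run_wf[of x u H] by (simp add: agree_def symbol_is_def ref_def cell_of_def)
  then have "V x u"
    using run_accept[of u x] \<open>length u \<le> B\<close> by (simp add: H_def B_def)
  then show ?thesis using \<open>length u \<le> B\<close> B_def by blast
qed

section \<open>Computability of the constraints and of the reduction\<close>

lemma ptb_bad:
  assumes "pt vs x" "ptn vs p" "ptn vs p'"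
  shows "ptb vs (\<lambda>e. bad (x e) (p e) (p' e))"
proof -
  \<comment> \<open>Index conditions are arithmetic; conditions on cells depend on residues modulo
    the constant \<open>D\<close> and are tables.\<close>
  have 1: "ptb vs (\<lambda>e. F (decode (f e mod D)))" if "ptn vs f" for F f
    by (rule ptb_table[OF that D_pos, of "\<lambda>i. F (decode i)"])
  have 2: "ptb vs (\<lambda>e. F (decode (f e mod D)) (decode (g e mod D)))" if "ptn vs f" "ptn vs g" for F f g
    by (rule ptb_table2[OF that D_pos, of "\<lambda>i j. F (decode i) (decode j)"])
  have sizes: "ptn vs (\<lambda>e. horizon (f e))" "ptn vs (\<lambda>e. witness_bound (f e))"
    "ptn vs (\<lambda>e. centre (f e))" "ptn vs (\<lambda>e. width (f e))" if "ptn vs f" for f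
    unfolding horizon_def witness_bound_def centre_def width_def
    by (intro ptn_poly pt_intros that)+
  show ?thesis
    unfolding bad_def compatible_def initial_def
    by (intro ptb_not ptb_conj ptb_imp ptb_eq ptb_le ptb_less ptb_nth 1 2 sizes assms ptn_length ptn_diff ptn_div ptn_mod
        ptn_const ptn_Suc)
qed

lemma poly_time_reducible_csp:
  "poly_time_reducible {x. \<exists>u. length u \<le> poly pw (length x) \<and> V x u} (encode ` SC1P_row_deletion)"
proof -
  define f where "f x = encode (csp_matrix (num_vars (length x)) D (bad x), csp_deletions (num_vars (length x)) D)" for x
  let ?vs = "map (\<lambda>i ws. ws ! i) [0..<1] :: (bool list list \<Rightarrow> bool list) list"
  have x: "pt ?vs (\<lambda>ws. ws ! 0)" by (rule pt_var) simp
  have N: "ptn ?vs (\<lambda>ws. num_vars (length (ws ! 0)))"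
    unfolding num_vars_def width_def centre_def horizon_def witness_bound_def
    by (intro ptn_poly pt_intros x)
  have "pt ?vs (\<lambda>ws. f (ws ! 0))"
    unfolding f_def
    by (rule pt_encode_csp[OF N]) (intro ptb_bad ptn_div ptn_mod ptn_csp_twins ptn_csp_rows ptn_snd pt_weaken_nat ptn_weaken_nat N x)
  then have "poly_time_computable 1 (\<lambda>ws. f (ws ! 0))"
    by (rule pt_poly_time_computable[OF order_refl])
  moreover have "(\<exists>u. length u \<le> poly pw (length x) \<and> V x u) \<longleftrightarrow> f x \<in> encode ` SC1P_row_deletion" for x
  proof -
    have "(\<exists>u. length u \<le> poly pw (length x) \<and> V x u) \<longleftrightarrow> csp_solvable (num_vars (length x)) D (bad x)"
      using tableau_sound tableau_complete csp_solvable_iff_tableau unfolding witness_bound_def by blast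
    also have "\<dots> \<longleftrightarrow> (csp_matrix (num_vars (length x)) D (bad x), csp_deletions (num_vars (length x)) D) \<in> SC1P_row_deletion"
      using csp_solvable_imp_row_deletion row_deletion_imp_csp_solvable[OF _ D_pos] by blast
    \<comment> \<open>As \<open>encode\<close> is injective, \<open>f x\<close> represents no other
      instance.\<close>
    also have "\<dots> \<longleftrightarrow> f x \<in> encode ` SC1P_row_deletion"
      unfolding f_def using inj_encode by (simp add: inj_image_mem_iff)
    finally show ?thesis .
  qed
  ultimately show ?thesis unfolding poly_time_reducible_def by auto
qed

end

theorem SC1P_row_deletion_NP_hard: "NP_hard (encode ` SC1P_row_deletion)"
  unfolding NP_hard_def
proof
  fix L assume "L \<in> NP"
  then obtain V pw where V: "poly_time_computable 2 (\<lambda>ws. [V (ws ! 0) (ws ! 1)])"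
    and L: "\<And>x. x \<in> L \<longleftrightarrow> (\<exists>u. length u \<le> poly pw (length x) \<and> V x u)"
    unfolding NP_def by blast
  from V obtain T pr where T: "wf_tm T" "2 \<le> ntapes T"
    "\<And>ws. length ws = 2 \<Longrightarrow> computes_within T ws (poly pr (sum_list (map length ws))) [V (ws ! 0) (ws ! 1)]"
    unfolding poly_time_computable_def by blast
  interpret verifier T V pw pr
    by unfold_locales (use T(1,2) T(3)[of "[_, _]"] in simp_all)
  have "L = {x. \<exists>u. length u \<le> poly pw (length x) \<and> V x u}" using L by blast
  then show "poly_time_reducible L (encode ` SC1P_row_deletion)"
    using poly_time_reducible_csp by simp
qed

theorem theorem5:
  shows "NP_complete (encode ` SC1P_row_deletion)"
  unfolding NP_complete_def using SC1P_row_deletion_in_NP SC1P_row_deletion_NP_hard by blast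

end
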